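(* Let $\mathfrak h\subset\mathfrak g$ be simple complex Lie algebras with $\mathfrak t_{\mathfrak h}\subset\mathfrak t$, and let $\Sigma'$ be the branching semigroup of the pair. For a dominant weight $\lambda$ of $\mathfrak g$ let $\Sigma'(\lambda)$ be the set of signatures in $\Sigma'$ with highest weight $\lambda$, and write $$V_{\mathfrak g}(\lambda)|_{\mathfrak h}=\bigoplus_{\lambda'}m_{\lambda,\lambda'}V_{\mathfrak h}(\lambda'),$$ where $\lambda'$ runs over the dominant weights of $\mathfrak h$ and $m_{\lambda,\lambda'}\in\mathbb Z_{\ge 0}$ are the multiplicities. Then for all $\lambda,\lambda'$ the multiplicity $m_{\lambda,\lambda'}$ equals the number of signatures $\sigma\in\Sigma'(\lambda)$ such that the weight of $v(\sigma)$, restricted to $\mathfrak t_{\mathfrak h}$, is $\lambda'$.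
   Context: Let $\mathfrak g=\mathfrak u^-\oplus\mathfrak t\oplus\mathfrak u$ be a triangular decomposition of a simple complex Lie algebra, with positive roots $\Delta_+(\mathfrak g)=\{\alpha_1,\dots,\alpha_N\}$ in a fixed order and root vectors $e_{\pm\alpha}$. $V(\lambda)=V_{\mathfrak g}(\lambda)$ is the irreducible finite-dimensional module with highest weight $\lambda$, and $v_\lambda$ is a highest weight vector. A signature is a tuple $\sigma=(\lambda;p_1,\dots,p_N)$ with $\lambda$ a dominant weight (the highest weight of $\sigma$) and $p_i\in\mathbb Z_{\ge0}$ (the exponents). Set $v(\sigma)=e_{-\alpha_1}^{p_1}\cdots e_{-\alpha_N}^{p_N}v_\lambda\in V(\lambda)$; the weight of $\sigma$ is $\lambda-\sum p_i\alpha_i$. Fix a monomial order $<$ on $\mathbb Z^N$ (a total order compatible with addition, for which $0$ is the least element of $\mathbb Z_{\ge0}^N$); signatures with the same highest weight are compared by comparing their exponent tuples. For a nonzero $\omega\in V(\lambda)^*$ let $\operatorname{sign}(\omega)$ be the least signature $\sigma$ of highest weight $\lambda$ with $\langle\omega,v(\sigma)\rangle\ne0$. (Equivalently, it records the least term of the function $f_\omega(g)=\langle\omega,gv_\lambda\rangle$ on $G/U$ restricted to $U^-\cdot T$ in the coordinates $\exp(z_1e_{-\alpha_1})\cdots\exp(z_Ne_{-\alpha_N})\cdot t$. Here $G$ is the simply connected group with Lie algebra $\mathfrak g$, and $U,U^-,T$ are the subgroups with Lie algebras $\mathfrak u,\mathfrak u^-,\mathfrak t$.) Let $\mathfrak h\subset\mathfrak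 g$ be a simple subalgebra with triangular decomposition $\mathfrak h=\mathfrak u'^-\oplus\mathfrak t_{\mathfrak h}\oplus\mathfrak u'$, $H\subset G$ the connected subgroup with Lie algebra $\mathfrak h$, and $U'^-\subset H$ the subgroup with Lie algebra $\mathfrak u'^-$. The branching semigroup is $$\Sigma'=\{\operatorname{sign}(\omega)\mid \lambda\text{ dominant},\ 0\ne\omega\in (V(\lambda)^* )^{U'^-}\}.$$ *)

theory Defs
  imports Complex_Main "HOL-Library.FuncSet" "HOL-Library.Groups_Big_Fun"
begin

text \<open>
  Lie algebras and modules are carrier sets: subspaces of an ambient complex vector space, whose
  scalar multiplication is an explicit argument (\<open>sg\<close> for Lie algebras, \<open>sv\<close> for modules).
  Algebraic laws are only required on the carriers. A linear functional on a subspace is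
  represented by a function that is \<^const>\<open>extensional\<close> on it, so that equality of weights is
  equality of functions.
\<close>

section \<open>Linear algebra on carriers\<close>

definition finite_dim_on :: "(complex \<Rightarrow> 'a::ab_group_add \<Rightarrow> 'a) \<Rightarrow> 'a set \<Rightarrow> bool" where
  "finite_dim_on s S \<longleftrightarrow> (\<exists>B. finite B \<and> S \<subseteq> module.span s B)"

definition linear_map_on ::
  "(complex \<Rightarrow> 'a::ab_group_add \<Rightarrow> 'a) \<Rightarrow> (complex \<Rightarrow> 'b::ab_group_add \<Rightarrow> 'b) \<Rightarrow> 'a set \<Rightarrow> ('a \<Rightarrow> 'b) \<Rightarrow> bool" where
  "linear_map_on s1 s2 S f \<longleftrightarrow>
     (\<forall>x\<in>S. \<forall>y\<in>S. f (x + y) = f x + f y) \<and> (\<forall>c. \<forall>x\<in>S. f (s1 c x) = s2 c (f x))"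

definition dual_space :: "(complex \<Rightarrow> 'a::ab_group_add \<Rightarrow> 'a) \<Rightarrow> 'a set \<Rightarrow> ('a \<Rightarrow> complex) set" where
  "dual_space s S = {f \<in> extensional S. linear_map_on s (*) S f}"

definition internal_direct_sum :: "'i set \<Rightarrow> ('i \<Rightarrow> 'a::ab_group_add set) \<Rightarrow> 'a set \<Rightarrow> bool" where
  "internal_direct_sum I W V \<longleftrightarrow> finite I \<and>
     V = {\<Sum>i\<in>I. w i | w. \<forall>i\<in>I. w i \<in> W i} \<and>
     (\<forall>w. (\<forall>i\<in>I. w i \<in> W i) \<and> (\<Sum>i\<in>I. w i) = 0 \<longrightarrow> (\<forall>i\<in>I. w i = 0))"

section \<open>Simple complex Lie algebras and triangular decompositions\<close>

definition lie_algebra_on ::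
  "(complex \<Rightarrow> 'g::ab_group_add \<Rightarrow> 'g) \<Rightarrow> ('g \<Rightarrow> 'g \<Rightarrow> 'g) \<Rightarrow> 'g set \<Rightarrow> bool" where
  "lie_algebra_on sg br L \<longleftrightarrow>
     vector_space sg \<and> module.subspace sg L \<and>
     (\<forall>x\<in>L. \<forall>y\<in>L. br x y \<in> L) \<and>
     (\<forall>x\<in>L. linear_map_on sg sg L (br x)) \<and>
     (\<forall>y\<in>L. linear_map_on sg sg L (\<lambda>x. br x y)) \<and>
     (\<forall>x\<in>L. br x x = 0) \<and>
     (\<forall>x\<in>L. \<forall>y\<in>L. \<forall>z\<in>L. br x (br y z) + br y (br z x) + br z (br x y) = 0)"

definition lie_ideal ::
  "(complex \<Rightarrow> 'g::ab_group_add \<Rightarrow> 'g) \<Rightarrow> ('g \<Rightarrow> 'g \<Rightarrow> 'g) \<Rightarrow> 'g set \<Rightarrow> 'g set \<Rightarrow> bool" where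
  "lie_ideal sg br L J \<longleftrightarrow>
     module.subspace sg J \<and> J \<subseteq> L \<and> (\<forall>x\<in>L. \<forall>y\<in>J. br x y \<in> J)"

definition simple_lie_algebra ::
  "(complex \<Rightarrow> 'g::ab_group_add \<Rightarrow> 'g) \<Rightarrow> ('g \<Rightarrow> 'g \<Rightarrow> 'g) \<Rightarrow> 'g set \<Rightarrow> bool" where
  "simple_lie_algebra sg br L \<longleftrightarrow>
     lie_algebra_on sg br L \<and> finite_dim_on sg L \<and>
     (\<exists>x\<in>L. \<exists>y\<in>L. br x y \<noteq> 0) \<and>
     (\<forall>J. lie_ideal sg br L J \<longrightarrow> J = {0} \<or> J = L)"

definition root_space ::
  "(complex \<Rightarrow> 'g::ab_group_add \<Rightarrow> 'g) \<Rightarrow> ('g \<Rightarrow> 'g \<Rightarrow> 'g) \<Rightarrow> 'g set \<Rightarrow> 'g set \<Rightarrow> ('g \<Rightarrow> complex) \<Rightarrow> 'g set" where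
  "root_space sg br L t \<alpha> = {x \<in> L. \<forall>h\<in>t. br h x = sg (\<alpha> h) x}"

definition roots ::
  "(complex \<Rightarrow> 'g::ab_group_add \<Rightarrow> 'g) \<Rightarrow> ('g \<Rightarrow> 'g \<Rightarrow> 'g) \<Rightarrow> 'g set \<Rightarrow> 'g set \<Rightarrow> ('g \<Rightarrow> complex) set" where
  "roots sg br L t =
     {\<alpha> \<in> dual_space sg t. (\<exists>h\<in>t. \<alpha> h \<noteq> 0) \<and> root_space sg br L t \<alpha> \<noteq> {0}}"

definition neg_weight :: "'g set \<Rightarrow> ('g \<Rightarrow> complex) \<Rightarrow> ('g \<Rightarrow> complex)" where
  "neg_weight t \<alpha> = (\<lambda>h\<in>t. - \<alpha> h)"

definition root_base :: "'g set \<Rightarrow> ('g \<Rightarrow> complex) set \<Rightarrow> ('g \<Rightarrow> complex) set \<Rightarrow> bool" where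
  "root_base t \<Delta> S \<longleftrightarrow> finite S \<and> S \<subseteq> \<Delta> \<and>
     (\<forall>c. (\<forall>h\<in>t. (\<Sum>\<beta>\<in>S. c \<beta> * \<beta> h) = 0) \<longrightarrow> (\<forall>\<beta>\<in>S. c \<beta> = 0)) \<and>
     (\<forall>\<alpha>\<in>\<Delta>. \<exists>k :: ('g \<Rightarrow> complex) \<Rightarrow> nat.
        (\<forall>h\<in>t. \<alpha> h = (\<Sum>\<beta>\<in>S. of_nat (k \<beta>) * \<beta> h)) \<or>
        (\<forall>h\<in>t. \<alpha> h = - (\<Sum>\<beta>\<in>S. of_nat (k \<beta>) * \<beta> h)))"

definition positive_system :: "'g set \<Rightarrow> ('g \<Rightarrow> complex) set \<Rightarrow> ('g \<Rightarrow> complex) set \<Rightarrow> bool" where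
  "positive_system t \<Delta> P \<longleftrightarrow> (\<exists>S. root_base t \<Delta> S \<and>
     P = {\<alpha> \<in> \<Delta>. \<exists>k :: ('g \<Rightarrow> complex) \<Rightarrow> nat.
            \<forall>h\<in>t. \<alpha> h = (\<Sum>\<beta>\<in>S. of_nat (k \<beta>) * \<beta> h)})"

text \<open>
  In \<open>triangular_decomposition\<close>, \<open>P\<close> is the set of positive roots. An abelian \<open>t\<close> with
  \<open>L = um \<oplus> t \<oplus> u\<close>, where \<open>um\<close> and \<open>u\<close> are sums of root spaces for nonzero functionals, acts
  diagonalizably on \<open>L\<close> and is its own centralizer; thus \<open>t\<close> is a Cartan subalgebra.
\<close>

definition triangular_decomposition ::
  "(complex \<Rightarrow> 'g::ab_group_add \<Rightarrow> 'g) \<Rightarrow> ('g \<Rightarrow> 'g \<Rightarrow> 'g) \<Rightarrow> 'g set \<Rightarrow> ('g \<Rightarrow> complex) set \<Rightarrow>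
     'g set \<Rightarrow> 'g set \<Rightarrow> 'g set \<Rightarrow> bool" where
  "triangular_decomposition sg br L P um t u \<longleftrightarrow>
     module.subspace sg t \<and> t \<subseteq> L \<and> (\<forall>x\<in>t. \<forall>y\<in>t. br x y = 0) \<and>
     positive_system t (roots sg br L t) P \<and>
     u = module.span sg (\<Union>\<alpha>\<in>P. root_space sg br L t \<alpha>) \<and>
     um = module.span sg (\<Union>\<alpha>\<in>P. root_space sg br L t (neg_weight t \<alpha>)) \<and>
     (\<forall>x\<in>L. \<exists>!(a, h, b). a \<in> um \<and> h \<in> t \<and> b \<in> u \<and> x = a + h + b)"

definition is_coroot ::
  "(complex \<Rightarrow> 'g::ab_group_add \<Rightarrow> 'g) \<Rightarrow> ('g \<Rightarrow> 'g \<Rightarrow> 'g) \<Rightarrow> 'g set \<Rightarrow> 'g set \<Rightarrow> ('g \<Rightarrow> complex) \<Rightarrow> 'g \<Rightarrow> bool" where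
  "is_coroot sg br L t \<alpha> h \<longleftrightarrow> h \<in> t \<and> \<alpha> h = 2 \<and>
     (\<exists>x \<in> root_space sg br L t \<alpha>. \<exists>y \<in> root_space sg br L t (neg_weight t \<alpha>). h = br x y)"

definition dominant_weight ::
  "(complex \<Rightarrow> 'g::ab_group_add \<Rightarrow> 'g) \<Rightarrow> ('g \<Rightarrow> 'g \<Rightarrow> 'g) \<Rightarrow> 'g set \<Rightarrow> 'g set \<Rightarrow> ('g \<Rightarrow> complex) set \<Rightarrow>
     ('g \<Rightarrow> complex) \<Rightarrow> bool" where
  "dominant_weight sg br L t P \<Lambda> \<longleftrightarrow> \<Lambda> \<in> dual_space sg t \<and>
     (\<forall>\<alpha>\<in>P. \<forall>h. is_coroot sg br L t \<alpha> h \<longrightarrow> \<Lambda> h \<in> \<nat>)"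

section \<open>Highest weight modules\<close>

definition lie_module_on ::
  "(complex \<Rightarrow> 'g::ab_group_add \<Rightarrow> 'g) \<Rightarrow> ('g \<Rightarrow> 'g \<Rightarrow> 'g) \<Rightarrow> 'g set \<Rightarrow>
   (complex \<Rightarrow> 'v::ab_group_add \<Rightarrow> 'v) \<Rightarrow> ('g \<Rightarrow> 'v \<Rightarrow> 'v) \<Rightarrow> 'v set \<Rightarrow> bool" where
  "lie_module_on sg br L sv \<rho> V \<longleftrightarrow>
     vector_space sv \<and> module.subspace sv V \<and>
     (\<forall>x\<in>L. \<forall>v\<in>V. \<rho> x v \<in> V) \<and>
     (\<forall>x\<in>L. linear_map_on sv sv V (\<rho> x)) \<and>
     (\<forall>v\<in>V. linear_map_on sg sv L (\<lambda>x. \<rho> x v)) \<and>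
     (\<forall>x\<in>L. \<forall>y\<in>L. \<forall>v\<in>V. \<rho> (br x y) v = \<rho> x (\<rho> y v) - \<rho> y (\<rho> x v))"

definition irreducible_lie_module ::
  "(complex \<Rightarrow> 'g::ab_group_add \<Rightarrow> 'g) \<Rightarrow> ('g \<Rightarrow> 'g \<Rightarrow> 'g) \<Rightarrow> 'g set \<Rightarrow>
   (complex \<Rightarrow> 'v::ab_group_add \<Rightarrow> 'v) \<Rightarrow> ('g \<Rightarrow> 'v \<Rightarrow> 'v) \<Rightarrow> 'v set \<Rightarrow> bool" where
  "irreducible_lie_module sg br L sv \<rho> V \<longleftrightarrow>
     lie_module_on sg br L sv \<rho> V \<and> V \<noteq> {0} \<and>
     (\<forall>W. module.subspace sv W \<and> W \<subseteq> V \<and> (\<forall>x\<in>L. \<forall>w\<in>W. \<rho> x w \<in> W) \<longrightarrow> W = {0} \<or> W = V)"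

definition highest_weight_vector ::
  "(complex \<Rightarrow> 'v::ab_group_add \<Rightarrow> 'v) \<Rightarrow> ('g \<Rightarrow> 'v \<Rightarrow> 'v) \<Rightarrow> 'g set \<Rightarrow> 'g set \<Rightarrow> 'v set \<Rightarrow>
     ('g \<Rightarrow> complex) \<Rightarrow> 'v \<Rightarrow> bool" where
  "highest_weight_vector sv \<rho> t u V \<Lambda> v \<longleftrightarrow>
     v \<in> V \<and> v \<noteq> 0 \<and> (\<forall>h\<in>t. \<rho> h v = sv (\<Lambda> h) v) \<and> (\<forall>x\<in>u. \<rho> x v = 0)"

text \<open>
  \<open>V\<close> is a copy of the irreducible finite-dimensional \<open>L\<close>-module of highest weight \<open>\<Lambda>\<close>, which is
  determined by \<open>\<Lambda>\<close> up to isomorphism, with chosen highest weight vector \<open>v\<close>.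
\<close>

definition irreducible_highest_weight_module ::
  "(complex \<Rightarrow> 'g::ab_group_add \<Rightarrow> 'g) \<Rightarrow> ('g \<Rightarrow> 'g \<Rightarrow> 'g) \<Rightarrow> 'g set \<Rightarrow> 'g set \<Rightarrow> 'g set \<Rightarrow>
   (complex \<Rightarrow> 'v::ab_group_add \<Rightarrow> 'v) \<Rightarrow> ('g \<Rightarrow> 'v \<Rightarrow> 'v) \<Rightarrow> 'v set \<Rightarrow> ('g \<Rightarrow> complex) \<Rightarrow> 'v \<Rightarrow> bool" where
  "irreducible_highest_weight_module sg br L t u sv \<rho> V \<Lambda> v \<longleftrightarrow>
     irreducible_lie_module sg br L sv \<rho> V \<and> finite_dim_on sv V \<and>
     highest_weight_vector sv \<rho> t u V \<Lambda> v"

text \<open>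
  \<open>V = \<Oplus>\<^sub>\<mu> m(\<mu>) V(\<mu>)\<close> as an \<open>L\<close>-module, \<open>\<mu>\<close> running over the dominant weights: \<open>W \<mu> j\<close> for
  \<open>j < m \<mu>\<close> are the copies of \<open>V(\<mu>)\<close>.
\<close>

definition decomposes_with_multiplicities ::
  "(complex \<Rightarrow> 'g::ab_group_add \<Rightarrow> 'g) \<Rightarrow> ('g \<Rightarrow> 'g \<Rightarrow> 'g) \<Rightarrow> 'g set \<Rightarrow> ('g \<Rightarrow> complex) set \<Rightarrow> 'g set \<Rightarrow> 'g set \<Rightarrow>
   (complex \<Rightarrow> 'v::ab_group_add \<Rightarrow> 'v) \<Rightarrow> ('g \<Rightarrow> 'v \<Rightarrow> 'v) \<Rightarrow> 'v set \<Rightarrow> (('g \<Rightarrow> complex) \<Rightarrow> nat) \<Rightarrow> bool" where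
  "decomposes_with_multiplicities sg br L P t u sv \<rho> V m \<longleftrightarrow>
     (\<exists>W :: ('g \<Rightarrow> complex) \<Rightarrow> nat \<Rightarrow> 'v set.
        (\<forall>\<mu> j. dominant_weight sg br L t P \<mu> \<and> j < m \<mu> \<longrightarrow>
           (\<exists>w. irreducible_highest_weight_module sg br L t u sv \<rho> (W \<mu> j) \<mu> w)) \<and>
        internal_direct_sum {(\<mu>, j). dominant_weight sg br L t P \<mu> \<and> j < m \<mu>}
          (\<lambda>(\<mu>, j). W \<mu> j) V)"

section \<open>Invariants of a unipotent subgroup\<close>

text \<open>
  The connected subgroup with Lie algebra \<open>n\<close> is generated by the elements \<open>exp x\<close>, \<open>x \<in> n\<close>, and
  \<open>exp x\<close> acts on a finite-dimensional module by \<open>\<Sum>k. (\<rho> x)^k / k!\<close>. For \<open>n\<close> the nilpotent part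
  of a triangular decomposition, \<open>\<rho> x\<close> is nilpotent on the module, so the sum has finite support
  and \<^const>\<open>Sum_any\<close> (which is \<open>0\<close> for infinite support) gives the right value.
  The set of operators generated is closed under inverses, \<open>exp (- x)\<close> being inverse to \<open>exp x\<close>.
\<close>

definition exp_operator :: "(complex \<Rightarrow> 'v::ab_group_add \<Rightarrow> 'v) \<Rightarrow> ('v \<Rightarrow> 'v) \<Rightarrow> 'v \<Rightarrow> 'v" where
  "exp_operator sv A v = Sum_any (\<lambda>k. sv (1 / fact k) ((A ^^ k) v))"

inductive_set unipotent_group ::
  "(complex \<Rightarrow> 'v::ab_group_add \<Rightarrow> 'v) \<Rightarrow> ('g \<Rightarrow> 'v \<Rightarrow> 'v) \<Rightarrow> 'g set \<Rightarrow> ('v \<Rightarrow> 'v) set"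
  for sv :: "complex \<Rightarrow> 'v::ab_group_add \<Rightarrow> 'v" and \<rho> :: "'g \<Rightarrow> 'v \<Rightarrow> 'v" and n :: "'g set" where
  one: "id \<in> unipotent_group sv \<rho> n"
| exp_mult: "x \<in> n \<Longrightarrow> g \<in> unipotent_group sv \<rho> n \<Longrightarrow>
    exp_operator sv (\<rho> x) \<circ> g \<in> unipotent_group sv \<rho> n"

definition dual_invariants ::
  "(complex \<Rightarrow> 'v::ab_group_add \<Rightarrow> 'v) \<Rightarrow> ('g \<Rightarrow> 'v \<Rightarrow> 'v) \<Rightarrow> 'g set \<Rightarrow> 'v set \<Rightarrow> ('v \<Rightarrow> complex) set" where
  "dual_invariants sv \<rho> n V =
     {\<omega> \<in> dual_space sv V. \<forall>g \<in> unipotent_group sv \<rho> n. \<forall>v\<in>V. \<omega> (g v) = \<omega> v}"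

section \<open>Signatures\<close>

text \<open>
  Elements of \<open>\<int>\<^sup>N\<close> and exponent tuples are functions on \<^typ>\<open>nat\<close> that vanish outside \<open>{1..N}\<close>.
\<close>

type_synonym 'g signature = "('g \<Rightarrow> complex) \<times> (nat \<Rightarrow> nat)"

definition int_tuples :: "nat \<Rightarrow> (nat \<Rightarrow> int) set" where
  "int_tuples N = {a. \<forall>i. i \<notin> {1..N} \<longrightarrow> a i = 0}"

definition exponent_tuples :: "nat \<Rightarrow> (nat \<Rightarrow> nat) set" where
  "exponent_tuples N = {p. \<forall>i. i \<notin> {1..N} \<longrightarrow> p i = 0}"

definition monomial_order :: "nat \<Rightarrow> ((nat \<Rightarrow> int) \<times> (nat \<Rightarrow> int)) set \<Rightarrow> bool" where
  "monomial_order N r \<longleftrightarrow>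
     r \<subseteq> int_tuples N \<times> int_tuples N \<and> strict_linear_order_on (int_tuples N) r \<and>
     (\<forall>a b. (a, b) \<in> r \<longrightarrow> (\<forall>c \<in> int_tuples N. (\<lambda>i. a i + c i, \<lambda>i. b i + c i) \<in> r)) \<and>
     (\<forall>a \<in> int_tuples N. (\<forall>i. a i \<ge> 0) \<and> (\<exists>i. a i \<noteq> 0) \<longrightarrow> (\<lambda>i. 0, a) \<in> r)"

definition signature_weight ::
  "'g set \<Rightarrow> nat \<Rightarrow> (nat \<Rightarrow> 'g \<Rightarrow> complex) \<Rightarrow> 'g signature \<Rightarrow> ('g \<Rightarrow> complex)" where
  "signature_weight t N \<alpha> \<sigma> = (\<lambda>h\<in>t. fst \<sigma> h - (\<Sum>i=1..N. of_nat (snd \<sigma> i) * \<alpha> i h))"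

text \<open>
  \<open>signature_vector f \<rho> N v p = f\<^sub>1\<^bsup>p\<^sub>1\<^esup> \<dots> f\<^sub>N\<^bsup>p\<^sub>N\<^esup> v\<close>, with \<open>f\<^sub>N\<close> acting first; \<open>f i\<close> is the root vector
  for \<open>- \<alpha> i\<close>.
\<close>

definition signature_vector ::
  "(nat \<Rightarrow> 'g) \<Rightarrow> ('g \<Rightarrow> 'v \<Rightarrow> 'v) \<Rightarrow> nat \<Rightarrow> 'v \<Rightarrow> (nat \<Rightarrow> nat) \<Rightarrow> 'v" where
  "signature_vector f \<rho> N v p = foldr (\<lambda>i w. ((\<rho> (f i)) ^^ (p i)) w) [1..<Suc N] v"

definition sign_of ::
  "((nat \<Rightarrow> int) \<times> (nat \<Rightarrow> int)) set \<Rightarrow> (nat \<Rightarrow> 'g) \<Rightarrow> ('g \<Rightarrow> 'v \<Rightarrow> 'v) \<Rightarrow> nat \<Rightarrow> ('g \<Rightarrow> complex) \<Rightarrow> 'v \<Rightarrow>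
     ('v \<Rightarrow> complex) \<Rightarrow> 'g signature" where
  "sign_of r f \<rho> N \<Lambda> v \<omega> = (\<Lambda>,
     THE p. p \<in> exponent_tuples N \<and> \<omega> (signature_vector f \<rho> N v p) \<noteq> 0 \<and>
       (\<forall>q \<in> exponent_tuples N. \<omega> (signature_vector f \<rho> N v q) \<noteq> 0 \<and> q \<noteq> p \<longrightarrow>
          (int \<circ> p, int \<circ> q) \<in> r))"

text \<open>
  Here \<open>V \<Lambda>\<close> with action \<open>\<rho> \<Lambda>\<close> and highest weight vector \<open>vh \<Lambda>\<close> is the chosen module of
  highest weight \<open>\<Lambda>\<close>, and \<open>n\<close> is the Lie algebra of the unipotent group.
\<close>

definition branching_semigroup ::
  "(complex \<Rightarrow> 'g::ab_group_add \<Rightarrow> 'g) \<Rightarrow> ('g \<Rightarrow> 'g \<Rightarrow> 'g) \<Rightarrow> 'g set \<Rightarrow> 'g set \<Rightarrow> ('g \<Rightarrow> complex) set \<Rightarrow>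
   (complex \<Rightarrow> 'v::ab_group_add \<Rightarrow> 'v) \<Rightarrow> (('g \<Rightarrow> complex) \<Rightarrow> 'g \<Rightarrow> 'v \<Rightarrow> 'v) \<Rightarrow>
   (('g \<Rightarrow> complex) \<Rightarrow> 'v set) \<Rightarrow> (('g \<Rightarrow> complex) \<Rightarrow> 'v) \<Rightarrow>
   ((nat \<Rightarrow> int) \<times> (nat \<Rightarrow> int)) set \<Rightarrow> (nat \<Rightarrow> 'g) \<Rightarrow> nat \<Rightarrow> 'g set \<Rightarrow> 'g signature set" where
  "branching_semigroup sg br L t P sv \<rho> V vh r f N n =
     {sign_of r f (\<rho> \<Lambda>) N \<Lambda> (vh \<Lambda>) \<omega> | \<Lambda> \<omega>.
        dominant_weight sg br L t P \<Lambda> \<and> \<omega> \<in> dual_invariants sv (\<rho> \<Lambda>) n (V \<Lambda>) \<and>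
        (\<exists>v \<in> V \<Lambda>. \<omega> v \<noteq> 0)}"

end

theory Submission
  imports Defs "HOL-Library.Multiset"
begin

text \<open>
  The invariants \<open>D = (V(\<Lambda>)\<^sup>*)\<^bsup>U'\<^esup>\<close> under the lower unipotent group of \<open>\<hh>\<close> encode the multiplicities. A
  functional is invariant iff it vanishes on \<open>um' V\<close> (\<open>dual_invariants_eq\<close>), and an irreducible module
  with highest weight vector \<open>w\<close> is the direct sum of \<open>\<complex> w\<close> and \<open>um' W\<close> (\<open>coinvariants\<close>). Hence every
  summand \<open>V(\<mu>)\<close> of \<open>V(\<Lambda>)\<close> contributes exactly one basis vector of \<open>D\<close>, of weight \<open>\<mu>\<close>
  (\<open>invariant_basis_exists\<close>), and the part \<open>D(\<Lambda>')\<close> of weight \<open>\<Lambda>'\<close> has dimension \<open>m \<Lambda>'\<close>.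

  On the other side, a space of functions on an ordered set has as many least terms as its dimension
  (\<open>card_least_terms\<close>). This is applied to the functions \<open>p \<mapsto> \<langle>\<omega>, v(p)\<rangle>\<close> with \<open>\<omega> \<in> D(\<Lambda>')\<close>, whose least
  terms are the exponents of the signatures; different \<open>\<omega>\<close> give different functions because the \<open>v(p)\<close>
  span \<open>V(\<Lambda>)\<close> (\<open>span_sigvec\<close>). As \<open>v(p)\<close> is a weight vector, such a function is supported on
  signatures whose weight restricts to \<open>\<Lambda>'\<close>. Conversely, if the least term of some \<open>\<omega> \<in> D\<close> has this
  restricted weight, then the component of \<open>\<omega>\<close> in \<open>D(\<Lambda>')\<close> has the same least term. So the signatures
  counted are exactly the least terms of \<open>D(\<Lambda>')\<close>.

  That the \<open>v(p)\<close> span is a Poincare-Birkhoff-Witt argument (\<open>span_ordered_monomials\<close>), which needs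
  the chosen root vectors to span the lower nilpotent part of \<open>\<gg>\<close>, that is, one-dimensional root
  spaces (\<open>root_space_one_dimensional\<close>). This is proved from simplicity: the trace of a commutator
  \<open>[x, y]\<close> with \<open>x \<in> \<gg>\<^sub>\<alpha>\<close>, \<open>y \<in> \<gg>\<^sub>-\<^sub>\<alpha>\<close> vanishes on every \<open>\<alpha>\<close>-string of weight spaces, so that all weights
  are real multiples of \<open>\<alpha>\<close> at \<open>[x, y]\<close> (\<open>string_trace\<close>). Then the Killing form is nonzero, hence
  nondegenerate; every root vector \<open>x\<close> acquires an opposite \<open>y\<close> with \<open>\<alpha>([x, y]) \<noteq> 0\<close>; and a second,
  independent vector of weight \<open>\<alpha>\<close> would generate an infinite string.
\<close>

section \<open>Linear algebra\<close>

lemma linear_map_on_0: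
  assumes "vector_space s1" "vector_space s2" "module.subspace s1 S" "linear_map_on s1 s2 S f"
  shows "f 0 = 0"
proof -
  interpret X: vector_space s1 by fact
  have "0 \<in> S" using assms(3) X.subspace_0 by blast
  then have "f (0 + 0) = f 0 + f 0" using assms(4) unfolding linear_map_on_def by blast
  then show ?thesis by simp
qed

lemma linear_map_on_sum:
  assumes "vector_space s1" "vector_space s2" "module.subspace s1 S" "linear_map_on s1 s2 S f"
    and "\<And>i. i \<in> I \<Longrightarrow> x i \<in> S"
  shows "f (\<Sum>i\<in>I. x i) = (\<Sum>i\<in>I. f (x i))"
proof -
  interpret X: vector_space s1 by fact
  show ?thesis using assms(5)
  proof (induction I rule: infinite_finite_induct)
    case (insert i I)
    have "(\<Sum>i\<in>I. x i) \<in> S" using insert.prems assms(3) by (intro X.subspace_sum) auto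
    then show ?case using insert assms(4) unfolding linear_map_on_def by simp
  qed (use linear_map_on_0[OF assms(1-4)] in auto)
qed

lemma linear_map_on_diff:
  assumes "vector_space s1" "vector_space s2" "module.subspace s1 S" "linear_map_on s1 s2 S f"
    and "x \<in> S" "y \<in> S"
  shows "f (x - y) = f x - f y"
proof -
  interpret X: vector_space s1 by fact
  have "x - y \<in> S" using assms X.subspace_diff by blast
  then have "f ((x - y) + y) = f (x - y) + f y"
    using assms(4,6) unfolding linear_map_on_def by blast
  then show ?thesis by simp
qed

lemma linear_map_on_subset: "linear_map_on s1 s2 S f \<Longrightarrow> T \<subseteq> S \<Longrightarrow> linear_map_on s1 s2 T f"
  unfolding linear_map_on_def by blast

lemma linear_map_on_span:
  assumes "vector_space s1" "vector_space s2" "module.subspace s1 S" "linear_map_on s1 s2 S f"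
    and "X \<subseteq> S" "module.subspace s2 T" "\<And>x. x \<in> X \<Longrightarrow> f x \<in> T" "y \<in> module.span s1 X"
  shows "f y \<in> T"
proof -
  interpret X: vector_space s1 by fact
  interpret Y: vector_space s2 by fact
  have XS: "X.span X \<subseteq> S" using assms(3,5) X.span_minimal by blast
  have f0: "f 0 = 0" using linear_map_on_0[OF assms(1-4)] .
  have "f y \<in> T \<and> y \<in> S" using assms(8)
  proof (induction rule: X.span_induct_alt)
    case base
    show ?case using f0 assms(3,6) X.subspace_0 Y.subspace_0 by simp
  next
    case (step c x y)
    have xS: "x \<in> S" "s1 c x \<in> S" using step assms(3,5) X.subspace_scale by auto
    have "f (s1 c x + y) = s2 c (f x) + f y"
      using xS step assms(4) unfolding linear_map_on_def by auto
    then show ?case using xS step assms(3,6,7) X.subspace_add Y.subspace_add Y.subspace_scale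
      by simp
  qed
  then show ?thesis by simp
qed

lemma eigenvectors_sum_zero:
  assumes "vector_space s" "module.subspace s S" "linear_map_on s s S A" "finite I"
    and "\<And>i. i \<in> I \<Longrightarrow> x i \<in> S" "\<And>i. i \<in> I \<Longrightarrow> A (x i) = s (c i) (x i)"
    and "inj_on c I" "(\<Sum>i\<in>I. x i) = 0"
  shows "\<forall>i\<in>I. x i = 0"
proof -
  interpret vector_space s by fact
  show ?thesis using assms(4-8)
  proof (induction I arbitrary: x)
    case empty
    then show ?case by simp
  next
    case (insert j I)
    have "A (\<Sum>i\<in>insert j I. x i) = 0"
      using insert.prems(4) linear_map_on_0[OF assms(1,1,2,3)] by simp
    also have "A (\<Sum>i\<in>insert j I. x i) = (\<Sum>i\<in>insert j I. A (x i))"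
      using insert.prems by (intro linear_map_on_sum[OF assms(1,1,2,3)]) auto
    finally have 1: "(\<Sum>i\<in>insert j I. s (c i) (x i)) = 0"
      using insert.prems(2) by simp
    have 2: "(\<Sum>i\<in>insert j I. s (c j) (x i)) = 0"
      using insert.prems(4) scale_sum_right[of "c j" x "insert j I"] by simp
    have "(\<Sum>i\<in>insert j I. s (c i - c j) (x i)) = 0"
      using 1 2 by (simp only: scale_left_diff_distrib sum_subtractf) simp
    then have sum0: "(\<Sum>i\<in>I. s (c i - c j) (x i)) = 0"
      using insert.hyps by simp
    have "\<forall>i\<in>I. s (c i - c j) (x i) = 0"
    proof (rule insert.IH)
      fix i assume i: "i \<in> I"
      then show "s (c i - c j) (x i) \<in> S" using insert.prems(1) assms(2) subspace_scale by simp
      show "A (s (c i - c j) (x i)) = s (c i) (s (c i - c j) (x i))"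
        using assms(3) i insert.prems(1,2) unfolding linear_map_on_def by (simp add: mult.commute)
    qed (use insert.prems(3) sum0 in \<open>auto simp: inj_on_def\<close>)
    moreover have "\<forall>i\<in>I. c i - c j \<noteq> 0"
      using insert.prems(3) insert.hyps(2) by (auto simp: inj_on_def)
    ultimately have "\<forall>i\<in>I. x i = 0" by simp
    moreover from this have "x j = 0" using insert.prems(4) insert.hyps by simp
    ultimately show ?case by simp
  qed
qed

text \<open>
  The trace is taken on the span of \<open>B\<close> in the basis \<open>B\<close>, so that it is available on any subspace
  spanned by part of a weight basis.
\<close>

lemma trace_commute:
  assumes "vector_space s" "finite B" "\<not> module.dependent s B"
    and "linear_map_on s s (module.span s B) A" "linear_map_on s s (module.span s B) C"
    and "\<And>b. b \<in> B \<Longrightarrow> A b \<in> module.span s B" "\<And>b. b \<in> B \<Longrightarrow> C b \<in> module.span s B"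
  shows "(\<Sum>b\<in>B. module.representation s B (A (C b)) b) =
         (\<Sum>b\<in>B. module.representation s B (C (A b)) b)"
proof -
  interpret vector_space s by fact
  have expand: "representation B (A (C b)) b = (\<Sum>c\<in>B. representation B (C b) c * representation B (A c) b)"
    if b: "b \<in> B" and A: "linear_map_on s s (span B) A" "\<And>b. b \<in> B \<Longrightarrow> A b \<in> span B"
      and C: "\<And>b. b \<in> B \<Longrightarrow> C b \<in> span B" for b A C
  proof -
    have "C b = (\<Sum>c\<in>B. s (representation B (C b) c) c)"
      using sum_representation_eq[OF assms(3) C[OF b] assms(2) order_refl] by simp
    then have "A (C b) = A (\<Sum>c\<in>B. s (representation B (C b) c) c)" by simp
    also have "\<dots> = (\<Sum>c\<in>B. A (s (representation B (C b) c) c))"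
      by (intro linear_map_on_sum[OF assms(1,1) subspace_span A(1)])
        (auto intro: span_scale span_base)
    also have "\<dots> = (\<Sum>c\<in>B. s (representation B (C b) c) (A c))"
      using A(1) span_base[of _ B] unfolding linear_map_on_def by (intro sum.cong) auto
    finally have "representation B (A (C b)) b
        = representation B (\<Sum>c\<in>B. s (representation B (C b) c) (A c)) b" by simp
    also have "\<dots> = (\<Sum>c\<in>B. representation B (s (representation B (C b) c) (A c)) b)"
      using A(2) by (subst representation_sum[OF assms(3)]) (auto intro: span_scale)
    also have "\<dots> = (\<Sum>c\<in>B. representation B (C b) c * representation B (A c) b)"
      using A(2) by (intro sum.cong) (auto simp: representation_scale[OF assms(3)])
    finally show ?thesis .
  qed
  have "(\<Sum>b\<in>B. representation B (A (C b)) b)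
      = (\<Sum>b\<in>B. \<Sum>c\<in>B. representation B (C b) c * representation B (A c) b)"
    using expand assms by (intro sum.cong) auto
  also have "\<dots> = (\<Sum>c\<in>B. \<Sum>b\<in>B. representation B (A c) b * representation B (C b) c)"
    by (subst sum.swap) (simp add: mult.commute)
  also have "\<dots> = (\<Sum>b\<in>B. representation B (C (A b)) b)"
    using expand assms by (intro sum.cong refl) (metis (no_types, lifting))
  finally show ?thesis .
qed

text \<open>
  The replacement for arguments with \<open>sl\<^sub>2\<close>-modules: the eigenvalues of a diagonal commutator sum to
  zero on every stable subspace.
\<close>

lemma trace_commutator_diagonal:
  assumes "vector_space s" "finite B" "\<not> module.dependent s B"
    and "linear_map_on s s (module.span s B) A" "linear_map_on s s (module.span s B) C"
    and "\<And>b. b \<in> B \<Longrightarrow> A b \<in> module.span s B" "\<And>b. b \<in> B \<Longrightarrow> C b \<in> module.span s B"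
    and "\<And>b. b \<in> B \<Longrightarrow> A (C b) - C (A b) = s (d b) b"
  shows "(\<Sum>b\<in>B. d b) = 0"
proof -
  interpret vector_space s by fact
  have stable: "F b \<in> span B"
    if "linear_map_on s s (span B) F" "\<And>b. b \<in> B \<Longrightarrow> F b \<in> span B" "b \<in> span B" for F b
    by (rule linear_map_on_span[OF assms(1,1) subspace_span that(1) span_superset subspace_span
          that(2) that(3)])
  have "d b = representation B (A (C b)) b - representation B (C (A b)) b" if b: "b \<in> B" for b
  proof -
    have in_span: "A (C b) \<in> span B" "C (A b) \<in> span B" using stable[OF assms(4,6)] stable[OF assms(5,7)] assms(6,7) b by blast+
    have "d b = representation B (s (d b) b) b"
      using b assms(3) by (simp add: representation_scale span_base representation_basis)
    also have "\<dots> = representation B (A (C b)) b - representation B (C (A b)) b"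
      using representation_diff[OF assms(3) in_span(2,1)] assms(8)[OF b] by simp
    finally show ?thesis .
  qed
  then show ?thesis using trace_commute[OF assms(1-7)] by (simp add: sum_subtractf)
qed

text \<open>
  By induction: if no \<open>h\<close> separated \<open>\<beta>\<close> from the remaining functionals, \<open>\<beta>\<close> would be the combination
  of them with coefficients \<open>\<beta> (e \<gamma>)\<close>, where \<open>e\<close> is a dual family for the others.
\<close>

lemma independent_functionals_dual:
  fixes S :: "('a::ab_group_add \<Rightarrow> complex) set"
  assumes "vector_space s" "module.subspace s t" "finite S"
    and "\<And>\<beta>. \<beta> \<in> S \<Longrightarrow> linear_map_on s (*) t \<beta>"
    and "\<And>c. (\<And>h. h \<in> t \<Longrightarrow> (\<Sum>\<beta>\<in>S. c \<beta> * \<beta> h) = 0) \<Longrightarrow> \<forall>\<beta>\<in>S. c \<beta> = 0"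
  shows "\<exists>h\<in>t. \<forall>\<beta>\<in>S. \<beta> h = d \<beta>"
proof -
  interpret vector_space s by fact
  have C: "vector_space ((*) :: complex \<Rightarrow> complex \<Rightarrow> complex)"
    by unfold_locales (auto simp: algebra_simps)
  show ?thesis using assms(3-5)
  proof (induction S arbitrary: d)
    case empty
    then show ?case using subspace_0[OF assms(2)] by auto
  next
    case (insert \<beta> S)
    have indep: "\<forall>\<gamma>\<in>S. c \<gamma> = 0" if "\<And>h. h \<in> t \<Longrightarrow> (\<Sum>\<gamma>\<in>S. c \<gamma> * \<gamma> h) = 0" for c
    proof -
      have "(\<Sum>\<gamma>\<in>insert \<beta> S. (if \<gamma> \<in> S then c \<gamma> else 0) * \<gamma> h) = (\<Sum>\<gamma>\<in>S. c \<gamma> * \<gamma> h)" for h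
        using insert.hyps by simp
      then have "\<forall>\<gamma>\<in>insert \<beta> S. (if \<gamma> \<in> S then c \<gamma> else 0) = 0"
        using that by (intro insert.prems(2)) metis
      then show ?thesis by auto
    qed
    have IH: "\<exists>h\<in>t. \<forall>\<gamma>\<in>S. \<gamma> h = d \<gamma>" for d
      by (rule insert.IH[OF insert.prems(1)[OF insertI2] indep])
    have "\<forall>\<delta>. \<exists>h. h \<in> t \<and> (\<forall>\<gamma>\<in>S. \<gamma> h = (if \<gamma> = \<delta> then 1 else 0))"
    proof
      fix \<delta>
      show "\<exists>h. h \<in> t \<and> (\<forall>\<gamma>\<in>S. \<gamma> h = (if \<gamma> = \<delta> then 1 else 0))"
        using IH[of "\<lambda>\<gamma>. if \<gamma> = \<delta> then 1 else 0"] by (simp add: Bex_def)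
    qed
    from choice[OF this] obtain e where
      e: "\<And>\<delta>. e \<delta> \<in> t" "\<And>\<delta> \<gamma>. \<gamma> \<in> S \<Longrightarrow> \<gamma> (e \<delta>) = (if \<gamma> = \<delta> then 1 else 0)"
      by blast
    have ins: "linear_map_on s (*) t \<gamma>" if "\<gamma> \<in> insert \<beta> S" for \<gamma> using insert.prems(1) that .
    \<comment> \<open>A vector on which \<open>\<beta>\<close> differs from the combination of \<open>S\<close> that agrees with it on the \<open>e \<delta>\<close>.\<close>
    have "\<exists>h\<in>t. \<beta> h \<noteq> (\<Sum>\<gamma>\<in>S. \<beta> (e \<gamma>) * \<gamma> h)"
    proof (rule ccontr)
      assume "\<not> ?thesis"
      then have eq: "\<beta> h = (\<Sum>\<gamma>\<in>S. \<beta> (e \<gamma>) * \<gamma> h)" if "h \<in> t" for h using that by blast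
      let ?c = "\<lambda>\<gamma>. if \<gamma> = \<beta> then -1 else \<beta> (e \<gamma>)"
      have "(\<Sum>\<gamma>\<in>insert \<beta> S. ?c \<gamma> * \<gamma> h) = 0" if "h \<in> t" for h
      proof -
        have "(\<Sum>\<gamma>\<in>S. ?c \<gamma> * \<gamma> h) = (\<Sum>\<gamma>\<in>S. \<beta> (e \<gamma>) * \<gamma> h)"
          using insert.hyps by (intro sum.cong) auto
        then show ?thesis using insert.hyps eq[OF that] by simp
      qed
      then have "\<forall>\<gamma>\<in>insert \<beta> S. ?c \<gamma> = 0" by (rule insert.prems(2))
      then show False by simp
    qed
    then obtain h where h: "h \<in> t" "\<beta> h \<noteq> (\<Sum>\<gamma>\<in>S. \<beta> (e \<gamma>) * \<gamma> h)" by blast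
    define k where "k = h - (\<Sum>\<gamma>\<in>S. s (\<gamma> h) (e \<gamma>))"
    have sum_t: "(\<Sum>\<gamma>\<in>S. s (x \<gamma>) (e \<gamma>)) \<in> t" for x
      using e(1) assms(2) by (intro subspace_sum) (auto intro: subspace_scale)
    have kt: "k \<in> t" unfolding k_def using h(1) sum_t assms(2) by (intro subspace_diff)
    have on_sum: "\<gamma> (\<Sum>\<delta>\<in>S. s (x \<delta>) (e \<delta>)) = (\<Sum>\<delta>\<in>S. x \<delta> * \<gamma> (e \<delta>))" if "\<gamma> \<in> insert \<beta> S" for \<gamma> x
    proof -
      have "\<gamma> (\<Sum>\<delta>\<in>S. s (x \<delta>) (e \<delta>)) = (\<Sum>\<delta>\<in>S. \<gamma> (s (x \<delta>) (e \<delta>)))"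
        using e(1) assms(2) by (intro linear_map_on_sum[OF assms(1) C assms(2) ins[OF that]])
          (auto intro: subspace_scale)
      then show ?thesis using e(1) ins[OF that] unfolding linear_map_on_def by simp
    qed
    have S_sum: "(\<Sum>\<delta>\<in>S. x \<delta> * \<gamma> (e \<delta>)) = x \<gamma>" if "\<gamma> \<in> S" for \<gamma> x
    proof -
      have "(\<Sum>\<delta>\<in>S. x \<delta> * \<gamma> (e \<delta>)) = (\<Sum>\<delta>\<in>S. if \<delta> = \<gamma> then x \<delta> else 0)"
        by (intro sum.cong) (auto simp: e(2)[OF that])
      then show ?thesis using that insert.hyps by simp
    qed
    have on_k: "\<gamma> k = \<gamma> h - (\<Sum>\<delta>\<in>S. \<delta> h * \<gamma> (e \<delta>))" if "\<gamma> \<in> insert \<beta> S" for \<gamma>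
      using linear_map_on_diff[OF assms(1) C assms(2) ins[OF that] h(1) sum_t]
        on_sum[OF that, of "\<lambda>\<delta>. \<delta> h"] unfolding k_def by (rule trans[OF _ arg_cong])
    have k: "\<gamma> k = 0" if "\<gamma> \<in> S" for \<gamma>
      using on_k[of \<gamma>] S_sum[OF that, of "\<lambda>\<delta>. \<delta> h"] that by simp
    have "\<beta> k = \<beta> h - (\<Sum>\<delta>\<in>S. \<beta> (e \<delta>) * \<delta> h)" using on_k[of \<beta>] by (simp add: mult.commute)
    then have \<beta>k: "\<beta> k \<noteq> 0" using h(2) by simp
    define w where "w = (\<Sum>\<gamma>\<in>S. s (d \<gamma>) (e \<gamma>))"
    define z where "z = w + s ((d \<beta> - \<beta> w) / \<beta> k) k"
    have wt: "w \<in> t" unfolding w_def by (rule sum_t)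
    have skt: "s a k \<in> t" for a using kt assms(2) subspace_scale by blast
    have z: "\<gamma> z = \<gamma> w + (d \<beta> - \<beta> w) / \<beta> k * \<gamma> k" if "\<gamma> \<in> insert \<beta> S" for \<gamma>
      using ins[OF that] wt kt skt unfolding z_def linear_map_on_def by simp
    have "\<gamma> z = d \<gamma>" if "\<gamma> \<in> insert \<beta> S" for \<gamma>
    proof (cases "\<gamma> = \<beta>")
      case True
      then show ?thesis using z[OF that] \<beta>k by simp
    next
      case False
      then have "\<gamma> \<in> S" using that by simp
      then show ?thesis using z[OF that] k on_sum[OF that] S_sum unfolding w_def by simp
    qed
    moreover have "z \<in> t" unfolding z_def using wt skt assms(2) subspace_add by blast
    ultimately show ?case by blast
  qed
qed

lemma homogeneous_system:
  fixes M :: "'i \<Rightarrow> 'j \<Rightarrow> 'k::field"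
  assumes "finite J" "finite I" "card J < card I"
  shows "\<exists>c. (\<exists>i\<in>I. c i \<noteq> 0) \<and> (\<forall>j\<in>J. (\<Sum>i\<in>I. c i * M i j) = 0)"
  using assms
proof (induction J arbitrary: I M)
  case empty
  then have "I \<noteq> {}" by auto
  then show ?case by (auto intro!: exI[of _ "\<lambda>_. 1"])
next
  case (insert j J)
  show ?case
  proof (cases "\<forall>i\<in>I. M i j = 0")
    case True
    then show ?thesis using insert.IH[of I M] insert.prems insert.hyps by auto
  next
    case False
    then obtain l where l: "l \<in> I" "M l j \<noteq> 0" by auto
    let ?M = "\<lambda>i k. M i k - M i j / M l j * M l k"
    have card_less: "card J < card (I - {l})" using insert.prems insert.hyps l(1) by auto
    obtain c where c: "\<exists>i\<in>I - {l}. c i \<noteq> 0" "\<forall>k\<in>J. (\<Sum>i\<in>I - {l}. c i * ?M i k) = 0"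
      using insert.IH[of "I - {l}" ?M] card_less insert.prems(1) by blast
    define a where "a = - (\<Sum>i\<in>I - {l}. c i * M i j / M l j)"
    let ?c = "c(l := a)"
    have split: "(\<Sum>i\<in>I. ?c i * M i k) = a * M l k + (\<Sum>i\<in>I - {l}. c i * M i k)" for k
      using insert.prems(1) l(1) by (subst sum.remove[of _ l]) (auto intro!: sum.cong)
    have "(\<Sum>i\<in>I. ?c i * M i j) = 0"
      using l(2) unfolding split unfolding a_def by (simp add: sum_distrib_right)
    moreover have "(\<Sum>i\<in>I. ?c i * M i k) = 0" if "k \<in> J" for k
    proof -
      have "(\<Sum>i\<in>I - {l}. c i * ?M i k)
          = (\<Sum>i\<in>I - {l}. c i * M i k) - (\<Sum>i\<in>I - {l}. c i * M i j / M l j) * M l k"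
        by (simp add: sum_subtractf sum_distrib_left algebra_simps)
      then show ?thesis using c(2) that unfolding split unfolding a_def by (simp add: algebra_simps)
    qed
    ultimately show ?thesis using c(1) by (intro exI[of _ ?c]) auto
  qed
qed

section \<open>Least terms\<close>

lemma finite_linear_order_least:
  assumes "trans r" "irrefl r" "total_on A r" "finite A" "A \<noteq> {}"
  shows "\<exists>p\<in>A. \<forall>q\<in>A. q \<noteq> p \<longrightarrow> (p, q) \<in> r"
  using assms(4,5,3)
proof (induction A rule: finite_ne_induct)
  case (singleton x)
  then show ?case by simp
next
  case (insert x A)
  then obtain p where p: "p \<in> A" "\<forall>q\<in>A. q \<noteq> p \<longrightarrow> (p, q) \<in> r"
    by (auto simp: total_on_def)
  have "(x, p) \<in> r \<or> (p, x) \<in> r"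
    using insert.prems insert.hyps p(1) unfolding total_on_def by auto
  then show ?case
  proof
    assume xp: "(x, p) \<in> r"
    then have "\<forall>q\<in>A. (x, q) \<in> r" using p(2) assms(1) by (metis transD)
    then show ?thesis by blast
  next
    assume "(p, x) \<in> r"
    then show ?thesis using p by blast
  qed
qed

text \<open>
  For \<open>a p = \<langle>\<omega>, v(p)\<rangle>\<close> the least term is at the exponent tuple of \<open>sign \<omega>\<close>.
\<close>

definition least_term :: "('q \<times> 'q) set \<Rightarrow> 'q set \<Rightarrow> ('q \<Rightarrow> 'k::zero) \<Rightarrow> 'q \<Rightarrow> bool" where
  "least_term r Q a p \<longleftrightarrow> p \<in> Q \<and> a p \<noteq> 0 \<and> (\<forall>q\<in>Q. a q \<noteq> 0 \<and> q \<noteq> p \<longrightarrow> (p, q) \<in> r)"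

lemma least_term_unique:
  assumes "trans r" "irrefl r" "least_term r Q a p" "least_term r Q a q"
  shows "p = q"
proof (rule ccontr)
  assume "p \<noteq> q"
  then have "(p, q) \<in> r" "(q, p) \<in> r" using assms(3,4) unfolding least_term_def by blast+
  then show False using assms(1,2) by (meson irreflD transD)
qed

lemma least_term_exists:
  assumes "trans r" "irrefl r" "total_on Q r" "finite {q\<in>Q. a q \<noteq> 0}" "q \<in> Q" "a q \<noteq> 0"
  shows "\<exists>p. least_term r Q a p"
proof -
  have "total_on {q\<in>Q. a q \<noteq> 0} r" using assms(3) unfolding total_on_def by blast
  then show ?thesis
    using finite_linear_order_least[OF assms(1,2) _ assms(4)] assms(5,6)
    unfolding least_term_def by blast
qed

text \<open>
  A space of functions has as many least terms as its dimension. Evaluation at the positions of the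
  least terms is injective, because a nonzero function does not vanish at its own least term; and
  functions with distinct least terms are linearly independent, by triangularity.
\<close>

lemma card_least_terms:
  fixes a :: "'i \<Rightarrow> 'q \<Rightarrow> 'k::field"
  assumes "trans r" "irrefl r" "total_on Q r" "finite I"
    and finite_support: "\<And>i. i \<in> I \<Longrightarrow> finite {q\<in>Q. a i q \<noteq> 0}"
    and independent: "\<And>c. (\<And>q. q \<in> Q \<Longrightarrow> (\<Sum>i\<in>I. c i * a i q) = 0) \<Longrightarrow> \<forall>i\<in>I. c i = 0"
  shows "finite {p. \<exists>c. least_term r Q (\<lambda>q. \<Sum>i\<in>I. c i * a i q) p} \<and>
    card {p. \<exists>c. least_term r Q (\<lambda>q. \<Sum>i\<in>I. c i * a i q) p} = card I"
proof -
  define S where "S = {p. \<exists>c. least_term r Q (\<lambda>q. \<Sum>i\<in>I. c i * a i q) p}"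
  let ?supp = "\<Union>i\<in>I. {q\<in>Q. a i q \<noteq> 0}"
  have supp: "finite ?supp" using assms(4) finite_support by auto
  have comb: "{q\<in>Q. (\<Sum>i\<in>I. c i * a i q) \<noteq> 0} \<subseteq> ?supp" for c
  proof
    fix q assume q: "q \<in> {q\<in>Q. (\<Sum>i\<in>I. c i * a i q) \<noteq> 0}"
    then obtain i where "i \<in> I" "c i * a i q \<noteq> 0" using sum.not_neutral_contains_not_neutral by blast
    then show "q \<in> ?supp" using q by auto
  qed
  have fin: "finite S"
  proof (rule finite_subset[OF _ supp])
    show "S \<subseteq> ?supp" unfolding S_def least_term_def using comb by blast
  qed
  have "card I \<le> card S"
  proof (rule ccontr)
    assume "\<not> ?thesis"
    then obtain c where c: "\<exists>i\<in>I. c i \<noteq> 0" "\<forall>p\<in>S. (\<Sum>i\<in>I. c i * a i p) = 0"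
      using homogeneous_system[OF fin assms(4), of a] by auto
    obtain q where q: "q \<in> Q" "(\<Sum>i\<in>I. c i * a i q) \<noteq> 0" using independent[of c] c(1) by auto
    obtain p where "least_term r Q (\<lambda>q. \<Sum>i\<in>I. c i * a i q) p"
      using least_term_exists[OF assms(1-3) finite_subset[OF comb supp] q] by blast
    then show False using c(2) unfolding S_def least_term_def by blast
  qed
  moreover have "card S \<le> card I"
  proof (rule ccontr)
    assume less: "\<not> ?thesis"
    have "\<forall>p\<in>S. \<exists>c. least_term r Q (\<lambda>q. \<Sum>i\<in>I. c i * a i q) p" unfolding S_def by blast
    then obtain c where c: "\<And>p. p \<in> S \<Longrightarrow> least_term r Q (\<lambda>q. \<Sum>i\<in>I. c p i * a i q) p"
      using bchoice[of S "\<lambda>p c. least_term r Q (\<lambda>q. \<Sum>i\<in>I. c i * a i q) p"] by blast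
    obtain d where d: "\<exists>p\<in>S. d p \<noteq> 0" "\<forall>i\<in>I. (\<Sum>p\<in>S. d p * c p i) = 0"
      using homogeneous_system[OF assms(4) fin, of c] less by auto
    have "S \<subseteq> Q" unfolding S_def least_term_def by blast
    then have "total_on {p\<in>S. d p \<noteq> 0} r" using assms(3) unfolding total_on_def by blast
    then obtain p where p: "p \<in> S" "d p \<noteq> 0" "\<And>q. q \<in> S \<Longrightarrow> d q \<noteq> 0 \<Longrightarrow> q \<noteq> p \<Longrightarrow> (p, q) \<in> r"
      using finite_linear_order_least[OF assms(1,2), of "{p\<in>S. d p \<noteq> 0}"] fin d(1) by auto
    have zero: "d q * (\<Sum>i\<in>I. c q i * a i p) = 0" if "q \<in> S" "q \<noteq> p" for q
    proof (cases "d q = 0")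
      case False
      then have "(p, q) \<in> r" using p(3) that by blast
      then have "(q, p) \<notin> r" using assms(1,2) by (meson irreflD transD)
      then have "(\<Sum>i\<in>I. c q i * a i p) = 0"
        using c[OF that(1)] that(2) p(1) \<open>S \<subseteq> Q\<close> unfolding least_term_def by blast
      then show ?thesis by simp
    qed simp
    have "0 = (\<Sum>i\<in>I. (\<Sum>q\<in>S. d q * c q i) * a i p)" using d(2) by simp
    also have "\<dots> = (\<Sum>i\<in>I. \<Sum>q\<in>S. d q * (c q i * a i p))" by (simp add: sum_distrib_right mult.assoc)
    also have "\<dots> = (\<Sum>q\<in>S. d q * (\<Sum>i\<in>I. c q i * a i p))"
      by (subst sum.swap) (simp add: sum_distrib_left)
    also have "\<dots> = d p * (\<Sum>i\<in>I. c p i * a i p)"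
    proof -
      have "(\<Sum>q\<in>S - {p}. d q * (\<Sum>i\<in>I. c q i * a i p)) = 0"
        using zero by (intro sum.neutral) blast
      then show ?thesis
        using sum.remove[OF fin p(1), of "\<lambda>q. d q * (\<Sum>i\<in>I. c q i * a i p)"] by simp
    qed
    finally have "d p * (\<Sum>i\<in>I. c p i * a i p) = 0" by (rule sym)
    moreover have "(\<Sum>i\<in>I. c p i * a i p) \<noteq> 0" using c[OF p(1)] unfolding least_term_def by blast
    ultimately show False using p(2) by simp
  qed
  ultimately show ?thesis using fin unfolding S_def by simp
qed

section \<open>Straightening of words\<close>

lemma sorted_eq_concat_replicate:
  assumes "sorted zs" "set zs \<subseteq> {m..<n}"
  shows "zs = concat (map (\<lambda>i. replicate (count_list zs i) i) [m..<n])" (is "_ = ?C zs n")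
proof -
  have rep: "count_list (replicate k i) x = (if i = x then k else 0)" for k i x :: nat
    by (induction k) auto
  have cnt: "count_list (concat (map (\<lambda>i. replicate (p i) i) [m..<n])) x
      = (if x \<in> {m..<n} then p x else 0)" for p x
    by (induction n) (auto simp: rep)
  have sorted: "sorted (concat (map (\<lambda>i. replicate (p i) i) [m..<n]))
      \<and> set (concat (map (\<lambda>i. replicate (p i) i) [m..<n])) \<subseteq> {m..<n}" for p
    by (induction n) (auto simp: sorted_append)
  have "mset zs = mset (?C zs n)"
  proof (rule multiset_eqI)
    fix x
    have "count_list zs x = 0" if "x \<notin> {m..<n}" using that assms(2) by (auto simp: count_list_0_iff)
    then show "count (mset zs) x = count (mset (?C zs n)) x"
      using cnt[of "count_list zs" x] by (auto simp: count_mset)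
  qed
  then have "sort (?C zs n) = zs" using assms(1) by (intro properties_for_sort) simp_all
  then show ?thesis using sorted by (simp add: sorted_sort_id)
qed

text \<open>
  Operators that commute up to linear combinations of the operators themselves: this is all that the
  spanning half of the Poincare-Birkhoff-Witt theorem uses.
\<close>

locale straightening =
  fixes sv :: "complex \<Rightarrow> 'v::ab_group_add \<Rightarrow> 'v" and V :: "'v set"
    and A :: "'i::linorder \<Rightarrow> 'v \<Rightarrow> 'v" and I :: "'i set" and v :: 'v
  assumes vs: "vector_space sv" and V: "module.subspace sv V"
    and lin: "\<And>i. i \<in> I \<Longrightarrow> linear_map_on sv sv V (A i)"
    and closed: "\<And>i w. i \<in> I \<Longrightarrow> w \<in> V \<Longrightarrow> A i w \<in> V" and v: "v \<in> V"
    and comm: "\<And>i j w. i \<in> I \<Longrightarrow> j \<in> I \<Longrightarrow> w \<in> V \<Longrightarrow>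
      A i (A j w) - A j (A i w) \<in> module.span sv ((\<lambda>k. A k w) ` I)"
begin

sublocale vector_space sv by (rule vs)

definition words :: "nat \<Rightarrow> 'v set" where
  "words n = {foldr A xs v |xs. set xs \<subseteq> I \<and> length xs \<le> n}"

definition sorted_words :: "nat \<Rightarrow> 'v set" where
  "sorted_words n = {foldr A xs v |xs. set xs \<subseteq> I \<and> length xs \<le> n \<and> sorted xs}"

lemma foldr_in_V: "set xs \<subseteq> I \<Longrightarrow> foldr A xs v \<in> V"
  by (induction xs) (auto simp: v closed)

lemma apply_span_words:
  assumes "i \<in> I" "x \<in> span (words n)"
  shows "A i x \<in> span (words (Suc n))"
proof (rule linear_map_on_span[OF vs vs V lin[OF assms(1)] _ subspace_span _ assms(2)])
  show "words n \<subseteq> V" unfolding words_def using foldr_in_V by auto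
  fix x assume "x \<in> words n"
  then obtain xs where xs: "x = foldr A xs v" "set xs \<subseteq> I" "length xs \<le> n"
    unfolding words_def by blast
  have "foldr A (i # xs) v \<in> words (Suc n)"
    unfolding words_def using xs(2,3) assms(1) by (intro CollectI exI[of _ "i # xs"]) auto
  then show "A i x \<in> span (words (Suc n))" using xs(1) by (simp add: span_base)
qed

text \<open>
  Each exchange of the new letter with a smaller one costs a combination of words that are one letter
  shorter.
\<close>

lemma insort_mod_shorter:
  assumes "set zs \<subseteq> I" "i \<in> I"
  shows "A i (foldr A zs v) - foldr A (insort i zs) v \<in> span (words (length zs))"
  using assms(1)
proof (induction zs)
  case Nil
  then show ?case by (simp add: span_zero)
next
  case (Cons y ys)
  show ?case
  proof (cases "i \<le> y")
    case True
    then show ?thesis by (simp add: span_zero)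
  next
    case False
    let ?w = "foldr A ys v"
    have y: "y \<in> I" and ys: "set ys \<subseteq> I" using Cons.prems by auto
    have w: "?w \<in> V" using foldr_in_V[OF ys] .
    have ins: "foldr A (insort i ys) v \<in> V"
      by (rule foldr_in_V) (use ys assms(2) in \<open>auto simp: set_insort_key\<close>)
    have "(\<lambda>k. A k ?w) ` I \<subseteq> words (Suc (length ys))"
    proof
      fix x assume "x \<in> (\<lambda>k. A k ?w) ` I"
      then obtain k where "k \<in> I" "x = foldr A (k # ys) v" by auto
      then show "x \<in> words (Suc (length ys))"
        unfolding words_def using ys by (intro CollectI exI[of _ "k # ys"]) auto
    qed
    then have 1: "A i (A y ?w) - A y (A i ?w) \<in> span (words (Suc (length ys)))"
      using comm[OF assms(2) y w] span_mono by blast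
    have "A y (A i ?w) - A y (foldr A (insort i ys) v) = A y (A i ?w - foldr A (insort i ys) v)"
      by (rule linear_map_on_diff[OF vs vs V lin[OF y] closed[OF assms(2) w] ins, symmetric])
    then have 2: "A y (A i ?w) - A y (foldr A (insort i ys) v) \<in> span (words (Suc (length ys)))"
      using apply_span_words[OF y Cons.IH[OF ys]] by simp
    have "(A i (A y ?w) - A y (A i ?w)) + (A y (A i ?w) - A y (foldr A (insort i ys) v))
        \<in> span (words (Suc (length ys)))"
      using 1 2 by (rule span_add)
    then show ?thesis using False by simp
  qed
qed

lemma words_subset_span_sorted: "words n \<subseteq> span (sorted_words n)"
proof (induction n)
  case 0
  show ?case unfolding words_def sorted_words_def by (auto intro!: span_base)
next
  case (Suc n)
  have mono: "words m \<subseteq> words k" "sorted_words m \<subseteq> sorted_words k" if "m \<le> k" for m k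
    unfolding words_def sorted_words_def using that le_trans by blast+
  have IH: "span (words n) \<subseteq> span (sorted_words n)" using Suc span_minimal subspace_span by blast
  show ?case
  proof
    fix x assume "x \<in> words (Suc n)"
    then obtain xs where xs: "x = foldr A xs v" "set xs \<subseteq> I" "length xs \<le> Suc n"
      unfolding words_def by blast
    show "x \<in> span (sorted_words (Suc n))"
    proof (cases xs)
      case Nil
      then have "x \<in> sorted_words (Suc n)" unfolding sorted_words_def using xs
        by (intro CollectI exI[of _ xs]) auto
      then show ?thesis by (rule span_base)
    next
      case (Cons i ys)
      then have i: "i \<in> I" and ys: "foldr A ys v \<in> span (words n)"
        using xs by (auto simp: words_def intro!: span_base)
      have "A i (foldr A ys v) \<in> span (sorted_words (Suc n))"
      proof (rule linear_map_on_span[OF vs vs V lin[OF i] _ subspace_span])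
        show "foldr A ys v \<in> span (sorted_words n)" using ys IH by blast
        show "sorted_words n \<subseteq> V" unfolding sorted_words_def using foldr_in_V by auto
        fix z assume "z \<in> sorted_words n"
        then obtain zs where zs: "z = foldr A zs v" "set zs \<subseteq> I" "length zs \<le> n" "sorted zs"
          unfolding sorted_words_def by blast
        have "foldr A (insort i zs) v \<in> sorted_words (Suc n)"
          unfolding sorted_words_def using zs i
          by (intro CollectI exI[of _ "insort i zs"]) (auto simp: set_insort_key sorted_insort)
        then have 1: "foldr A (insort i zs) v \<in> span (sorted_words (Suc n))" by (rule span_base)
        have "A i z - foldr A (insort i zs) v \<in> span (words (length zs))"
          using insort_mod_shorter[OF zs(2) i] zs(1) by simp
        then have "A i z - foldr A (insort i zs) v \<in> span (sorted_words (Suc n))"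
          using span_mono[OF mono(1)[OF zs(3)]] span_mono[OF mono(2)[of n "Suc n"]] IH by auto
        from span_add[OF this 1] show "A i z \<in> span (sorted_words (Suc n))" by simp
      qed
      then show ?thesis using xs(1) Cons by simp
    qed
  qed
qed

end

text \<open>
  A sorted word is determined by the multiplicities of its letters, that is, by an exponent tuple.
\<close>

lemma span_ordered_monomials:
  fixes A :: "nat \<Rightarrow> 'v::ab_group_add \<Rightarrow> 'v"
  assumes "straightening sv V A {1..N} v" "set xs \<subseteq> {1..N}"
  shows "foldr A xs v \<in> module.span sv
    {foldr (\<lambda>i w. (A i ^^ p i) w) [1..<Suc N] v |p. p \<in> exponent_tuples N}" (is "_ \<in> module.span sv ?X")
proof -
  interpret straightening sv V A "{1..N}" v by fact
  have "sorted_words n \<subseteq> ?X" for n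
  proof
    fix x assume "x \<in> sorted_words n"
    then obtain zs where zs: "x = foldr A zs v" "set zs \<subseteq> {1..N}" "sorted zs"
      unfolding sorted_words_def by blast
    have "set zs \<subseteq> {1..<Suc N}" using zs(2) by auto
    then have concat: "zs = concat (map (\<lambda>i. replicate (count_list zs i) i) [1..<Suc N])"
      by (rule sorted_eq_concat_replicate[OF zs(3)])
    have "foldr A (concat (map (\<lambda>i. replicate (p i) i) is)) v = foldr (\<lambda>i w. (A i ^^ p i) w) is v"
      for p "is" by (induction "is") (auto simp: foldr_replicate)
    then have "x = foldr (\<lambda>i w. (A i ^^ count_list zs i) w) [1..<Suc N] v"
      using concat zs(1) by metis
    moreover have "count_list zs \<in> exponent_tuples N"
      unfolding exponent_tuples_def using zs(2) by (auto simp: count_list_0_iff)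
    ultimately show "x \<in> ?X" by blast
  qed
  moreover have "foldr A xs v \<in> words (length xs)" unfolding words_def using assms(2) by blast
  ultimately show ?thesis using words_subset_span_sorted span_mono by blast
qed

section \<open>Modules and triangular decompositions\<close>

locale lie_module =
  fixes sg :: "complex \<Rightarrow> 'g::ab_group_add \<Rightarrow> 'g" and br :: "'g \<Rightarrow> 'g \<Rightarrow> 'g" and L :: "'g set"
    and sv :: "complex \<Rightarrow> 'v::ab_group_add \<Rightarrow> 'v" and \<rho> :: "'g \<Rightarrow> 'v \<Rightarrow> 'v" and V :: "'v set"
  assumes lie: "lie_algebra_on sg br L" and module_on: "lie_module_on sg br L sv \<rho> V"
begin

sublocale G: vector_space sg using lie unfolding lie_algebra_on_def by blast
sublocale M: vector_space sv using module_on unfolding lie_module_on_def by blast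

lemma L_subspace: "G.subspace L" using lie unfolding lie_algebra_on_def by blast
lemma V_subspace: "M.subspace V" using module_on unfolding lie_module_on_def by blast
lemma br_closed: "x \<in> L \<Longrightarrow> y \<in> L \<Longrightarrow> br x y \<in> L" using lie unfolding lie_algebra_on_def by blast
lemma act_closed: "x \<in> L \<Longrightarrow> w \<in> V \<Longrightarrow> \<rho> x w \<in> V"
  using module_on unfolding lie_module_on_def by blast
lemma act_linear: "x \<in> L \<Longrightarrow> linear_map_on sv sv V (\<rho> x)"
  using module_on unfolding lie_module_on_def by blast
lemma act_linear_left: "w \<in> V \<Longrightarrow> linear_map_on sg sv L (\<lambda>x. \<rho> x w)"
  using module_on unfolding lie_module_on_def by blast
lemma act_add: "x \<in> L \<Longrightarrow> w \<in> V \<Longrightarrow> w' \<in> V \<Longrightarrow> \<rho> x (w + w') = \<rho> x w + \<rho> x w'"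
  using act_linear unfolding linear_map_on_def by blast
lemma act_scale: "x \<in> L \<Longrightarrow> w \<in> V \<Longrightarrow> \<rho> x (sv c w) = sv c (\<rho> x w)"
  using act_linear unfolding linear_map_on_def by blast
lemma act_0: "x \<in> L \<Longrightarrow> \<rho> x 0 = 0"
  using linear_map_on_0[OF M.vector_space_axioms M.vector_space_axioms V_subspace act_linear] .
lemma act_diff: "x \<in> L \<Longrightarrow> w \<in> V \<Longrightarrow> w' \<in> V \<Longrightarrow> \<rho> x (w - w') = \<rho> x w - \<rho> x w'"
  using linear_map_on_diff[OF M.vector_space_axioms M.vector_space_axioms V_subspace act_linear] .
lemma act_sum: "x \<in> L \<Longrightarrow> (\<And>i. i \<in> I \<Longrightarrow> w i \<in> V) \<Longrightarrow> \<rho> x (\<Sum>i\<in>I. w i) = (\<Sum>i\<in>I. \<rho> x (w i))"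
  using linear_map_on_sum[OF M.vector_space_axioms M.vector_space_axioms V_subspace act_linear] .
lemma act_add_left: "x \<in> L \<Longrightarrow> y \<in> L \<Longrightarrow> w \<in> V \<Longrightarrow> \<rho> (x + y) w = \<rho> x w + \<rho> y w"
  using act_linear_left unfolding linear_map_on_def by blast
lemma act_scale_left: "x \<in> L \<Longrightarrow> w \<in> V \<Longrightarrow> \<rho> (sg c x) w = sv c (\<rho> x w)"
  using act_linear_left unfolding linear_map_on_def by blast
lemma act_commute: "x \<in> L \<Longrightarrow> y \<in> L \<Longrightarrow> w \<in> V \<Longrightarrow> \<rho> x (\<rho> y w) = \<rho> y (\<rho> x w) + \<rho> (br x y) w"
  using module_on unfolding lie_module_on_def by simp

lemma act_span:
  "x \<in> L \<Longrightarrow> X \<subseteq> V \<Longrightarrow> M.subspace T \<Longrightarrow> (\<And>w. w \<in> X \<Longrightarrow> \<rho> x w \<in> T) \<Longrightarrow> w \<in> M.span X \<Longrightarrow> \<rho> x w \<in> T"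
  using linear_map_on_span[OF M.vector_space_axioms M.vector_space_axioms V_subspace act_linear] .

lemma act_span_left:
  "w \<in> V \<Longrightarrow> X \<subseteq> L \<Longrightarrow> M.subspace T \<Longrightarrow> (\<And>x. x \<in> X \<Longrightarrow> \<rho> x w \<in> T) \<Longrightarrow> x \<in> G.span X \<Longrightarrow> \<rho> x w \<in> T"
  using linear_map_on_span[OF G.vector_space_axioms M.vector_space_axioms L_subspace act_linear_left] .

text \<open>
  Stated for a single \<open>h\<close>, and used both for simultaneous weights and for gradings by one element;
  for the adjoint module it says that weights add under the bracket.
\<close>

lemma weight_shift:
  assumes "h \<in> L" "x \<in> L" "w \<in> V" "br h x = sg a x" "\<rho> h w = sv c w"
  shows "\<rho> h (\<rho> x w) = sv (c + a) (\<rho> x w)"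
  using act_commute[OF assms(1-3)] assms act_scale[OF assms(2,3)] act_scale_left[OF assms(2,3)]
  by (simp add: M.scale_left_distrib)

end

locale triangular =
  fixes sg :: "complex \<Rightarrow> 'g::ab_group_add \<Rightarrow> 'g" and br :: "'g \<Rightarrow> 'g \<Rightarrow> 'g" and L :: "'g set"
    and P :: "('g \<Rightarrow> complex) set" and um t u :: "'g set"
  assumes lie_alg: "lie_algebra_on sg br L" and tri: "triangular_decomposition sg br L P um t u"
begin

lemma br_skew:
  assumes "x \<in> L" "y \<in> L"
  shows "br y x = - br x y"
proof -
  have vs: "vector_space sg" and sub: "module.subspace sg L"
    and lin: "\<forall>x\<in>L. linear_map_on sg sg L (br x)"
    and linl: "\<forall>y\<in>L. linear_map_on sg sg L (\<lambda>x. br x y)"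
    and alt: "\<forall>x\<in>L. br x x = 0"
    using lie_alg unfolding lie_algebra_on_def by blast+
  interpret vector_space sg by (rule vs)
  have "x + y \<in> L" using assms sub subspace_add by blast
  then have "br (x + y) (x + y) = br x x + br y x + (br x y + br y y)"
    using lin linl assms unfolding linear_map_on_def by (metis add.assoc)
  then have "br y x + br x y = 0" using alt assms \<open>x + y \<in> L\<close> by simp
  then show ?thesis by (simp add: eq_neg_iff_add_eq_0)
qed

sublocale adj: lie_module sg br L sg br L
proof
  show "lie_algebra_on sg br L" by (rule lie_alg)
  have vs: "vector_space sg" and sub: "module.subspace sg L"
    and closed: "\<forall>x\<in>L. \<forall>y\<in>L. br x y \<in> L"
    and lin: "\<forall>x\<in>L. linear_map_on sg sg L (br x)"
    and linl: "\<forall>y\<in>L. linear_map_on sg sg L (\<lambda>x. br x y)"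
    and alt: "\<forall>x\<in>L. br x x = 0"
    and jac: "\<forall>x\<in>L. \<forall>y\<in>L. \<forall>z\<in>L. br x (br y z) + br y (br z x) + br z (br x y) = 0"
    using lie_alg unfolding lie_algebra_on_def by blast+
  interpret vector_space sg by (rule vs)
  note skew = br_skew
  have neg: "br x (- y) = - br x y" if "x \<in> L" "y \<in> L" for x y
    using linear_map_on_diff[OF vs vs sub, of "br x" 0 y] linear_map_on_0[OF vs vs sub, of "br x"]
      lin that sub subspace_0 by simp
  have "br (br x y) z = br x (br y z) - br y (br x z)" if "x \<in> L" "y \<in> L" "z \<in> L" for x y z
  proof -
    have "br z (br x y) = - br (br x y) z" "br y (br z x) = - br y (br x z)"
      using skew[of "br x y" z] skew[of x z] neg[of y "br x z"] closed that by auto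
    then show ?thesis using jac that by (metis add_diff_cancel_right' add_uminus_conv_diff diff_eq_eq
          diff_minus_eq_add eq_iff_diff_eq_0)
  qed
  then show "lie_module_on sg br L sg br L"
    unfolding lie_module_on_def using vs sub closed lin linl by blast
qed

lemma t_subspace: "adj.G.subspace t" and t_subset: "t \<subseteq> L"
  and t_abelian: "h \<in> t \<Longrightarrow> h' \<in> t \<Longrightarrow> br h h' = 0"
  using tri unfolding triangular_decomposition_def by blast+

definition neg_root_vectors :: "'g set" where
  "neg_root_vectors = (\<Union>\<alpha>\<in>P. root_space sg br L t (neg_weight t \<alpha>))"

lemma um_span: "um = adj.G.span neg_root_vectors"
  using tri unfolding triangular_decomposition_def neg_root_vectors_def by blast

lemma neg_root_vectors_subset: "neg_root_vectors \<subseteq> L"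
  unfolding neg_root_vectors_def root_space_def by blast

lemma neg_root_vector_weight:
  "y \<in> neg_root_vectors \<Longrightarrow> \<exists>\<alpha>\<in>P. \<forall>h\<in>t. br h y = sg (- \<alpha> h) y"
  unfolding neg_root_vectors_def root_space_def neg_weight_def by auto

lemma um_subset: "um \<subseteq> L"
  unfolding um_span by (rule adj.G.span_minimal[OF neg_root_vectors_subset adj.L_subspace])

lemma u_subset: "u \<subseteq> L"
proof -
  have "u = adj.G.span (\<Union>\<alpha>\<in>P. root_space sg br L t \<alpha>)"
    using tri unfolding triangular_decomposition_def by blast
  then show ?thesis using adj.G.span_minimal[OF _ adj.L_subspace, of "\<Union>\<alpha>\<in>P. root_space sg br L t \<alpha>"]
    unfolding root_space_def by blast
qed

lemma decompose:
  assumes "x \<in> L"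
  obtains a h b where "a \<in> um" "h \<in> t" "b \<in> u" "x = a + h + b"
proof -
  have "\<exists>!(a, h, b). a \<in> um \<and> h \<in> t \<and> b \<in> u \<and> x = a + h + b"
    using tri assms unfolding triangular_decomposition_def by blast
  then show ?thesis using that by (auto dest!: ex1_implies_ex)
qed

lemma t_um:
  assumes "h \<in> t" "x \<in> um"
  shows "br h x \<in> um"
  unfolding um_span
proof (rule adj.act_span[OF _ neg_root_vectors_subset adj.G.subspace_span])
  show "h \<in> L" "x \<in> adj.G.span neg_root_vectors" using assms t_subset um_span by auto
  fix y assume y: "y \<in> neg_root_vectors"
  then obtain \<alpha> where "br h y = sg (- \<alpha> h) y" using neg_root_vector_weight assms(1) by blast
  then show "br h y \<in> adj.G.span neg_root_vectors"
    using y by (simp only: adj.G.span_scale adj.G.span_base)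
qed

lemma positive_root:
  assumes "\<alpha> \<in> P"
  shows "linear_map_on sg (*) t \<alpha>" "\<exists>h\<in>t. \<alpha> h \<noteq> 0"
proof -
  have "\<alpha> \<in> roots sg br L t"
    using assms tri unfolding triangular_decomposition_def positive_system_def by blast
  then show "linear_map_on sg (*) t \<alpha>" "\<exists>h\<in>t. \<alpha> h \<noteq> 0"
    unfolding roots_def dual_space_def by auto
qed

text \<open>
  On these elements a positive root takes a positive integer value, such as its height. They turn
  statements about weights into statements about eigenvalues of one operator.
\<close>

definition height_element :: "'g \<Rightarrow> bool" where
  "height_element h \<longleftrightarrow> h \<in> t \<and> (\<forall>\<alpha>\<in>P. \<exists>n>0. \<alpha> h = of_nat n)"

text \<open>The simple roots are independent, so some \<open>h0\<close> takes the value 1 at each of them.\<close>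

lemma height_element_exists: "\<exists>h. height_element h"
proof -
  obtain S where S: "root_base t (roots sg br L t) S"
    and P: "P = {\<alpha> \<in> roots sg br L t. \<exists>k :: ('g \<Rightarrow> complex) \<Rightarrow> nat.
            \<forall>h\<in>t. \<alpha> h = (\<Sum>\<beta>\<in>S. of_nat (k \<beta>) * \<beta> h)}"
    using tri unfolding triangular_decomposition_def positive_system_def by blast
  have fin: "finite S" and roots: "S \<subseteq> roots sg br L t"
    and indep: "\<And>c. (\<forall>h\<in>t. (\<Sum>\<beta>\<in>S. c \<beta> * \<beta> h) = 0) \<longrightarrow> (\<forall>\<beta>\<in>S. c \<beta> = 0)"
    using S unfolding root_base_def by auto
  have "\<exists>h\<in>t. \<forall>\<beta>\<in>S. \<beta> h = (\<lambda>_. 1) \<beta>"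
  proof (rule independent_functionals_dual[OF adj.G.vector_space_axioms t_subspace fin])
    show "linear_map_on sg (*) t \<beta>" if "\<beta> \<in> S" for \<beta>
      using roots that unfolding roots_def dual_space_def by blast
    show "\<forall>\<beta>\<in>S. c \<beta> = 0" if "\<And>h. h \<in> t \<Longrightarrow> (\<Sum>\<beta>\<in>S. c \<beta> * \<beta> h) = 0" for c
      using indep[of c] that by blast
  qed
  then obtain h0 where h0: "h0 \<in> t" "\<And>\<beta>. \<beta> \<in> S \<Longrightarrow> \<beta> h0 = 1" by auto
  have "\<exists>n>0. \<alpha> h0 = of_nat n" if \<alpha>: "\<alpha> \<in> P" for \<alpha>
  proof -
    obtain k :: "('g \<Rightarrow> complex) \<Rightarrow> nat" where k: "\<And>h. h \<in> t \<Longrightarrow> \<alpha> h = (\<Sum>\<beta>\<in>S. of_nat (k \<beta>) * \<beta> h)"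
      using \<alpha> P by blast
    obtain h where "h \<in> t" "\<alpha> h \<noteq> 0" using positive_root(2)[OF \<alpha>] by blast
    then obtain \<beta> where "\<beta> \<in> S" "k \<beta> > 0"
      using k by (metis (no_types, lifting) gr0I mult_zero_left of_nat_0 sum.neutral)
    then have "(\<Sum>\<beta>\<in>S. k \<beta>) > 0" using fin by (metis gr0I sum_eq_0_iff less_numeral_extra(3))
    moreover have "\<alpha> h0 = (\<Sum>\<beta>\<in>S. of_nat (k \<beta>))"
      unfolding k[OF h0(1)] using h0(2) by (intro sum.cong) auto
    then have "\<alpha> h0 = of_nat (\<Sum>\<beta>\<in>S. k \<beta>)" by simp
    ultimately show ?thesis by blast
  qed
  then show ?thesis using h0(1) unfolding height_element_def by blast
qed

end

section \<open>Highest weight modules\<close>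

locale highest_weight_module = triangular sg br L P um t u
  for sg :: "complex \<Rightarrow> 'g::ab_group_add \<Rightarrow> 'g" and br :: "'g \<Rightarrow> 'g \<Rightarrow> 'g" and L :: "'g set"
    and P :: "('g \<Rightarrow> complex) set" and um t u :: "'g set" +
  fixes sv :: "complex \<Rightarrow> 'v::ab_group_add \<Rightarrow> 'v" and \<rho> :: "'g \<Rightarrow> 'v \<Rightarrow> 'v" and V :: "'v set"
    and \<Lambda> :: "'g \<Rightarrow> complex" and v :: 'v
  assumes hwm: "irreducible_highest_weight_module sg br L t u sv \<rho> V \<Lambda> v"
begin

sublocale lie_module sg br L sv \<rho> V
  using lie_alg hwm
  unfolding lie_module_def irreducible_highest_weight_module_def irreducible_lie_module_def by blast

lemma v_in: "v \<in> V" and v_nonzero: "v \<noteq> 0"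
  and v_weight: "h \<in> t \<Longrightarrow> \<rho> h v = sv (\<Lambda> h) v" and v_highest: "x \<in> u \<Longrightarrow> \<rho> x v = 0"
  using hwm unfolding irreducible_highest_weight_module_def highest_weight_vector_def by blast+

lemma foldr_act_in: "set ys \<subseteq> L \<Longrightarrow> foldr \<rho> ys v \<in> V"
  by (induction ys) (auto simp: v_in act_closed)

text \<open>
  Moving an element of \<open>L\<close> to the right through a word leaves commutators in \<open>L\<close>, applied to shorter
  words; on \<open>v\<close> itself the upper part vanishes. So the words span a submodule.
\<close>

lemma span_words:
  assumes Y: "Y \<subseteq> L" "um \<subseteq> adj.G.span Y"
  shows "M.span {foldr \<rho> ys v |ys. set ys \<subseteq> Y} = V" (is "M.span ?W = V")
proof -
  have WV: "?W \<subseteq> V" using foldr_act_in Y(1) by blast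
  have step: "\<rho> y w \<in> M.span ?W" if "y \<in> Y" "w \<in> M.span ?W" for y w
  proof (rule act_span[OF _ WV M.subspace_span _ that(2)])
    show "y \<in> L" using that Y by blast
    fix w assume "w \<in> ?W"
    then obtain ys where "w = foldr \<rho> ys v" "set ys \<subseteq> Y" by blast
    then have "\<rho> y w = foldr \<rho> (y # ys) v \<and> set (y # ys) \<subseteq> Y" using that(1) by simp
    then have "\<rho> y w \<in> ?W" by blast
    then show "\<rho> y w \<in> M.span ?W" by (rule M.span_base)
  qed
  have v_span: "v \<in> M.span ?W"
    by (rule M.span_base) (rule CollectI, rule exI[of _ "[]"], simp)
  have word: "\<rho> x (foldr \<rho> ys v) \<in> M.span ?W" if "set ys \<subseteq> Y" "x \<in> L" for x ys
    using that
  proof (induction ys arbitrary: x)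
    case Nil
    obtain a h b where abc: "a \<in> um" "h \<in> t" "b \<in> u" "x = a + h + b" using decompose Nil(2) .
    have sub: "a \<in> L" "h \<in> L" "b \<in> L" using abc um_subset t_subset u_subset by auto
    have "\<rho> x v = \<rho> a v + sv (\<Lambda> h) v"
      using act_add_left[of "a + h" b v] act_add_left[of a h v] sub v_in v_weight[OF abc(2)]
        v_highest[OF abc(3)] adj.G.subspace_add[OF L_subspace] abc(4) by simp
    moreover have "\<rho> a v \<in> M.span ?W"
    proof (rule act_span_left[OF v_in Y(1) M.subspace_span])
      show "a \<in> adj.G.span Y" using abc(1) Y(2) by blast
    qed (rule step[OF _ v_span])
    ultimately show ?case using v_span by (simp add: M.span_add M.span_scale)
  next
    case (Cons y ys)
    then have y: "y \<in> Y" "y \<in> L" "set ys \<subseteq> Y" using Y(1) by auto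
    let ?w = "foldr \<rho> ys v"
    have w: "?w \<in> V" using foldr_act_in y(3) Y(1) by blast
    have "\<rho> x (\<rho> y ?w) = \<rho> y (\<rho> x ?w) + \<rho> (br x y) ?w" using act_commute Cons.prems(2) y w by blast
    moreover have "\<rho> y (\<rho> x ?w) \<in> M.span ?W" using step y Cons by blast
    moreover have "\<rho> (br x y) ?w \<in> M.span ?W"
      using Cons.IH[OF y(3) br_closed[OF Cons.prems(2) y(2)]] .
    ultimately show ?case by (simp add: M.span_add)
  qed
  have "\<rho> x w \<in> M.span ?W" if "x \<in> L" "w \<in> M.span ?W" for x w
    by (rule act_span[OF that(1) WV M.subspace_span _ that(2)]) (use word that(1) in blast)
  moreover have "M.span ?W \<subseteq> V" by (rule M.span_minimal[OF WV V_subspace])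
  moreover have "M.span ?W \<noteq> {0}" using v_span v_nonzero by blast
  moreover have "W = {0} \<or> W = V"
    if "M.subspace W" "W \<subseteq> V" "\<forall>x\<in>L. \<forall>w\<in>W. \<rho> x w \<in> W" for W
    using hwm that unfolding irreducible_highest_weight_module_def irreducible_lie_module_def by blast
  ultimately show ?thesis using M.subspace_span[of ?W] by blast
qed

text \<open>
  For a height element \<open>h\<close> these are the layers of \<open>V\<close> by distance from the highest weight, and the
  filtration that they define.
\<close>

definition depth_space :: "'g \<Rightarrow> nat \<Rightarrow> 'v set" where
  "depth_space h n = {w \<in> V. \<rho> h w = sv (\<Lambda> h - of_nat n) w}"

definition deep :: "'g \<Rightarrow> nat \<Rightarrow> 'v set" where
  "deep h k = M.span (\<Union>n\<in>{k..}. depth_space h n)"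

lemma depth_space_subset: "depth_space h n \<subseteq> V"
  unfolding depth_space_def by blast

lemma deep_subset: "deep h k \<subseteq> V"
  unfolding deep_def using M.span_minimal[OF _ V_subspace] depth_space_subset by blast

lemma deep_antimono: "k \<le> l \<Longrightarrow> deep h l \<subseteq> deep h k"
  unfolding deep_def by (intro M.span_mono UN_mono) auto

lemma subspace_depth_space:
  assumes "h \<in> L"
  shows "M.subspace (depth_space h n)"
proof (rule M.subspaceI)
  show "0 \<in> depth_space h n"
    unfolding depth_space_def using act_0[OF assms] M.subspace_0[OF V_subspace] by simp
next
  fix x y assume "x \<in> depth_space h n" "y \<in> depth_space h n"
  then show "x + y \<in> depth_space h n"
    unfolding depth_space_def using act_add[OF assms] M.subspace_add[OF V_subspace]
    by (simp add: M.scale_right_distrib)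
next
  fix c x assume "x \<in> depth_space h n"
  then show "sv c x \<in> depth_space h n"
    unfolding depth_space_def using act_scale[OF assms] M.subspace_scale[OF V_subspace]
    by (simp add: mult.commute)
qed

lemma deep_sum:
  assumes "h \<in> L" "x \<in> deep h k"
  obtains J e where "finite J" "J \<subseteq> {k..}" "\<And>n. n \<in> J \<Longrightarrow> e n \<in> depth_space h n" "x = (\<Sum>n\<in>J. e n)"
proof -
  have "\<exists>J e. finite J \<and> J \<subseteq> {k..} \<and> (\<forall>n\<in>J. e n \<in> depth_space h n) \<and> x = (\<Sum>n\<in>J. e n)"
    using assms(2) unfolding deep_def
  proof (induction rule: M.span_induct_alt)
    case base
    show ?case by (rule exI[of _ "{}"]) simp
  next
    case (step c x y)
    then obtain m J e where m: "m \<ge> k" "x \<in> depth_space h m"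
      and J: "finite J" "J \<subseteq> {k..}" "\<forall>n\<in>J. e n \<in> depth_space h n" "y = (\<Sum>n\<in>J. e n)" by auto
    let ?e = "e(m := sv c x + (if m \<in> J then e m else 0))"
    note sub = subspace_depth_space[OF assms(1)]
    have "\<forall>n\<in>insert m J. ?e n \<in> depth_space h n"
      using m(2) J(3) sub by (auto simp: M.subspace_add M.subspace_scale)
    moreover have "sv c x + y = (\<Sum>n\<in>insert m J. ?e n)"
    proof -
      have "(\<Sum>n\<in>insert m J. ?e n) = ?e m + (\<Sum>n\<in>J - {m}. ?e n)"
        using J(1) by (rule sum.insert_remove)
      also have "(\<Sum>n\<in>J - {m}. ?e n) = (\<Sum>n\<in>J - {m}. e n)" by (intro sum.cong) auto
      also have "?e m + \<dots> = sv c x + (\<Sum>n\<in>J. e n)"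
        using sum.remove[OF J(1), of m e] by (auto simp: add.assoc)
      finally show ?thesis using J(4) by simp
    qed
    ultimately show ?case using J(1,2) m(1)
      by (intro exI[of _ "insert m J"] exI[of _ ?e]) auto
  qed
  then show ?thesis using that by blast
qed

lemma depth_spaces_independent:
  assumes "h \<in> L" "finite J" "\<And>n. n \<in> J \<Longrightarrow> e n \<in> depth_space h n" "(\<Sum>n\<in>J. e n) = 0"
  shows "\<forall>n\<in>J. e n = 0"
  by (rule eigenvectors_sum_zero[OF M.vector_space_axioms V_subspace act_linear[OF assms(1)] assms(2),
        where c = "\<lambda>n. \<Lambda> h - of_nat n"])
    (use assms in \<open>auto simp: depth_space_def inj_on_def\<close>)

lemma depth_0_deep_1:
  assumes "h \<in> L" "x \<in> depth_space h 0" "x \<in> deep h 1"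
  shows "x = 0"
proof -
  obtain J e where J: "finite J" "J \<subseteq> {1..}" "\<And>n. n \<in> J \<Longrightarrow> e n \<in> depth_space h n" "x = (\<Sum>n\<in>J. e n)"
    using deep_sum[OF assms(1,3)] by metis
  have "0 \<notin> J" using J(2) by auto
  have "- x \<in> depth_space h 0"
    using subspace_depth_space[OF assms(1)] assms(2) by (rule M.subspace_neg)
  then have "\<forall>n\<in>insert 0 J. (e(0 := - x)) n = 0"
    using J \<open>0 \<notin> J\<close>
    by (intro depth_spaces_independent[OF assms(1)]) (auto simp: sum.insert_if intro!: sum.cong)
  then show ?thesis by simp
qed

text \<open>
  Eigenvectors for distinct eigenvalues are independent, so only finitely many depths occur in a
  finite-dimensional module.
\<close>

lemma deep_eventually_zero:
  assumes "h \<in> L"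
  shows "\<exists>d. deep h d = {0}"
proof -
  obtain B where B: "finite B" "V \<subseteq> M.span B"
    using hwm unfolding irreducible_highest_weight_module_def finite_dim_on_def by blast
  let ?N = "{n. depth_space h n \<noteq> {0}}"
  have zero: "0 \<in> depth_space h n" for n using subspace_depth_space[OF assms] M.subspace_0 by blast
  have "finite ?N"
  proof (rule ccontr)
    assume "infinite ?N"
    then obtain J where J: "J \<subseteq> ?N" "finite J" "card J = Suc (card B)"
      by (meson infinite_arbitrarily_large)
    have "\<forall>n\<in>J. \<exists>w. w \<in> depth_space h n \<and> w \<noteq> 0" using J(1) zero by blast
    then obtain e where e: "\<And>n. n \<in> J \<Longrightarrow> e n \<in> depth_space h n" "\<And>n. n \<in> J \<Longrightarrow> e n \<noteq> 0"
      using bchoice[of J "\<lambda>n w. w \<in> depth_space h n \<and> w \<noteq> 0"] by blast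
    have inj: "inj_on e J"
    proof (rule inj_onI)
      fix n m assume nm: "n \<in> J" "m \<in> J" "e n = e m"
      then have "sv (\<Lambda> h - of_nat n) (e n) = sv (\<Lambda> h - of_nat m) (e n)"
        using e(1)[OF nm(1)] e(1)[OF nm(2)] unfolding depth_space_def by simp
      then show "n = m" using e(2)[OF nm(1)] by simp
    qed
    have "M.independent (e ` J)"
    proof
      assume "M.dependent (e ` J)"
      then obtain c where c: "\<exists>n\<in>J. c (e n) \<noteq> 0" "(\<Sum>w\<in>e ` J. sv (c w) w) = 0"
        using M.dependent_finite[of "e ` J"] J(2) by auto
      have "(\<Sum>n\<in>J. sv (c (e n)) (e n)) = 0" 
        using c(2) sum.reindex[OF inj, of "\<lambda>w. sv (c w) w"] by (simp add: o_def)
      then have "\<forall>n\<in>J. sv (c (e n)) (e n) = 0"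
        using e(1) subspace_depth_space[OF assms]
        by (intro depth_spaces_independent[OF assms J(2)]) (auto intro: M.subspace_scale)
      then show False using c(1) e(2) by auto
    qed
    moreover have "e ` J \<subseteq> M.span B" using e(1) B(2) depth_space_subset by blast
    ultimately have "card (e ` J) \<le> card B" using M.independent_span_bound[OF B(1)] by blast
    then show False using J(3) card_image[OF inj] by simp
  qed
  then obtain d where d: "\<forall>n\<in>?N. n < d" using finite_nat_set_iff_bounded by blast
  have "deep h d \<subseteq> M.span {0}" unfolding deep_def using d by (intro M.span_mono) force
  moreover have "0 \<in> deep h d" unfolding deep_def by (rule M.span_zero)
  ultimately have "deep h d = {0}" by auto
  then show ?thesis ..
qed

lemma um_deepens:
  assumes h: "height_element h"
    and x: "x \<in> um" "w \<in> deep h k"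
  shows "\<rho> x w \<in> deep h (Suc k)"
proof -
  have ht: "h \<in> t" and hP: "\<And>\<alpha>. \<alpha> \<in> P \<Longrightarrow> \<exists>n>0. \<alpha> h = of_nat n"
    using h unfolding height_element_def by blast+
  have hL: "h \<in> L" using ht t_subset by blast
  have gen: "\<rho> y z \<in> deep h (Suc k)" if y: "y \<in> neg_root_vectors" and z: "z \<in> depth_space h n" "n \<ge> k" for y z n
  proof -
    obtain \<alpha> where \<alpha>: "\<alpha> \<in> P" "br h y = sg (- \<alpha> h) y" using neg_root_vector_weight[OF y] ht by blast
    obtain m :: nat where m: "m > 0" "\<alpha> h = of_nat m" using hP[OF \<alpha>(1)] by blast
    have y': "y \<in> L" using y neg_root_vectors_subset by blast
    have z': "z \<in> V" "\<rho> h z = sv (\<Lambda> h - of_nat n) z" using z unfolding depth_space_def by auto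
    have "\<rho> h (\<rho> y z) = sv (\<Lambda> h - of_nat n + - \<alpha> h) (\<rho> y z)"
      using weight_shift[OF hL y' z'(1) \<alpha>(2) z'(2)] .
    also have "\<Lambda> h - of_nat n + - \<alpha> h = \<Lambda> h - of_nat (n + m)" using m(2) by simp
    finally have "\<rho> h (\<rho> y z) = sv (\<Lambda> h - of_nat (n + m)) (\<rho> y z)" .
    moreover have "\<rho> y z \<in> V" using act_closed[OF y' z'(1)] .
    ultimately have "\<rho> y z \<in> depth_space h (n + m)" unfolding depth_space_def by simp
    then show ?thesis unfolding deep_def using z(2) m(1) by (intro M.span_base UN_I[of "n + m"]) auto
  qed
  have sub: "M.subspace (deep h (Suc k))" unfolding deep_def by (rule M.subspace_span)
  have wV: "w \<in> V" using x(2) deep_subset by blast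
  have "\<rho> y w \<in> deep h (Suc k)" if y: "y \<in> neg_root_vectors" for y
  proof (rule act_span[OF _ _ sub _ x(2)[unfolded deep_def]])
    show "y \<in> L" using y neg_root_vectors_subset by blast
    show "(\<Union>n\<in>{k..}. depth_space h n) \<subseteq> V" using depth_space_subset by blast
  qed (use gen[OF y] in auto)
  then show ?thesis
    using act_span_left[OF wV neg_root_vectors_subset sub] x(1) um_span by blast
qed

lemma v_depth: "h \<in> t \<Longrightarrow> v \<in> depth_space h 0"
  unfolding depth_space_def using v_in v_weight by simp

lemma deep_0:
  assumes h: "height_element h"
  shows "deep h 0 = V"
proof
  show "deep h 0 \<subseteq> V" by (rule deep_subset)
  have ht: "h \<in> t" using h unfolding height_element_def by blast
  have word: "foldr \<rho> ys v \<in> deep h 0" if "set ys \<subseteq> neg_root_vectors" for ys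
    using that
  proof (induction ys)
    case Nil
    show ?case unfolding deep_def using v_depth[OF ht] by (auto intro!: M.span_base)
  next
    case (Cons y ys)
    then have "y \<in> um" unfolding um_span by (auto intro: adj.G.span_base)
    then have "foldr \<rho> (y # ys) v \<in> deep h (Suc 0)" using um_deepens[OF h] Cons by simp
    then show ?case using deep_antimono[of 0 "Suc 0"] by blast
  qed
  have "M.span {foldr \<rho> ys v |ys. set ys \<subseteq> neg_root_vectors} \<subseteq> deep h 0"
    by (rule M.span_minimal) (use word in \<open>auto simp: deep_def\<close>)
  then show "V \<subseteq> deep h 0" using span_words[OF neg_root_vectors_subset] um_span by simp
qed

text \<open>
  Uniformly in \<open>x\<close>, since every element of \<open>um\<close> increases the depth by at least 1.
\<close>

lemma um_nilpotent: "\<exists>d. \<forall>x\<in>um. \<forall>w\<in>V. (\<rho> x ^^ d) w = 0"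
proof -
  obtain h where h: "height_element h" using height_element_exists ..
  have ht: "h \<in> t" using h unfolding height_element_def by blast
  obtain d where d: "deep h d = {0}" using deep_eventually_zero ht t_subset by blast
  have "(\<rho> x ^^ k) w \<in> deep h k" if "x \<in> um" "w \<in> deep h 0" for x w k
    by (induction k) (use that um_deepens[OF h] in auto)
  then show ?thesis using d deep_0[OF h] by blast
qed

text \<open>
  \<open>V\<close> is the sum of the line of \<open>v\<close> and the span of the \<open>\<rho> x w\<close> with \<open>x \<in> um\<close>; the sum is direct
  because the latter lies in positive depth.
\<close>

lemma coinvariants:
  obtains \<psi> where "linear_map_on sv (*) V \<psi>" "\<psi> v = 1"
    "\<And>x w. x \<in> um \<Longrightarrow> w \<in> V \<Longrightarrow> \<psi> (\<rho> x w) = 0"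
    "\<And>h w. h \<in> t \<Longrightarrow> w \<in> V \<Longrightarrow> \<psi> (\<rho> h w) = \<Lambda> h * \<psi> w"
    "\<And>\<omega> w. linear_map_on sv (*) V \<omega> \<Longrightarrow> (\<And>x w. x \<in> um \<Longrightarrow> w \<in> V \<Longrightarrow> \<omega> (\<rho> x w) = 0) \<Longrightarrow> w \<in> V \<Longrightarrow>
      \<omega> w = \<omega> v * \<psi> w"
proof -
  obtain h where h: "height_element h" using height_element_exists ..
  have ht: "h \<in> t" using h unfolding height_element_def by blast
  have hL: "h \<in> L" using ht t_subset by blast
  define K where "K = M.span {\<rho> x w |x w. x \<in> um \<and> w \<in> V}"
  have K: "M.subspace K" unfolding K_def by (rule M.subspace_span)
  have gensV: "{\<rho> x w |x w. x \<in> um \<and> w \<in> V} \<subseteq> V" using act_closed um_subset by blast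
  have in_K: "\<rho> x w \<in> K" if "x \<in> um" "w \<in> V" for x w
    unfolding K_def using that by (intro M.span_base) blast
  have ex: "\<exists>c. w - sv c v \<in> K" if "w \<in> V" for w
  proof -
    have "w \<in> M.span {foldr \<rho> ys v |ys. set ys \<subseteq> neg_root_vectors}"
      using that span_words[OF neg_root_vectors_subset] um_span by simp
    then show ?thesis
    proof (induction rule: M.span_induct_alt)
      case base
      show ?case using M.subspace_0[OF K] by (auto intro: exI[of _ 0])
    next
      case (step a x y)
      then obtain ys where ys: "x = foldr \<rho> ys v" "set ys \<subseteq> neg_root_vectors" by blast
      have "\<exists>c. x - sv c v \<in> K"
      proof (cases ys)
        case Nil
        then show ?thesis using ys M.subspace_0[OF K] by (auto intro!: exI[of _ 1])
      next
        case (Cons y' ys')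
        then have "y' \<in> um" "foldr \<rho> ys' v \<in> V"
          using ys foldr_act_in[of ys'] neg_root_vectors_subset unfolding um_span
          by (auto intro: adj.G.span_base)
        then show ?thesis using in_K Cons ys by (auto intro!: exI[of _ 0])
      qed
      then obtain c c' where "x - sv c v \<in> K" "y - sv c' v \<in> K" using step.IH by blast
      then have "sv a (x - sv c v) + (y - sv c' v) \<in> K" using K by (simp add: M.subspace_add M.subspace_scale)
      then have "(sv a x + y) - sv (a * c + c') v \<in> K"
        by (simp add: M.scale_right_diff_distrib M.scale_left_distrib algebra_simps)
      then show ?case by blast
    qed
  qed
  have K_deep: "K \<subseteq> deep h 1"
    unfolding K_def
  proof (rule M.span_minimal)
    show "M.subspace (deep h 1)" unfolding deep_def by (rule M.subspace_span)
    have "\<rho> x w \<in> deep h 1" if "x \<in> um" "w \<in> V" for x w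
      using um_deepens[OF h that(1), of w 0] that(2) deep_0[OF h] by simp
    then show "{\<rho> x w |x w. x \<in> um \<and> w \<in> V} \<subseteq> deep h 1" by blast
  qed
  have v_notin: "v \<notin> K" using depth_0_deep_1[OF hL v_depth[OF ht]] K_deep v_nonzero by blast
  have unique: "c = c'" if "w - sv c v \<in> K" "w - sv c' v \<in> K" for w c c'
  proof (rule ccontr)
    assume ne: "c \<noteq> c'"
    have "(w - sv c v) - (w - sv c' v) \<in> K" using that K by (rule_tac M.subspace_diff)
    then have "sv (c' - c) v \<in> K" by (simp add: M.scale_left_diff_distrib)
    then have "sv (inverse (c' - c)) (sv (c' - c) v) \<in> K" using K by (rule_tac M.subspace_scale)
    then show False using ne v_notin by simp
  qed
  define \<psi> where "\<psi> w = (SOME c. w - sv c v \<in> K)" for w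
  have \<psi>: "w - sv (\<psi> w) v \<in> K" if "w \<in> V" for w
    unfolding \<psi>_def using ex[OF that] by (rule someI_ex)
  have eqI: "\<psi> w = c" if "w \<in> V" "w - sv c v \<in> K" for w c
    by (rule unique[OF \<psi>[OF that(1)] that(2)])
  have add: "\<psi> (x + y) = \<psi> x + \<psi> y" if "x \<in> V" "y \<in> V" for x y
  proof (rule eqI)
    show "x + y \<in> V" using that V_subspace M.subspace_add by blast
    have "(x - sv (\<psi> x) v) + (y - sv (\<psi> y) v) \<in> K" using \<psi> that K M.subspace_add by blast
    then show "x + y - sv (\<psi> x + \<psi> y) v \<in> K" by (simp add: M.scale_left_distrib algebra_simps)
  qed
  have scale: "\<psi> (sv c x) = c * \<psi> x" if "x \<in> V" for c x
  proof (rule eqI)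
    show "sv c x \<in> V" using that V_subspace M.subspace_scale by blast
    have "sv c (x - sv (\<psi> x) v) \<in> K" using \<psi> that K M.subspace_scale by blast
    then show "sv c x - sv (c * \<psi> x) v \<in> K" by (simp add: M.scale_right_diff_distrib)
  qed
  have lin: "linear_map_on sv (*) V \<psi>" unfolding linear_map_on_def using add scale by blast
  have kill: "\<psi> (\<rho> x w) = 0" if "x \<in> um" "w \<in> V" for x w
  proof (rule eqI)
    show "\<rho> x w \<in> V" using act_closed um_subset that by blast
    show "\<rho> x w - sv 0 v \<in> K" using in_K[OF that] by simp
  qed
  have tK: "\<rho> k x \<in> K" if "k \<in> t" "x \<in> K" for k x
  proof (rule act_span[OF _ gensV K _ that(2)[unfolded K_def]])
    show kL: "k \<in> L" using that t_subset by blast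
    fix z assume "z \<in> {\<rho> x w |x w. x \<in> um \<and> w \<in> V}"
    then obtain x w where z: "z = \<rho> x w" "x \<in> um" "w \<in> V" by blast
    then have "\<rho> k z = \<rho> x (\<rho> k w) + \<rho> (br k x) w" using act_commute kL um_subset by blast
    moreover have "\<rho> k w \<in> V" using act_closed kL z(3) by blast
    ultimately show "\<rho> k z \<in> K" using in_K z t_um[OF that(1)] M.subspace_add[OF K] by simp
  qed
  show ?thesis
  proof (rule that[OF lin _ kill])
    show "\<psi> v = 1" by (rule eqI[OF v_in]) (simp add: M.subspace_0[OF K])
    fix k w assume k: "k \<in> t" and w: "w \<in> V"
    have kL: "k \<in> L" using k t_subset by blast
    show "\<psi> (\<rho> k w) = \<Lambda> k * \<psi> w"
    proof (rule eqI)
      show "\<rho> k w \<in> V" using act_closed kL w .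
      have "\<rho> k (w - sv (\<psi> w) v) \<in> K" using tK[OF k \<psi>[OF w]] .
      moreover have "\<rho> k (w - sv (\<psi> w) v) = \<rho> k w - sv (\<psi> w) (sv (\<Lambda> k) v)"
        using act_diff[OF kL w] act_scale[OF kL v_in] v_weight[OF k] v_in
          M.subspace_scale[OF V_subspace] by simp
      ultimately show "\<rho> k w - sv (\<Lambda> k * \<psi> w) v \<in> K" by (simp add: mult.commute)
    qed
  next
    fix \<omega> w assume \<omega>: "linear_map_on sv (*) V \<omega>" "\<And>x w. x \<in> um \<Longrightarrow> w \<in> V \<Longrightarrow> \<omega> (\<rho> x w) = 0"
      and w: "w \<in> V"
    have C: "vector_space ((*) :: complex \<Rightarrow> complex \<Rightarrow> complex)"
      by unfold_locales (auto simp: algebra_simps)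
    interpret C: vector_space "(*) :: complex \<Rightarrow> complex \<Rightarrow> complex" by (rule C)
    have "\<omega> (w - sv (\<psi> w) v) \<in> {0}"
    proof (rule linear_map_on_span[OF M.vector_space_axioms C V_subspace \<omega>(1) gensV _ _
          \<psi>[OF w, unfolded K_def]])
      show "module.subspace (*) {0::complex}" by (rule C.subspace_single_0)
    qed (use \<omega>(2) in auto)
    moreover have "sv (\<psi> w) v \<in> V" using v_in M.subspace_scale[OF V_subspace] by blast
    then have "\<omega> (w - sv (\<psi> w) v) = \<omega> w - \<psi> w * \<omega> v"
      using linear_map_on_diff[OF M.vector_space_axioms C V_subspace \<omega>(1) w] \<omega>(1) v_in
      unfolding linear_map_on_def by simp
    ultimately show "\<omega> w = \<omega> v * \<psi> w" by (simp add: mult.commute)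
  qed
qed

end

section \<open>Root spaces of a simple Lie algebra\<close>

text \<open>
  A fixed basis of weight vectors, adapted to \<open>L = um \<oplus> t \<oplus> u\<close>. All traces, in particular the Killing
  form, are computed in it.
\<close>

locale weight_basis = triangular sg br L P um t u
  for sg :: "complex \<Rightarrow> 'g::ab_group_add \<Rightarrow> 'g" and br :: "'g \<Rightarrow> 'g \<Rightarrow> 'g" and L :: "'g set"
    and P :: "('g \<Rightarrow> complex) set" and um t u :: "'g set" +
  fixes B :: "'g set" and wt :: "'g \<Rightarrow> 'g \<Rightarrow> complex"
  assumes simple: "simple_lie_algebra sg br L"
    and finite_B: "finite B" and indep_B: "adj.G.independent B" and span_B: "adj.G.span B = L"
    and wt: "b \<in> B \<Longrightarrow> h \<in> t \<Longrightarrow> br h b = sg (wt b h) b"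
    and wt_zero: "b \<in> B \<Longrightarrow> (\<And>h. h \<in> t \<Longrightarrow> wt b h = 0) \<Longrightarrow> b \<in> t"
    and wt_neg: "b \<in> B \<Longrightarrow> height_element h \<Longrightarrow> wt b h = - of_nat (Suc n) \<Longrightarrow> b \<in> um"
begin

abbreviation rep :: "'g \<Rightarrow> 'g \<Rightarrow> complex" where
  "rep \<equiv> adj.G.representation B"

lemma B_subset: "B \<subseteq> L" using span_B adj.G.span_superset[of B] by simp

lemma t_in_L: "h \<in> t \<Longrightarrow> h \<in> L" using t_subset by blast

definition has_weight :: "('g \<Rightarrow> complex) \<Rightarrow> 'g \<Rightarrow> bool" where
  "has_weight \<nu> z \<longleftrightarrow> z \<in> L \<and> (\<forall>h\<in>t. br h z = sg (\<nu> h) z)"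

lemma has_weight_B: "b \<in> B \<Longrightarrow> has_weight (wt b) b"
  unfolding has_weight_def using wt B_subset by blast

lemma has_weight_br:
  assumes "has_weight \<nu> x" "has_weight \<mu> z"
  shows "has_weight (\<lambda>h. \<mu> h + \<nu> h) (br x z)"
  unfolding has_weight_def
proof
  show "br x z \<in> L" using assms adj.br_closed unfolding has_weight_def by blast
  show "\<forall>h\<in>t. br h (br x z) = sg (\<mu> h + \<nu> h) (br x z)"
  proof
    fix h assume "h \<in> t"
    then show "br h (br x z) = sg (\<mu> h + \<nu> h) (br x z)"
      using assms t_in_L unfolding has_weight_def by (intro adj.weight_shift) auto
  qed
qed

lemma has_weight_cong: "has_weight \<nu> z \<Longrightarrow> (\<And>h. h \<in> t \<Longrightarrow> \<nu> h = \<mu> h) \<Longrightarrow> has_weight \<mu> z"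
  unfolding has_weight_def by simp

lemma expand: "z \<in> L \<Longrightarrow> z = (\<Sum>b\<in>B. sg (rep z b) b)"
  using adj.G.sum_representation_eq[OF indep_B _ finite_B order_refl] span_B by simp

lemma rep_sum:
  assumes "b \<in> B"
  shows "rep (\<Sum>c\<in>B. sg (a c) c) b = a b"
proof -
  have "rep (\<Sum>c\<in>B. sg (a c) c) b = (\<Sum>c\<in>B. rep (sg (a c) c) b)"
    by (subst adj.G.representation_sum[OF indep_B]) (auto intro: adj.G.span_scale adj.G.span_base)
  also have "\<dots> = (\<Sum>c\<in>B. if c = b then a c else 0)"
  proof (rule sum.cong)
    fix c assume "c \<in> B"
    then show "rep (sg (a c) c) b = (if c = b then a c else 0)"
      using adj.G.representation_scale[OF indep_B adj.G.span_base, of c "a c"]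
        adj.G.representation_basis[OF indep_B, of c] by simp
  qed simp
  finally show ?thesis using finite_B assms by simp
qed

lemma rep_weight:
  assumes "has_weight \<nu> z" "b \<in> B" "rep z b \<noteq> 0" "h \<in> t"
  shows "wt b h = \<nu> h"
proof -
  have z: "z \<in> L" "br h z = sg (\<nu> h) z" using assms unfolding has_weight_def by blast+
  have "br h z = br h (\<Sum>b\<in>B. sg (rep z b) b)" by (rule arg_cong[OF expand[OF z(1)]])
  also have "\<dots> = (\<Sum>b\<in>B. br h (sg (rep z b) b))"
    using B_subset adj.G.subspace_scale[OF adj.L_subspace]
    by (intro adj.act_sum[OF t_in_L[OF assms(4)]]) blast
  also have "\<dots> = (\<Sum>b\<in>B. sg (rep z b * wt b h) b)"
    using B_subset wt[OF _ assms(4)] by (intro sum.cong) (auto simp: adj.act_scale[OF t_in_L[OF assms(4)]])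
  finally have "rep (br h z) b = rep z b * wt b h" using rep_sum[OF assms(2)] by simp
  moreover have "rep (sg (\<nu> h) z) b = \<nu> h * rep z b"
    using adj.G.representation_scale[OF indep_B] z(1) span_B by simp
  ultimately show ?thesis using z(2) assms(3) by simp
qed

text \<open>
  Weight spaces for arbitrary functionals are controlled by the basis; the span is zero when no basis
  vector has the weight.
\<close>

lemma weight_span:
  assumes "has_weight \<nu> z"
  shows "z \<in> adj.G.span {b \<in> B. \<forall>h\<in>t. wt b h = \<nu> h}"
proof -
  have "sg (rep z b) b \<in> adj.G.span {b \<in> B. \<forall>h\<in>t. wt b h = \<nu> h}" if "b \<in> B" for b
  proof (cases "rep z b = 0")
    case True
    then show ?thesis by (simp add: adj.G.span_zero)
  next
    case False
    then show ?thesis using rep_weight[OF assms that] that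
      by (intro adj.G.span_scale adj.G.span_base) blast
  qed
  then have "(\<Sum>b\<in>B. sg (rep z b) b) \<in> adj.G.span {b \<in> B. \<forall>h\<in>t. wt b h = \<nu> h}"
    by (rule adj.G.span_sum)
  moreover have "z \<in> L" using assms unfolding has_weight_def by blast
  ultimately show ?thesis using expand[symmetric] by simp
qed

lemma weight_zero_in_t:
  assumes "has_weight \<nu> z" "\<And>h. h \<in> t \<Longrightarrow> \<nu> h = 0"
  shows "z \<in> t"
proof -
  have "{b \<in> B. \<forall>h\<in>t. wt b h = \<nu> h} \<subseteq> t" using wt_zero assms(2) by auto
  then show ?thesis using weight_span[OF assms(1)] adj.G.span_minimal[OF _ t_subspace] by blast
qed

lemma weight_negative_in_um:
  assumes "has_weight \<nu> z" "height_element h" "\<nu> h = - of_nat (Suc n)"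
  shows "z \<in> um"
proof -
  have "h \<in> t" using assms(2) unfolding height_element_def by blast
  then have "{b \<in> B. \<forall>h\<in>t. wt b h = \<nu> h} \<subseteq> um" using wt_neg[OF _ assms(2)] assms(3) by auto
  then have "adj.G.span {b \<in> B. \<forall>h\<in>t. wt b h = \<nu> h} \<subseteq> um"
    unfolding um_span by (rule adj.G.span_minimal[OF _ adj.G.subspace_span])
  then show ?thesis using weight_span[OF assms(1)] by blast
qed

text \<open>
  A commutator has trace zero on the string of weight spaces through \<open>wt c\<close> in direction \<open>\<alpha>\<close>; its
  eigenvalues there are \<open>wt c + k \<alpha>\<close> with integers \<open>k\<close>.
\<close>

lemma string_trace:
  assumes x: "has_weight \<alpha> x" and y: "has_weight (\<lambda>h. - \<alpha> h) y" and c: "c \<in> B"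
  shows "\<exists>q::real. wt c (br x y) = of_real q * \<alpha> (br x y)"
proof -
  define T where "T = {b \<in> B. \<exists>k::int. \<forall>h\<in>t. wt b h = wt c h + of_int k * \<alpha> h}"
  have T: "T \<subseteq> B" "finite T" unfolding T_def using finite_B by auto
  have TL: "adj.G.span T \<subseteq> L" using T(1) B_subset adj.G.span_minimal[OF _ adj.L_subspace] by blast
  have xL: "x \<in> L" and yL: "y \<in> L" using x y unfolding has_weight_def by blast+
  have ht: "br x y \<in> t" by (rule weight_zero_in_t[OF has_weight_br[OF x y]]) simp
  have stable: "br z b \<in> adj.G.span T"
    if z: "has_weight \<nu> z" and j: "\<And>h. h \<in> t \<Longrightarrow> \<nu> h = of_int j * \<alpha> h" and b: "b \<in> T" for z \<nu> b j
  proof -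
    obtain k :: int where k: "\<And>h. h \<in> t \<Longrightarrow> wt b h = wt c h + of_int k * \<alpha> h"
      using b unfolding T_def by blast
    have "{b' \<in> B. \<forall>h\<in>t. wt b' h = wt b h + \<nu> h} \<subseteq> T"
    proof
      fix b' assume "b' \<in> {b' \<in> B. \<forall>h\<in>t. wt b' h = wt b h + \<nu> h}"
      then have "b' \<in> B" "\<forall>h\<in>t. wt b' h = wt c h + of_int (k + j) * \<alpha> h"
        using k j by (auto simp: algebra_simps)
      then show "b' \<in> T" unfolding T_def by blast
    qed
    moreover have "b \<in> B" using b T(1) by blast
    ultimately show ?thesis
      using weight_span[OF has_weight_br[OF z has_weight_B[of b]]] adj.G.span_mono by blast
  qed
  have "(\<Sum>b\<in>T. wt b (br x y)) = 0"
  proof (rule trace_commutator_diagonal[OF adj.G.vector_space_axioms T(2)])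
    show "adj.G.independent T" by (rule adj.G.independent_mono[OF indep_B T(1)])
    show "linear_map_on sg sg (adj.G.span T) (br x)" "linear_map_on sg sg (adj.G.span T) (br y)"
      using linear_map_on_subset[OF adj.act_linear TL] xL yL by blast+
    fix b assume b: "b \<in> T"
    show "br x b \<in> adj.G.span T" by (rule stable[OF x _ b, of 1]) simp
    show "br y b \<in> adj.G.span T" by (rule stable[OF y _ b, of "-1"]) simp
    have "b \<in> B" "b \<in> L" using b T(1) B_subset by auto
    then show "br x (br y b) - br y (br x b) = sg (wt b (br x y)) b"
      using adj.act_commute[OF xL yL] wt[OF _ ht] by simp
  qed
  moreover have "\<forall>b\<in>T. \<exists>k::int. wt b (br x y) = wt c (br x y) + of_int k * \<alpha> (br x y)"
    unfolding T_def using ht by blast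
  then obtain k :: "'g \<Rightarrow> int" where
    "\<And>b. b \<in> T \<Longrightarrow> wt b (br x y) = wt c (br x y) + of_int (k b) * \<alpha> (br x y)"
    using bchoice[of T "\<lambda>b k. wt b (br x y) = wt c (br x y) + of_int k * \<alpha> (br x y)"] by blast
  ultimately have "of_nat (card T) * wt c (br x y) + of_int (\<Sum>b\<in>T. k b) * \<alpha> (br x y) = 0"
    by (simp add: sum.distrib sum_distrib_right)
  moreover have "c \<in> T" unfolding T_def using c by (auto intro: exI[of _ 0])
  then have "card T \<noteq> 0" using T(2) by auto
  ultimately have "wt c (br x y) = of_real (- of_int (\<Sum>b\<in>T. k b) / of_nat (card T)) * \<alpha> (br x y)"
    by (simp add: field_simps eq_neg_iff_add_eq_0)
  then show ?thesis by blast
qed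

lemma nonabelian: "\<exists>x\<in>L. \<exists>y\<in>L. br x y \<noteq> 0"
  and ideal_trivial: "adj.G.subspace J \<Longrightarrow> J \<subseteq> L \<Longrightarrow> (\<And>x y. x \<in> L \<Longrightarrow> y \<in> J \<Longrightarrow> br x y \<in> J) \<Longrightarrow>
    J = {0} \<or> J = L"
  using simple unfolding simple_lie_algebra_def lie_ideal_def by blast+

text \<open>
  Such an \<open>h\<close> is central, and the center of a simple Lie algebra is zero.
\<close>

lemma wt_zero_imp_zero:
  assumes h: "h \<in> t" and zero: "\<And>b. b \<in> B \<Longrightarrow> wt b h = 0"
  shows "h = 0"
proof -
  let ?Z = "{z \<in> L. \<forall>x\<in>L. br x z = 0}"
  have "adj.G.subspace ?Z"
    using adj.L_subspace adj.act_0 adj.act_add adj.act_scale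
    by (intro adj.G.subspaceI) (auto simp: adj.G.subspace_0 adj.G.subspace_add adj.G.subspace_scale)
  moreover have "br x z \<in> ?Z" if "x \<in> L" "z \<in> ?Z" for x z
    using that adj.act_0 adj.G.subspace_0[OF adj.L_subspace] by simp
  ultimately have "?Z = {0} \<or> ?Z = L" by (intro ideal_trivial) auto
  moreover have "?Z \<noteq> L" using nonabelian by blast
  moreover have "br x h = 0" if "x \<in> L" for x
  proof -
    have "br h x \<in> {0}"
    proof (rule adj.act_span[OF t_in_L[OF h] B_subset adj.G.subspace_single_0])
      show "x \<in> adj.G.span B" using that span_B by simp
      show "br h b \<in> {0}" if "b \<in> B" for b using wt[OF that h] zero[OF that] by simp
    qed
    then show ?thesis using br_skew[OF t_in_L[OF h] that] by simp
  qed
  ultimately show ?thesis using t_in_L[OF h] by blast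
qed

lemma bracket_zero:
  assumes "has_weight \<alpha> x" "has_weight (\<lambda>h. - \<alpha> h) y" "\<alpha> (br x y) = 0"
  shows "br x y = 0"
proof (rule wt_zero_imp_zero)
  show "br x y \<in> t" by (rule weight_zero_in_t[OF has_weight_br[OF assms(1,2)]]) simp
  show "wt b (br x y) = 0" if "b \<in> B" for b using string_trace[OF assms(1,2) that] assms(3) by auto
qed

definition killing :: "'g \<Rightarrow> 'g \<Rightarrow> complex" where
  "killing x y = (\<Sum>b\<in>B. rep (br x (br y b)) b)"

lemma rep_linear: "linear_map_on sg (*) L (\<lambda>z. rep z b)"
  unfolding linear_map_on_def
  using adj.G.representation_add[OF indep_B] adj.G.representation_scale[OF indep_B] span_B by simp

lemma killing_add_left:
  assumes "x \<in> L" "x' \<in> L" "y \<in> L"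
  shows "killing (x + x') y = killing x y + killing x' y"
  unfolding killing_def sum.distrib[symmetric]
proof (rule sum.cong)
  fix b assume "b \<in> B"
  then have "br y b \<in> L" using adj.act_closed assms(3) B_subset by blast
  then show "rep (br (x + x') (br y b)) b = rep (br x (br y b)) b + rep (br x' (br y b)) b"
    using adj.act_add_left[OF assms(1,2)] rep_linear adj.act_closed assms(1,2)
    unfolding linear_map_on_def by simp
qed simp

lemma killing_scale_left:
  assumes "x \<in> L" "y \<in> L"
  shows "killing (sg a x) y = a * killing x y"
  unfolding killing_def sum_distrib_left
proof (rule sum.cong)
  fix b assume "b \<in> B"
  then have "br y b \<in> L" using adj.act_closed assms(2) B_subset by blast
  then show "rep (br (sg a x) (br y b)) b = a * rep (br x (br y b)) b"
    using adj.act_scale_left[OF assms(1)] rep_linear adj.act_closed assms(1)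
    unfolding linear_map_on_def by simp
qed simp

lemma br_br_linear:
  assumes "x \<in> L" "y \<in> L"
  shows "linear_map_on sg sg L (\<lambda>w. br x (br y w))"
  unfolding linear_map_on_def
  using adj.act_add adj.act_scale adj.act_closed assms by simp

lemma killing_commute:
  assumes "x \<in> L" "y \<in> L"
  shows "killing x y = killing y x"
  unfolding killing_def
  by (rule trace_commute[OF adj.G.vector_space_axioms finite_B indep_B])
    (use assms adj.act_linear adj.act_closed B_subset span_B in auto)

text \<open>
  Expanding \<open>[z, x]\<close> and \<open>[z, y]\<close> as operators, this is \<open>tr (z \<circ> x y) = tr (x y \<circ> z)\<close>.
\<close>

lemma killing_invariant:
  assumes z: "z \<in> L" and x: "x \<in> L" and y: "y \<in> L"
  shows "killing (br z x) y = - killing x (br z y)"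
proof -
  have tr: "(\<Sum>b\<in>B. rep (br z (br x (br y b))) b) = (\<Sum>b\<in>B. rep (br x (br y (br z b))) b)"
    by (rule trace_commute[OF adj.G.vector_space_axioms finite_B indep_B, of "br z" "\<lambda>w. br x (br y w)"])
      (use z x y adj.act_linear br_br_linear adj.act_closed B_subset span_B in auto)
  have diff: "rep (a - a') b = rep a b - rep a' b" if "a \<in> L" "a' \<in> L" for a a' b
    using adj.G.representation_diff[OF indep_B, of a' a] that span_B by simp
  have "killing (br z x) y = (\<Sum>b\<in>B. rep (br z (br x (br y b))) b - rep (br x (br z (br y b))) b)"
    unfolding killing_def
  proof (rule sum.cong)
    fix b assume "b \<in> B"
    then have w: "br y b \<in> L" using adj.act_closed y B_subset by blast
    have "br (br z x) (br y b) = br z (br x (br y b)) - br x (br z (br y b))"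
      using adj.act_commute[OF z x w] by simp
    then show "rep (br (br z x) (br y b)) b = rep (br z (br x (br y b))) b - rep (br x (br z (br y b))) b"
      using diff adj.act_closed z x w by simp
  qed simp
  moreover have "killing x (br z y) = (\<Sum>b\<in>B. rep (br x (br z (br y b))) b - rep (br x (br y (br z b))) b)"
    unfolding killing_def
  proof (rule sum.cong)
    fix b assume "b \<in> B"
    then have b: "b \<in> L" using B_subset by blast
    have "br (br z y) b = br z (br y b) - br y (br z b)" using adj.act_commute[OF z y b] by simp
    then have "br x (br (br z y) b) = br x (br z (br y b)) - br x (br y (br z b))"
      using adj.act_diff[OF x] adj.act_closed z y b by simp
    then show "rep (br x (br (br z y) b)) b = rep (br x (br z (br y b))) b - rep (br x (br y (br z b))) b"
      using diff adj.act_closed z x y b by simp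
  qed simp
  ultimately show ?thesis using tr by (simp add: sum_subtractf)
qed

lemma killing_t:
  assumes "h \<in> t"
  shows "killing h h = (\<Sum>b\<in>B. (wt b h)\<^sup>2)"
  unfolding killing_def
proof (rule sum.cong)
  fix b assume b: "b \<in> B"
  then have "b \<in> L" using B_subset by blast
  then have "br h (br h b) = sg ((wt b h)\<^sup>2) b"
    using wt[OF b assms] adj.act_scale[OF t_in_L[OF assms]] by (simp add: power2_eq_square)
  then show "rep (br h (br h b)) b = (wt b h)\<^sup>2"
    using adj.G.representation_scale[OF indep_B adj.G.span_base[OF b]]
      adj.G.representation_basis[OF indep_B b] by simp
qed simp

text \<open>
  If the Killing form vanished, then \<open>[L\<^sub>\<alpha>, L\<^sub>-\<^sub>\<alpha>] = 0\<close> for all \<open>\<alpha>\<close>: all weights are real multiples of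
  \<open>\<alpha>\<close> on \<open>h = [x, y]\<close>, so \<open>killing h h\<close> is \<open>\<alpha>(h)\<^sup>2\<close> times a sum of real squares. But then the
  root spaces would span a proper ideal.
\<close>

lemma killing_nonzero: "\<exists>x\<in>L. \<exists>y\<in>L. killing x y \<noteq> 0"
proof (rule ccontr)
  assume "\<not> ?thesis"
  then have K0: "killing x y = 0" if "x \<in> L" "y \<in> L" for x y using that by blast
  have orth: "br x y = 0" if xy: "has_weight \<alpha> x" "has_weight (\<lambda>h. - \<alpha> h) y" for \<alpha> x y
  proof (rule wt_zero_imp_zero)
    let ?h = "br x y"
    show ht: "?h \<in> t" by (rule weight_zero_in_t[OF has_weight_br[OF xy]]) simp
    have "\<forall>b\<in>B. \<exists>q::real. wt b ?h = of_real q * \<alpha> ?h" using string_trace[OF xy] by blast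
    then obtain q :: "'g \<Rightarrow> real" where q: "\<And>b. b \<in> B \<Longrightarrow> wt b ?h = of_real (q b) * \<alpha> ?h"
      using bchoice[of B "\<lambda>b q. wt b ?h = of_real q * \<alpha> ?h"] by blast
    have "0 = (\<Sum>b\<in>B. (wt b ?h)\<^sup>2)" using killing_t[OF ht] K0 t_in_L[OF ht] by simp
    also have "\<dots> = (\<Sum>b\<in>B. of_real ((q b)\<^sup>2) * (\<alpha> ?h)\<^sup>2)"
      using q by (intro sum.cong) (auto simp: power_mult_distrib)
    also have "\<dots> = of_real (\<Sum>b\<in>B. (q b)\<^sup>2) * (\<alpha> ?h)\<^sup>2" by (simp add: sum_distrib_right)
    finally have "of_real (\<Sum>b\<in>B. (q b)\<^sup>2) * (\<alpha> ?h)\<^sup>2 = 0" by (rule sym)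
    then have "(\<Sum>b\<in>B. (q b)\<^sup>2) = 0 \<or> \<alpha> ?h = 0"
      by (simp only: mult_eq_0_iff of_real_eq_0_iff power_eq_0_iff) blast
    then have "(\<forall>b\<in>B. q b = 0) \<or> \<alpha> ?h = 0" using finite_B by (simp add: sum_nonneg_eq_0_iff)
    then show "wt b ?h = 0" if "b \<in> B" for b using q[OF that] that by auto
  qed
  let ?R = "{b \<in> B. \<exists>h\<in>t. wt b h \<noteq> 0}"
  let ?J = "adj.G.span ?R"
  have RL: "?R \<subseteq> L" using B_subset by blast
  have JL: "?J \<subseteq> L" by (rule adj.G.span_minimal[OF RL adj.L_subspace])
  have BR: "br c b \<in> ?J" if c: "c \<in> B" and b: "b \<in> ?R" for c b
  proof (cases "\<forall>h\<in>t. wt c h = - wt b h")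
    case True
    have "has_weight (\<lambda>h. - wt b h) c" 
      by (rule has_weight_cong[OF has_weight_B[OF c]]) (use True in blast)
    then have "br b c = 0" using orth[OF has_weight_B] b by blast
    moreover have "br c b = - br b c" using br_skew b c B_subset by blast
    ultimately show ?thesis by (simp add: adj.G.span_zero)
  next
    case False
    have bB: "b \<in> B" using b by blast
    obtain h where h: "h \<in> t" "wt c h \<noteq> - wt b h" using False by blast
    then have h': "wt b h + wt c h \<noteq> 0" by (simp add: add_eq_0_iff)
    have "{b' \<in> B. \<forall>h\<in>t. wt b' h = wt b h + wt c h} \<subseteq> ?R"
    proof
      fix b' assume "b' \<in> {b' \<in> B. \<forall>h\<in>t. wt b' h = wt b h + wt c h}"
      then have "b' \<in> B" "wt b' h \<noteq> 0" using h h' by auto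
      then show "b' \<in> ?R" using h(1) by blast
    qed
    then show ?thesis
      using weight_span[OF has_weight_br[OF has_weight_B[OF c] has_weight_B[OF bB]]]
        adj.G.span_mono by blast
  qed
  have stable: "br x y \<in> ?J" if x: "x \<in> L" and y: "y \<in> ?J" for x y
  proof (rule adj.act_span[OF x RL adj.G.subspace_span _ y])
    fix b assume b: "b \<in> ?R"
    show "br x b \<in> ?J"
    proof (rule adj.act_span_left[OF _ B_subset adj.G.subspace_span])
      show "b \<in> L" using b RL by blast
      show "x \<in> adj.G.span B" using x span_B by simp
    qed (rule BR[OF _ b])
  qed
  have "?J = {0} \<or> ?J = L" by (rule ideal_trivial[OF adj.G.subspace_span JL stable])
  moreover have "?J \<noteq> {0}"
  proof
    assume J0: "?J = {0}"
    have "0 \<notin> B" using indep_B adj.G.dependent_zero by blast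
    have none: "b \<notin> ?R" for b
    proof
      assume b: "b \<in> ?R"
      then have "b \<in> ?J" by (rule adj.G.span_base)
      then show False using b J0 \<open>0 \<notin> B\<close> by simp
    qed
    have "B \<subseteq> t"
    proof
      fix b assume b: "b \<in> B"
      then show "b \<in> t" by (rule wt_zero) (use b none in blast)
    qed
    then have "L \<subseteq> t" using span_B adj.G.span_minimal[OF _ t_subspace] by blast
    then show False using nonabelian t_abelian by blast
  qed
  moreover have "?J \<noteq> L"
  proof
    assume JL: "?J = L"
    have "h = 0" if h: "h \<in> t" for h
    proof -
      have hL: "h \<in> L" using t_in_L[OF h] .
      have "has_weight (\<lambda>_. 0) h" unfolding has_weight_def using hL t_abelian h by simp
      then have nz: "wt b k = 0" if "b \<in> B" "rep h b \<noteq> 0" "k \<in> t" for b k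
        using rep_weight that by blast
      have "rep h b = 0" if "b \<in> B" for b
      proof (cases "b \<in> ?R")
        case True
        then show ?thesis using nz by blast
      next
        case False
        have "rep h = adj.G.representation ?R h"
          by (rule adj.G.representation_extend[OF indep_B]) (use hL JL in auto)
        moreover have "adj.G.representation ?R h b = 0"
          using False adj.G.representation_ne_zero[of ?R h b] by blast
        ultimately show ?thesis by simp
      qed
      then have "(\<Sum>b\<in>B. sg (rep h b) b) = 0" by (intro sum.neutral) simp
      then show "h = 0" using expand[OF hL] by (rule trans[rotated])
    qed
    then have t0: "t \<subseteq> {0}" by blast
    have R: "?R = {}"
    proof (rule ccontr)
      assume "?R \<noteq> {}"
      then obtain b where b: "b \<in> B" "wt b 0 \<noteq> 0" "0 \<in> t" using t0 by auto
      have bL: "b \<in> L" using b(1) B_subset by blast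
      have "br 0 b = 0" using linear_map_on_0[OF adj.G.vector_space_axioms adj.G.vector_space_axioms
            adj.L_subspace adj.act_linear_left[OF bL]] .
      then have "b = 0" using wt[OF b(1,3)] b(2) by simp
      then show False using b(1) indep_B adj.G.dependent_zero by blast
    qed
    have "L = {0}" using JL[unfolded R] by simp
    moreover have "br 0 0 = 0" using t_abelian adj.G.subspace_0[OF t_subspace] by blast
    ultimately show False using nonabelian by simp
  qed
  ultimately show False by blast
qed

text \<open>
  The radical of the form is an ideal, and it is proper.
\<close>

lemma killing_nondegenerate:
  assumes "x \<in> L" "x \<noteq> 0"
  shows "\<exists>y\<in>L. killing x y \<noteq> 0"
proof -
  let ?R = "{x \<in> L. \<forall>y\<in>L. killing x y = 0}"
  have zero: "killing 0 y = 0" if "y \<in> L" for y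
    using killing_scale_left[OF assms(1) that, of 0] by simp
  have "adj.G.subspace ?R"
    using adj.L_subspace killing_add_left killing_scale_left zero
    by (intro adj.G.subspaceI) (auto simp: adj.G.subspace_0 adj.G.subspace_add adj.G.subspace_scale)
  moreover have "br z x \<in> ?R" if "z \<in> L" "x \<in> ?R" for z x
    using that killing_invariant adj.br_closed by simp
  ultimately have "?R = {0} \<or> ?R = L" by (intro ideal_trivial) auto
  then show ?thesis using killing_nonzero assms by blast
qed

text \<open>
  The form pairs the weight \<open>\<gamma>\<close> only with \<open>- \<gamma>\<close>, because an operator that shifts weights has no diagonal
  entries. If \<open>b\<close> is paired with \<open>x\<close>, then \<open>killing k [x, b] = \<gamma>(k) killing x b\<close> shows \<open>[x, b] \<noteq> 0\<close>.
\<close>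

lemma opposite_vector:
  assumes x: "has_weight \<gamma> x" "x \<noteq> 0" and k: "k \<in> t" "\<gamma> k \<noteq> 0"
  obtains y where "has_weight (\<lambda>h. - \<gamma> h) y" "\<gamma> (br x y) \<noteq> 0"
proof -
  have xL: "x \<in> L" using x(1) unfolding has_weight_def by blast
  obtain y where y: "y \<in> L" "killing x y \<noteq> 0" using killing_nondegenerate[OF xL x(2)] by blast
  have "\<exists>b\<in>B. killing x b \<noteq> 0"
  proof (rule ccontr)
    assume neg: "\<not> ?thesis"
    have lin: "linear_map_on sg (*) L (\<lambda>y. killing y x)"
      unfolding linear_map_on_def by (simp add: killing_add_left killing_scale_left xL)
    have "killing (\<Sum>b\<in>B. sg (rep y b) b) x = (\<Sum>b\<in>B. killing (sg (rep y b) b) x)"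
    proof (rule linear_map_on_sum[OF adj.G.vector_space_axioms _ adj.L_subspace lin])
      show "vector_space ((*) :: complex \<Rightarrow> complex \<Rightarrow> complex)"
        by unfold_locales (auto simp: algebra_simps)
      show "sg (rep y b) b \<in> L" if "b \<in> B" for b
        using that B_subset adj.G.subspace_scale[OF adj.L_subspace] by blast
    qed
    also have "\<dots> = 0"
    proof (rule sum.neutral, rule ballI)
      fix b assume b: "b \<in> B"
      then have bL: "b \<in> L" using B_subset by blast
      have "killing b x = 0" using neg killing_commute[OF xL bL] b by auto
      then show "killing (sg (rep y b) b) x = 0" using killing_scale_left[OF bL xL] by simp
    qed
    finally have "killing y x = 0" by (simp only: expand[OF y(1), symmetric])
    then show False using y killing_commute[OF xL y(1)] by simp
  qed
  then obtain b where b: "b \<in> B" "killing x b \<noteq> 0" by blast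
  have bL: "b \<in> L" using b(1) B_subset by blast
  obtain c where c: "c \<in> B" "rep (br x (br b c)) c \<noteq> 0"
    using b(2) unfolding killing_def by (rule sum.not_neutral_contains_not_neutral)
  have eq: "wt c h = wt c h + wt b h + \<gamma> h" if "h \<in> t" for h
    by (rule rep_weight[OF has_weight_br[OF x(1) has_weight_br[OF has_weight_B[OF b(1)]
              has_weight_B[OF c(1)]]] c that])
  have wb': "wt b h = - \<gamma> h" if "h \<in> t" for h using eq[OF that] by algebra
  have wb: "has_weight (\<lambda>h. - \<gamma> h) b" by (rule has_weight_cong[OF has_weight_B[OF b(1)] wb'])
  have kL: "k \<in> L" using t_in_L[OF k(1)] .
  have "br x k = sg (- \<gamma> k) x"
    using br_skew[OF kL xL] x(1) k(1) unfolding has_weight_def by simp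
  then have "- \<gamma> k * killing x b = killing (br x k) b"
    by (simp only: killing_scale_left[OF xL bL])
  also have "\<dots> = - killing k (br x b)" by (rule killing_invariant[OF xL kL bL])
  finally have "- \<gamma> k * killing x b = - killing k (br x b)" .
  then have "killing k (br x b) \<noteq> 0" using k(2) b(2) by auto
  moreover have "killing k 0 = 0"
    using killing_commute[OF kL, of 0] killing_scale_left[OF kL kL, of 0] adj.G.subspace_0[OF adj.L_subspace]
    by simp
  ultimately have "br x b \<noteq> 0" by auto
  then have "\<gamma> (br x b) \<noteq> 0" using bracket_zero[OF x(1) wb] by blast
  then show ?thesis using that wb by blast
qed

text \<open>
  Given \<open>x\<close> and an opposite vector \<open>y\<close>, any vector of the same weight as \<open>x\<close> can be corrected by a
  multiple of \<open>x\<close> to commute with \<open>y\<close>. Such a vector is zero: as a lowest weight vector of positive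
  weight for the triple of \<open>x\<close> and \<open>y\<close>, it would generate an infinite string.
\<close>

lemma root_space_one_dimensional:
  assumes x: "has_weight \<gamma> x" "x \<noteq> 0" and z: "has_weight \<gamma> z" and k: "k \<in> t" "\<gamma> k \<noteq> 0"
    and \<gamma>: "linear_map_on sg (*) t \<gamma>"
  shows "\<exists>c. z = sg c x"
proof -
  obtain y where y: "has_weight (\<lambda>h. - \<gamma> h) y" "\<gamma> (br x y) \<noteq> 0" using opposite_vector[OF x k] .
  have L: "x \<in> L" "y \<in> L" "z \<in> L" using x y z unfolding has_weight_def by blast+
  have ht: "br x y \<in> t" "br z y \<in> t"
    by (rule weight_zero_in_t[OF has_weight_br[OF x(1) y(1)]] weight_zero_in_t[OF has_weight_br[OF z y(1)]];
        simp)+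
  define c where "c = \<gamma> (br z y) / \<gamma> (br x y)"
  define w where "w = z - sg c x"
  have cx: "sg c x \<in> L" using L(1) adj.G.subspace_scale[OF adj.L_subspace] by blast
  have w: "has_weight \<gamma> w"
    unfolding has_weight_def
  proof
    show "w \<in> L" unfolding w_def using L(3) cx adj.G.subspace_diff[OF adj.L_subspace] by blast
    show "\<forall>h\<in>t. br h w = sg (\<gamma> h) w"
      using x z cx L adj.act_diff adj.act_scale t_in_L unfolding w_def has_weight_def
      by (simp add: adj.G.scale_right_diff_distrib mult.commute)
  qed
  have wL: "w \<in> L" using w unfolding has_weight_def by blast
  have "br w y = br z y - sg c (br x y)"
    using linear_map_on_diff[OF adj.G.vector_space_axioms adj.G.vector_space_axioms adj.L_subspace
        adj.act_linear_left[OF L(2)] L(3) cx] adj.act_scale_left[OF L(1,2)] unfolding w_def by simp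
  moreover have "sg c (br x y) \<in> t" using ht adj.G.subspace_scale[OF t_subspace] by blast
  moreover have "vector_space ((*) :: complex \<Rightarrow> complex \<Rightarrow> complex)"
    by unfold_locales (auto simp: algebra_simps)
  ultimately have "\<gamma> (br w y) = \<gamma> (br z y) - c * \<gamma> (br x y)"
    using linear_map_on_diff[OF adj.G.vector_space_axioms _ t_subspace \<gamma> ht(2)] \<gamma> ht(1)
    unfolding linear_map_on_def by simp
  then have "\<gamma> (br w y) = 0" unfolding c_def using y(2) by simp
  then have "br w y = 0" using bracket_zero[OF w y(1)] by blast
  then have yw: "br y w = 0" using br_skew[OF wL L(2)] by simp
  have "w = 0"
  proof (rule ccontr)
    assume w0: "w \<noteq> 0"
    define s where "s n = (br x ^^ n) w" for n
    have s_weight: "has_weight (\<lambda>h. of_nat (Suc n) * \<gamma> h) (s n)" for n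
    proof (induction n)
      case 0
      have "has_weight (\<lambda>h. of_nat (Suc 0) * \<gamma> h) w" by (rule has_weight_cong[OF w]) simp
      then show ?case unfolding s_def by (simp only: funpow_0)
    next
      case (Suc n)
      have "has_weight (\<lambda>h. of_nat (Suc (Suc n)) * \<gamma> h) (br x (s n))"
        by (rule has_weight_cong[OF has_weight_br[OF x(1) Suc]]) (simp add: algebra_simps)
      then show ?case unfolding s_def by simp
    qed
    have sL: "s n \<in> L" for n using s_weight[of n] unfolding has_weight_def by simp
    have s_Suc: "s (Suc n) = br x (s n)" for n unfolding s_def by simp
    have hs: "br (br y x) (s n) = sg (- (of_nat (Suc n) * \<gamma> (br x y))) (s n)" for n
    proof -
      have hL: "br x y \<in> L" using ht t_in_L by blast
      have "br y x = sg (-1) (br x y)" using br_skew[OF L(1,2)] by simp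
      then have "br (br y x) (s n) = sg (-1) (br (br x y) (s n))"
        by (simp only: adj.act_scale_left[OF hL sL])
      then show ?thesis using s_weight[of n] ht(1) unfolding has_weight_def by simp
    qed
    have lower: "\<exists>a::nat. a > 0 \<and> br y (s (Suc n)) = sg (- (of_nat a * \<gamma> (br x y))) (s n)" for n
    proof (induction n)
      case 0
      have "br y (br x w) = sg (- \<gamma> (br x y)) w"
        using adj.act_commute[OF L(2,1) wL] yw adj.act_0[OF L(1)] hs[of 0] unfolding s_def by simp
      then show ?case unfolding s_def by (intro exI[of _ 1]) simp
    next
      case (Suc n)
      then obtain a :: nat where a: "a > 0" "br y (s (Suc n)) = sg (- (of_nat a * \<gamma> (br x y))) (s n)" by blast
      have "br y (s (Suc (Suc n))) = br x (br y (s (Suc n))) + br (br y x) (s (Suc n))"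
        using adj.act_commute[OF L(2,1) sL] unfolding s_Suc[of "Suc n"] .
      also have "\<dots> = sg (- (of_nat a * \<gamma> (br x y))) (s (Suc n))
          + sg (- (of_nat (Suc (Suc n)) * \<gamma> (br x y))) (s (Suc n))"
        unfolding a(2) hs by (simp only: adj.act_scale[OF L(1) sL] s_Suc[of n])
      also have "\<dots> = sg (- (of_nat (a + Suc (Suc n)) * \<gamma> (br x y))) (s (Suc n))"
        unfolding adj.G.scale_left_distrib[symmetric] by (simp add: algebra_simps)
      finally show ?case by (intro exI[of _ "a + Suc (Suc n)"]) simp
    qed
    have s_nonzero: "s n \<noteq> 0" for n
    proof (induction n)
      case 0
      then show ?case unfolding s_def using w0 by simp
    next
      case (Suc n)
      obtain a :: nat where "a > 0" "br y (s (Suc n)) = sg (- (of_nat a * \<gamma> (br x y))) (s n)"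
        using lower by blast
      then have "br y (s (Suc n)) \<noteq> 0" using Suc y(2) by simp
      then show ?case using adj.act_0[OF L(2)] by auto
    qed
    have "\<exists>b\<in>B. wt b k = of_nat (Suc n) * \<gamma> k" for n
    proof (rule ccontr)
      assume "\<not> ?thesis"
      then have none: "{b \<in> B. \<forall>h\<in>t. wt b h = of_nat (Suc n) * \<gamma> h} = {}" using k(1) by blast
      have "s n \<in> adj.G.span {}" using weight_span[OF s_weight[of n]] unfolding none .
      then show False using s_nonzero[of n] by simp
    qed
    then have "\<forall>n. \<exists>b. b \<in> B \<and> wt b k = of_nat (Suc n) * \<gamma> k" by blast
    then obtain b where b: "\<And>n. b n \<in> B" "\<And>n. wt (b n) k = of_nat (Suc n) * \<gamma> k"
      using choice[of "\<lambda>n b. b \<in> B \<and> wt b k = of_nat (Suc n) * \<gamma> k"] by blast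
    have "inj b"
    proof (rule injI)
      fix n m assume "b n = b m"
      then have "wt (b n) k = wt (b m) k" by simp
      then have "(of_nat (Suc n) :: complex) * \<gamma> k = of_nat (Suc m) * \<gamma> k" by (simp only: b(2))
      then have "Suc n = Suc m" by (simp only: mult_right_cancel[OF k(2)] of_nat_eq_iff)
      then show "n = m" by simp
    qed
    moreover have "finite (range b)" by (rule finite_subset[OF _ finite_B]) (use b(1) in blast)
    ultimately have "finite (UNIV :: nat set)" by (rule finite_imageD[rotated])
    then show False by simp
  qed
  then show ?thesis unfolding w_def by (auto intro: exI[of _ c])
qed

end

text \<open>
  Root vectors together with \<open>t\<close> span \<open>L\<close>, so a basis can be selected among them.
\<close>

lemma (in triangular) weight_basis_exists:
  assumes simple: "simple_lie_algebra sg br L"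
  shows "\<exists>B wt. weight_basis sg br L P um t u B wt"
proof -
  define U where "U = (\<Union>\<alpha>\<in>P. root_space sg br L t \<alpha>)"
  define X where "X = t \<union> U \<union> neg_root_vectors"
  obtain B where B: "B \<subseteq> X" "adj.G.independent B" "X \<subseteq> adj.G.span B"
    using adj.G.maximal_independent_subset .
  have XL: "X \<subseteq> L" unfolding X_def U_def using t_subset neg_root_vectors_subset
    by (auto simp: root_space_def)
  have "L \<subseteq> adj.G.span B"
  proof
    fix x assume "x \<in> L"
    then obtain a h b where abc: "a \<in> um" "h \<in> t" "b \<in> u" "x = a + h + b"
      by (rule decompose)
    have "u = adj.G.span U" unfolding U_def using tri unfolding triangular_decomposition_def by blast
    moreover have parts: "t \<subseteq> adj.G.span B" "U \<subseteq> adj.G.span B" "neg_root_vectors \<subseteq> adj.G.span B"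
      using B(3) unfolding X_def by blast+
    ultimately have "u \<subseteq> adj.G.span B" "um \<subseteq> adj.G.span B"
      unfolding um_span by (simp_all add: adj.G.span_minimal)
    then have "a \<in> adj.G.span B" "h \<in> adj.G.span B" "b \<in> adj.G.span B"
      using abc(1-3) parts(1) by blast+
    then show "x \<in> adj.G.span B" unfolding abc(4) by (intro adj.G.span_add)
  qed
  moreover have "adj.G.span B \<subseteq> L"
    using adj.G.span_minimal[OF _ adj.L_subspace, of B] B(1) XL by (meson order_trans)
  ultimately have span: "adj.G.span B = L" by (rule subset_antisym[rotated])
  obtain F where F: "finite F" "L \<subseteq> adj.G.span F"
    using simple unfolding simple_lie_algebra_def finite_dim_on_def by blast
  have "B \<subseteq> adj.G.span F" using F(2) B(1) XL by (meson order_trans)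
  then have fin: "finite B" using adj.G.independent_span_bound[OF F(1) B(2)] by simp
  define Q where "Q b \<nu> \<longleftrightarrow> (\<forall>h\<in>t. br h b = sg (\<nu> h) b) \<and> ((\<forall>h\<in>t. \<nu> h = 0) \<longrightarrow> b \<in> t) \<and>
    (\<forall>h. height_element h \<longrightarrow> (\<forall>n. \<nu> h = - of_nat (Suc n) \<longrightarrow> b \<in> um))" for b \<nu>
  have "\<exists>\<nu>. Q b \<nu>" if b: "b \<in> B" for b
  proof -
    consider "b \<in> t" | \<alpha> where "\<alpha> \<in> P" "b \<in> root_space sg br L t \<alpha>" | "b \<in> neg_root_vectors"
      using b B(1) unfolding X_def U_def by blast
    then show ?thesis
    proof cases
      case 1
      have "(0::complex) \<noteq> - of_nat (Suc n)" for n
        by (simp only: neg_equal_0_iff_equal of_nat_eq_0_iff eq_commute[of "0::complex"])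
      then have "Q b (\<lambda>_. 0)" using t_abelian 1 unfolding Q_def by simp
      then show ?thesis by blast
    next
      case 2
      have "\<alpha> h \<noteq> - of_nat (Suc n)" if he: "height_element h" for h n
      proof
        assume "\<alpha> h = - of_nat (Suc n)"
        moreover obtain m :: nat where "\<alpha> h = of_nat m"
          using he 2(1) unfolding height_element_def by blast
        ultimately have "(of_nat (m + Suc n) :: complex) = 0" by simp
        then show False by (simp only: of_nat_eq_0_iff)
      qed
      moreover have "\<forall>h\<in>t. br h b = sg (\<alpha> h) b" using 2(2) unfolding root_space_def by blast
      ultimately have "Q b \<alpha>" using positive_root(2)[OF 2(1)] unfolding Q_def by meson
      then show ?thesis by blast
    next
      case 3
      then obtain \<alpha> where \<alpha>: "\<alpha> \<in> P" "\<forall>h\<in>t. br h b = sg (- \<alpha> h) b"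
        using neg_root_vector_weight by blast
      have "b \<in> um" unfolding um_span using 3 by (rule adj.G.span_base)
      moreover obtain h where "h \<in> t" "- \<alpha> h \<noteq> 0" using positive_root(2)[OF \<alpha>(1)] by auto
      ultimately have "Q b (\<lambda>h. - \<alpha> h)" using \<alpha>(2) unfolding Q_def by meson
      then show ?thesis by blast
    qed
  qed
  then have "\<forall>b\<in>B. \<exists>\<nu>. Q b \<nu>" by blast
  from bchoice[OF this] obtain wt where wt: "\<forall>b\<in>B. Q b (wt b)" ..
  have "weight_basis sg br L P um t u B wt"
  proof
    fix b h assume b: "b \<in> B"
    then have Q: "Q b (wt b)" using wt by blast
    show "br h b = sg (wt b h) b" if "h \<in> t" using Q that unfolding Q_def by simp
    show "b \<in> t" if "\<And>h. h \<in> t \<Longrightarrow> wt b h = 0" using Q that unfolding Q_def by simp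
    show "b \<in> um" if "height_element h" "wt b h = - of_nat (Suc n)" for n
      using Q that unfolding Q_def by blast
  qed (rule simple fin B(2) span)+
  then show ?thesis by blast
qed

text \<open>
  The input for straightening. The bracket of two negative root vectors has negative height, and
  vectors of negative height lie in \<open>um\<close>.
\<close>

lemma (in triangular) negative_root_vectors:
  assumes simple: "simple_lie_algebra sg br L" and \<alpha>: "\<alpha> ` I = P"
    and f: "\<And>i. i \<in> I \<Longrightarrow> f i \<in> root_space sg br L t (neg_weight t (\<alpha> i)) \<and> f i \<noteq> 0"
  shows "um = adj.G.span (f ` I)" "\<And>i j. i \<in> I \<Longrightarrow> j \<in> I \<Longrightarrow> br (f i) (f j) \<in> um"
proof -
  obtain B wt where "weight_basis sg br L P um t u B wt" using weight_basis_exists[OF simple] by blast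
  then interpret weight_basis sg br L P um t u B wt .
  have weight: "has_weight (\<lambda>h. - \<alpha> i h) z" if "z \<in> root_space sg br L t (neg_weight t (\<alpha> i))" for i z
    using that unfolding has_weight_def root_space_def neg_weight_def by simp
  have "f ` I \<subseteq> neg_root_vectors" unfolding neg_root_vectors_def using f \<alpha> by blast
  moreover have "neg_root_vectors \<subseteq> adj.G.span (f ` I)"
  proof
    fix y assume "y \<in> neg_root_vectors"
    then obtain i where i: "i \<in> I" "y \<in> root_space sg br L t (neg_weight t (\<alpha> i))"
      unfolding neg_root_vectors_def using \<alpha> by blast
    have P: "\<alpha> i \<in> P" using i(1) \<alpha> by blast
    obtain k where k: "k \<in> t" "- \<alpha> i k \<noteq> 0" using positive_root(2)[OF P] by auto
    have "linear_map_on sg (*) t (\<lambda>h. - \<alpha> i h)"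
      using positive_root(1)[OF P] unfolding linear_map_on_def by simp
    then obtain c where "y = sg c (f i)"
      using root_space_one_dimensional[OF weight _ weight[OF i(2)] k] f[OF i(1)] by blast
    then show "y \<in> adj.G.span (f ` I)" using i(1) by (auto intro: adj.G.span_scale adj.G.span_base)
  qed
  ultimately show "um = adj.G.span (f ` I)"
    unfolding um_span by (metis adj.G.span_minimal adj.G.span_mono adj.G.subspace_span subset_antisym)
  fix i j assume ij: "i \<in> I" "j \<in> I"
  obtain h where h: "height_element h" using height_element_exists ..
  then obtain m n where "m > 0" "\<alpha> i h = of_nat m" "\<alpha> j h = of_nat n"
    unfolding height_element_def using ij \<alpha> by blast
  moreover from this obtain l where "m = Suc l" using gr0_implies_Suc by blast
  ultimately have "- \<alpha> j h + - \<alpha> i h = - of_nat (Suc (n + l))" by simp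
  then show "br (f i) (f j) \<in> um"
    using weight_negative_in_um[OF has_weight_br[OF weight weight] h] f ij by blast
qed

section \<open>Invariants of the unipotent group\<close>

lemma (in lie_module) exp_operator_eq:
  assumes x: "x \<in> L" and w: "w \<in> V" and nil: "\<And>w. w \<in> V \<Longrightarrow> (\<rho> x ^^ d) w = 0" and n: "d \<le> n"
  shows "exp_operator sv (\<rho> x) w = (\<Sum>k<n. sv (1 / fact k) ((\<rho> x ^^ k) w))"
proof -
  have pow: "(\<rho> x ^^ k) w \<in> V" for k by (induction k) (auto simp: w act_closed[OF x])
  have "(\<rho> x ^^ k) w = 0" if "d \<le> k" for k
  proof -
    have "(\<rho> x ^^ k) w = (\<rho> x ^^ d) ((\<rho> x ^^ (k - d)) w)"
      using that funpow_add[of d "k - d" "\<rho> x"] by simp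
    then show ?thesis using nil[OF pow] by simp
  qed
  then have "{k. sv (1 / fact k) ((\<rho> x ^^ k) w) \<noteq> 0} \<subseteq> {..<n}" using n
    by (auto simp: not_less[symmetric] intro: ccontr)
  then show ?thesis unfolding exp_operator_def by (intro Sum_any.expand_superset) simp_all
qed

text \<open>
  If \<open>\<omega>\<close> is invariant, comparing \<open>\<omega> (exp x w)\<close> and \<open>\<omega> w\<close> for \<open>w\<close> in the image of ever lower powers
  of \<open>x\<close> isolates the linear term of the exponential.
\<close>

lemma (in lie_module) dual_invariants_eq:
  assumes n: "n \<subseteq> L" and nil: "\<And>x w. x \<in> n \<Longrightarrow> w \<in> V \<Longrightarrow> (\<rho> x ^^ d) w = 0"
  shows "dual_invariants sv \<rho> n V = {\<omega> \<in> dual_space sv V. \<forall>x\<in>n. \<forall>w\<in>V. \<omega> (\<rho> x w) = 0}"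
proof -
  have C: "vector_space ((*) :: complex \<Rightarrow> complex \<Rightarrow> complex)"
    by unfold_locales (auto simp: algebra_simps)
  have pow: "(\<rho> x ^^ k) w \<in> V" if "x \<in> n" "w \<in> V" for x w k
    by (induction k) (use that n act_closed in auto)
  have exp_in: "exp_operator sv (\<rho> x) w \<in> V" if "x \<in> n" "w \<in> V" for x w
  proof -
    have "exp_operator sv (\<rho> x) w = (\<Sum>k<d. sv (1 / fact k) ((\<rho> x ^^ k) w))"
      by (rule exp_operator_eq[OF subsetD[OF n that(1)] that(2) nil[OF that(1)] order_refl])
    also have "\<dots> \<in> V"
      using pow[OF that] by (intro M.subspace_sum[OF V_subspace] M.subspace_scale[OF V_subspace])
    finally show ?thesis .
  qed
  have exp_value: "\<omega> (exp_operator sv (\<rho> x) w) =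
      \<omega> w + \<omega> (\<rho> x w) + (\<Sum>k<d. 1 / fact (Suc (Suc k)) * \<omega> ((\<rho> x ^^ Suc (Suc k)) w))"
    if \<omega>: "linear_map_on sv (*) V \<omega>" and x: "x \<in> n" and w: "w \<in> V" for \<omega> x w
  proof -
    have "\<omega> (exp_operator sv (\<rho> x) w) = \<omega> (\<Sum>k<Suc (Suc d). sv (1 / fact k) ((\<rho> x ^^ k) w))"
      using exp_operator_eq[OF subsetD[OF n x] w nil[OF x], of "Suc (Suc d)"] by simp
    also have "\<dots> = (\<Sum>k<Suc (Suc d). \<omega> (sv (1 / fact k) ((\<rho> x ^^ k) w)))"
      using pow[OF x w]
      by (intro linear_map_on_sum[OF M.vector_space_axioms C V_subspace \<omega>] M.subspace_scale[OF V_subspace])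
    also have "\<dots> = (\<Sum>k<Suc (Suc d). 1 / fact k * \<omega> ((\<rho> x ^^ k) w))"
      using \<omega> pow[OF x w] unfolding linear_map_on_def by (intro sum.cong) blast+
    also have "\<dots> = \<omega> w + \<omega> (\<rho> x w)
        + (\<Sum>k<d. 1 / fact (Suc (Suc k)) * \<omega> ((\<rho> x ^^ Suc (Suc k)) w))"
      unfolding sum.lessThan_Suc_shift by (simp add: add.assoc)
    finally show ?thesis .
  qed
  have kills: "\<omega> (\<rho> x w) = 0"
    if inv: "\<omega> \<in> dual_invariants sv \<rho> n V" and x: "x \<in> n" and w: "w \<in> V" for \<omega> x w
  proof -
    have \<omega>: "linear_map_on sv (*) V \<omega>"
      using inv unfolding dual_invariants_def dual_space_def by blast
    have "exp_operator sv (\<rho> x) \<circ> id \<in> unipotent_group sv \<rho> n"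
      using x by (intro unipotent_group.intros)
    then have exp: "\<omega> (exp_operator sv (\<rho> x) w) = \<omega> w" if "w \<in> V" for w
      using inv that unfolding dual_invariants_def by fastforce
    have "\<forall>k\<ge>1. Suc d \<le> k + i \<longrightarrow> (\<forall>w\<in>V. \<omega> ((\<rho> x ^^ k) w) = 0)" for i
    proof (induction i)
      case 0
      have "\<omega> 0 = 0" using linear_map_on_0[OF M.vector_space_axioms C V_subspace \<omega>] .
      moreover have "(\<rho> x ^^ k) w = 0" if "Suc d \<le> k" "w \<in> V" for k w
      proof -
        have "(\<rho> x ^^ k) w = (\<rho> x ^^ d) ((\<rho> x ^^ (k - d)) w)"
          using that funpow_add[of d "k - d" "\<rho> x"] by simp
        then show ?thesis using nil[OF x pow[OF x that(2)]] by simp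
      qed
      ultimately show ?case by simp
    next
      case (Suc i)
      show ?case
      proof (intro allI impI ballI)
        fix k w assume k: "1 \<le> k" "Suc d \<le> k + Suc i" and w: "w \<in> V"
        then obtain j where j: "k = Suc j" by (cases k) auto
        let ?w = "(\<rho> x ^^ j) w"
        have "\<omega> ((\<rho> x ^^ Suc (Suc l)) ?w) = 0" for l
        proof -
          have "(\<rho> x ^^ Suc (Suc l)) ?w = (\<rho> x ^^ (Suc (Suc l) + j)) w" by (simp add: funpow_add)
          moreover have "\<omega> ((\<rho> x ^^ (Suc (Suc l) + j)) w) = 0" 
            by (rule Suc.IH[rule_format]) (use k j w in auto)
          ultimately show ?thesis by simp
        qed
        then have "\<omega> ?w = \<omega> ?w + \<omega> (\<rho> x ?w)"
          using exp_value[OF \<omega> x pow[OF x w, of j]] exp[OF pow[OF x w, of j]]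
          by (simp only: mult_zero_right sum.neutral_const add_0_right)
        then show "\<omega> ((\<rho> x ^^ k) w) = 0" unfolding j by simp
      qed
    qed
    from this[of "Suc d"] show ?thesis using w by (auto dest: spec[of _ 1])
  qed
  have invariant: "\<omega> \<in> dual_invariants sv \<rho> n V"
    if dual: "\<omega> \<in> dual_space sv V" and zero: "\<And>x w. x \<in> n \<Longrightarrow> w \<in> V \<Longrightarrow> \<omega> (\<rho> x w) = 0" for \<omega>
  proof -
    have \<omega>: "linear_map_on sv (*) V \<omega>" using dual unfolding dual_space_def by blast
    have exp: "\<omega> (exp_operator sv (\<rho> x) w) = \<omega> w" if x: "x \<in> n" and w: "w \<in> V" for x w
    proof -
      have "\<omega> ((\<rho> x ^^ Suc (Suc k)) w) = 0" for k using zero[OF x pow[OF x w, of "Suc k"]] by simp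
      then show ?thesis using exp_value[OF \<omega> x w] zero[OF x w]
        by (simp only: mult_zero_right sum.neutral_const add_0_right)
    qed
    have "\<forall>v\<in>V. g v \<in> V \<and> \<omega> (g v) = \<omega> v" if "g \<in> unipotent_group sv \<rho> n" for g
      using that by (induction rule: unipotent_group.induct) (auto simp: exp_in exp)
    then show ?thesis unfolding dual_invariants_def using dual by blast
  qed
  have "dual_invariants sv \<rho> n V \<subseteq> dual_space sv V" unfolding dual_invariants_def by blast
  then show ?thesis using kills invariant by blast
qed

lemma lie_module_on_subalgebra:
  assumes "lie_module_on sg br L sv \<rho> V" "H \<subseteq> L"
  shows "lie_module_on sg br H sv \<rho> V"
  using assms linear_map_on_subset[of sg sv L _ H] unfolding lie_module_on_def by (meson subsetD)

section \<open>Invariant functionals on a direct sum\<close>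

text \<open>
  The components are given by one function \<open>comp\<close> with its uniqueness property, from which linearity
  and compatibility with the action follow.
\<close>

lemma direct_sum_components:
  assumes "vector_space s" "internal_direct_sum I W V" "\<And>i. i \<in> I \<Longrightarrow> module.subspace s (W i)"
  shows "\<exists>comp. (\<forall>v\<in>V. (\<forall>i\<in>I. comp v i \<in> W i) \<and> (\<Sum>i\<in>I. comp v i) = v) \<and>
    (\<forall>x. (\<forall>j\<in>I. x j \<in> W j) \<longrightarrow> (\<forall>i\<in>I. comp (\<Sum>j\<in>I. x j) i = x i))"
proof -
  interpret vector_space s by fact
  have V: "V = {\<Sum>i\<in>I. w i | w. \<forall>i\<in>I. w i \<in> W i}"
    and zero: "\<And>w. (\<forall>i\<in>I. w i \<in> W i) \<and> (\<Sum>i\<in>I. w i) = 0 \<longrightarrow> (\<forall>i\<in>I. w i = 0)"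
    using assms(2) unfolding internal_direct_sum_def by blast+
  define comp where "comp v = (SOME x. (\<forall>i\<in>I. x i \<in> W i) \<and> (\<Sum>i\<in>I. x i) = v)" for v
  have comp: "(\<forall>i\<in>I. comp v i \<in> W i) \<and> (\<Sum>i\<in>I. comp v i) = v" if "v \<in> V" for v
  proof -
    have "\<exists>x. (\<forall>i\<in>I. x i \<in> W i) \<and> (\<Sum>i\<in>I. x i) = v" using that V by blast
    from someI_ex[OF this] show ?thesis unfolding comp_def .
  qed
  have unique: "comp (\<Sum>j\<in>I. x j) i = x i" if x: "\<forall>j\<in>I. x j \<in> W j" and i: "i \<in> I" for x i
  proof -
    let ?v = "\<Sum>j\<in>I. x j"
    have "?v \<in> V" unfolding V using x by blast
    then have c: "(\<forall>i\<in>I. comp ?v i \<in> W i) \<and> (\<Sum>i\<in>I. comp ?v i) = ?v" by (rule comp)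
    have "\<forall>j\<in>I. comp ?v j - x j \<in> W j" using c x assms(3) by (auto intro: subspace_diff)
    moreover have "(\<Sum>j\<in>I. comp ?v j - x j) = 0" using c by (simp add: sum_subtractf)
    ultimately have "\<forall>j\<in>I. comp ?v j - x j = 0"
      using zero[of "\<lambda>j. comp ?v j - x j"] by simp
    then show ?thesis using i by simp
  qed
  have "(\<forall>v\<in>V. (\<forall>i\<in>I. comp v i \<in> W i) \<and> (\<Sum>i\<in>I. comp v i) = v) \<and>
    (\<forall>x. (\<forall>j\<in>I. x j \<in> W j) \<longrightarrow> (\<forall>i\<in>I. comp (\<Sum>j\<in>I. x j) i = x i))"
    using comp unique by (intro conjI allI impI ballI) blast+
  then show ?thesis by (rule exI[of _ comp])
qed

text \<open>
  The space of functionals that vanish on \<open>n V\<close>, presented by a basis of weight vectors with dual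
  vectors \<open>w i\<close>, so that the coordinates of \<open>\<omega>\<close> are its values at the \<open>w i\<close>. The index carries the weight
  in its first component.
\<close>

locale invariant_basis =
  fixes sv :: "complex \<Rightarrow> 'v::ab_group_add \<Rightarrow> 'v" and \<rho> :: "'g \<Rightarrow> 'v \<Rightarrow> 'v" and V :: "'v set"
    and n t :: "'g set" and I :: "(('g \<Rightarrow> complex) \<times> 'j) set" and \<Omega> :: "(('g \<Rightarrow> complex) \<times> 'j) \<Rightarrow> 'v \<Rightarrow> complex"
    and w :: "(('g \<Rightarrow> complex) \<times> 'j) \<Rightarrow> 'v"
  assumes finite_I: "finite I" and \<Omega>_linear: "i \<in> I \<Longrightarrow> linear_map_on sv (*) V (\<Omega> i)"
    and \<Omega>_kills: "i \<in> I \<Longrightarrow> x \<in> n \<Longrightarrow> v \<in> V \<Longrightarrow> \<Omega> i (\<rho> x v) = 0"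
    and \<Omega>_weight: "i \<in> I \<Longrightarrow> h \<in> t \<Longrightarrow> v \<in> V \<Longrightarrow> \<Omega> i (\<rho> h v) = fst i h * \<Omega> i v"
    and w_in: "i \<in> I \<Longrightarrow> w i \<in> V"
    and \<Omega>_w: "i \<in> I \<Longrightarrow> j \<in> I \<Longrightarrow> \<Omega> i (w j) = (if i = j then 1 else 0)"
    and \<Omega>_basis: "linear_map_on sv (*) V \<omega> \<Longrightarrow> (\<And>x v. x \<in> n \<Longrightarrow> v \<in> V \<Longrightarrow> \<omega> (\<rho> x v) = 0) \<Longrightarrow> v \<in> V \<Longrightarrow>
      \<omega> v = (\<Sum>i\<in>I. \<omega> (w i) * \<Omega> i v)"

text \<open>Each irreducible summand contributes one functional, dual to its highest weight vector.\<close>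

lemma (in triangular) invariant_basis_exists:
  assumes mod: "lie_module_on sg br L sv \<rho> V"
    and dec: "decomposes_with_multiplicities sg br L P t u sv \<rho> V m"
  defines "I \<equiv> {(\<mu>, j). dominant_weight sg br L t P \<mu> \<and> j < m \<mu>}"
  shows "(\<exists>\<Omega> w. invariant_basis sv \<rho> V um t I \<Omega> w) \<and> (\<exists>d. \<forall>x\<in>um. \<forall>v\<in>V. (\<rho> x ^^ d) v = 0)"
proof -
  interpret lie_module sg br L sv \<rho> V by unfold_locales (rule lie_alg mod)+
  have C: "vector_space ((*) :: complex \<Rightarrow> complex \<Rightarrow> complex)"
    by unfold_locales (auto simp: algebra_simps)
  obtain W0 where W0: "\<forall>\<mu> j. dominant_weight sg br L t P \<mu> \<and> j < m \<mu> \<longrightarrow>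
      (\<exists>w. irreducible_highest_weight_module sg br L t u sv \<rho> (W0 \<mu> j) \<mu> w)"
    and ds: "internal_direct_sum I (\<lambda>(\<mu>, j). W0 \<mu> j) V"
    using dec unfolding decomposes_with_multiplicities_def I_def by blast
  define W where "W = (\<lambda>(\<mu>, j). W0 \<mu> j)"
  note ds = ds[folded W_def]
  have "\<forall>i\<in>I. \<exists>w. irreducible_highest_weight_module sg br L t u sv \<rho> (W i) (fst i) w"
    using W0 unfolding I_def W_def by auto
  from bchoice[OF this] obtain w where
    w: "\<forall>i\<in>I. irreducible_highest_weight_module sg br L t u sv \<rho> (W i) (fst i) (w i)" ..
  have hw: "highest_weight_module sg br L P um t u sv \<rho> (W i) (fst i) (w i)" if "i \<in> I" for i
    using w that by unfold_locales blast
  have fin: "finite I" and V: "V = {\<Sum>i\<in>I. x i | x. \<forall>i\<in>I. x i \<in> W i}"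
    using ds unfolding internal_direct_sum_def by blast+
  define Psi where "Psi i \<psi> \<longleftrightarrow> linear_map_on sv (*) (W i) \<psi> \<and> \<psi> (w i) = 1 \<and>
      (\<forall>x\<in>um. \<forall>v\<in>W i. \<psi> (\<rho> x v) = 0) \<and> (\<forall>h\<in>t. \<forall>v\<in>W i. \<psi> (\<rho> h v) = fst i h * \<psi> v) \<and>
      (\<forall>\<omega>. linear_map_on sv (*) (W i) \<omega> \<longrightarrow> (\<forall>x\<in>um. \<forall>v\<in>W i. \<omega> (\<rho> x v) = 0) \<longrightarrow>
        (\<forall>v\<in>W i. \<omega> v = \<omega> (w i) * \<psi> v))" for i \<psi>
  have summand: "M.subspace (W i) \<and> (\<forall>x\<in>L. \<forall>v\<in>W i. \<rho> x v \<in> W i) \<and> w i \<in> W i \<and>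
      (\<exists>d. \<forall>x\<in>um. \<forall>v\<in>W i. (\<rho> x ^^ d) v = 0) \<and> (\<exists>\<psi>. Psi i \<psi>)" if i: "i \<in> I" for i
  proof -
    interpret S: highest_weight_module sg br L P um t u sv \<rho> "W i" "fst i" "w i" by (rule hw[OF i])
    have "\<exists>\<psi>. Psi i \<psi>"
      by (rule S.coinvariants) (unfold Psi_def, blast)
    then show ?thesis using S.V_subspace S.act_closed S.v_in S.um_nilpotent by blast
  qed
  have sub: "M.subspace (W i)" and inv: "x \<in> L \<Longrightarrow> v \<in> W i \<Longrightarrow> \<rho> x v \<in> W i" and wW: "w i \<in> W i"
    if "i \<in> I" for i x v
    using summand[OF that] by blast+
  have "\<forall>i\<in>I. \<exists>\<psi>. Psi i \<psi>" using summand by blast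
  from bchoice[OF this] obtain \<psi> where \<psi>: "\<forall>i\<in>I. Psi i (\<psi> i)" ..
  have "\<forall>i\<in>I. \<exists>d. \<forall>x\<in>um. \<forall>v\<in>W i. (\<rho> x ^^ d) v = 0" using summand by blast
  from bchoice[OF this] obtain d where d: "\<forall>i\<in>I. \<forall>x\<in>um. \<forall>v\<in>W i. (\<rho> x ^^ d i) v = 0" ..
  have WV: "x \<in> V" if i: "i \<in> I" and x: "x \<in> W i" for i x
  proof -
    have "x = (\<Sum>j\<in>I. if j = i then x else 0)" using fin i by simp
    moreover have "\<forall>j\<in>I. (if j = i then x else 0) \<in> W j" using x M.subspace_0[OF sub] by simp
    ultimately show ?thesis unfolding V by blast
  qed
  obtain comp where comp: "(\<forall>v\<in>V. (\<forall>i\<in>I. comp v i \<in> W i) \<and> (\<Sum>i\<in>I. comp v i) = v) \<and>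
    (\<forall>x. (\<forall>j\<in>I. x j \<in> W j) \<longrightarrow> (\<forall>i\<in>I. comp (\<Sum>j\<in>I. x j) i = x i))"
    using direct_sum_components[OF M.vector_space_axioms ds sub] ..
  have comp_in: "comp v i \<in> W i" if "v \<in> V" "i \<in> I" for v i using comp that by blast
  have comp_sum: "(\<Sum>i\<in>I. comp v i) = v" if "v \<in> V" for v using comp that by blast
  have comp_unique: "comp (\<Sum>j\<in>I. x j) i = x i" if "\<And>j. j \<in> I \<Longrightarrow> x j \<in> W j" "i \<in> I" for x i
    using conjunct2[OF comp, rule_format, of x i] that by blast
  have comp_add: "comp (x + y) i = comp x i + comp y i" if "x \<in> V" "y \<in> V" "i \<in> I" for x y i
  proof -
    have "comp (\<Sum>j\<in>I. comp x j + comp y j) i = comp x i + comp y i"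
      using that comp_in sub by (intro comp_unique) (auto intro: M.subspace_add)
    then show ?thesis using comp_sum that by (simp add: sum.distrib)
  qed
  have comp_scale: "comp (sv c x) i = sv c (comp x i)" if "x \<in> V" "i \<in> I" for c x i
  proof -
    have "comp (\<Sum>j\<in>I. sv c (comp x j)) i = sv c (comp x i)"
      using that comp_in sub by (intro comp_unique) (auto intro: M.subspace_scale)
    then show ?thesis using comp_sum that by (simp add: M.scale_sum_right[symmetric])
  qed
  have comp_act: "comp (\<rho> z x) i = \<rho> z (comp x i)" if "z \<in> L" "x \<in> V" "i \<in> I" for z x i
  proof -
    have "comp (\<Sum>j\<in>I. \<rho> z (comp x j)) i = \<rho> z (comp x i)"
      using that comp_in inv by (intro comp_unique) auto
    moreover have "\<rho> z (\<Sum>j\<in>I. comp x j) = (\<Sum>j\<in>I. \<rho> z (comp x j))"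
      using that comp_in WV by (intro act_sum) auto
    ultimately show ?thesis using comp_sum that by simp
  qed
  have comp_w: "comp (w j) i = (if i = j then w j else 0)" if "i \<in> I" "j \<in> I" for i j
  proof -
    have "comp (\<Sum>k\<in>I. if k = j then w j else 0) i = (if i = j then w j else 0)"
      by (rule comp_unique) (use that wW M.subspace_0[OF sub] in auto)
    then show ?thesis using fin that by simp
  qed
  define \<Omega> where "\<Omega> i v = \<psi> i (comp v i)" for i v
  have "invariant_basis sv \<rho> V um t I \<Omega> w"
  proof
    show "finite I" by (rule fin)
    show "w i \<in> V" if "i \<in> I" for i using wW WV that by blast
    show "linear_map_on sv (*) V (\<Omega> i)" if i: "i \<in> I" for i
      using \<psi> i comp_in comp_add comp_scale unfolding \<Omega>_def Psi_def linear_map_on_def by simp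
    show "\<Omega> i (\<rho> x v) = 0" if "i \<in> I" "x \<in> um" "v \<in> V" for i x v
      using \<psi> that comp_in comp_act um_subset unfolding \<Omega>_def Psi_def by (simp add: subset_iff)
    show "\<Omega> i (\<rho> h v) = fst i h * \<Omega> i v" if "i \<in> I" "h \<in> t" "v \<in> V" for i h v
      using \<psi> that comp_in comp_act t_subset unfolding \<Omega>_def Psi_def by (simp add: subset_iff)
    show "\<Omega> i (w j) = (if i = j then 1 else 0)" if "i \<in> I" "j \<in> I" for i j
    proof -
      have "linear_map_on sv (*) (W i) (\<psi> i)" "\<psi> i (w i) = 1" using \<psi> that unfolding Psi_def by blast+
      then show ?thesis using comp_w[OF that] linear_map_on_0[OF M.vector_space_axioms C sub[OF that(1)]]
        unfolding \<Omega>_def by (cases "i = j") auto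
    qed
    show "\<omega> v = (\<Sum>i\<in>I. \<omega> (w i) * \<Omega> i v)"
      if \<omega>: "linear_map_on sv (*) V \<omega>" and kill: "\<And>x v. x \<in> um \<Longrightarrow> v \<in> V \<Longrightarrow> \<omega> (\<rho> x v) = 0"
        and v: "v \<in> V" for \<omega> v
    proof -
      have "\<omega> v = \<omega> (\<Sum>i\<in>I. comp v i)" using comp_sum[OF v] by simp
      also have "\<dots> = (\<Sum>i\<in>I. \<omega> (comp v i))"
        using comp_in[OF v] WV by (intro linear_map_on_sum[OF M.vector_space_axioms C V_subspace \<omega>]) blast
      also have "\<dots> = (\<Sum>i\<in>I. \<omega> (w i) * \<Omega> i v)"
      proof (rule sum.cong)
        fix i assume i: "i \<in> I"
        have "linear_map_on sv (*) (W i) \<omega>" using linear_map_on_subset[OF \<omega>] WV[OF i] by blast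
        moreover have "\<forall>x\<in>um. \<forall>v\<in>W i. \<omega> (\<rho> x v) = 0" using kill WV[OF i] by blast
        moreover have "comp v i \<in> W i" using comp_in[OF v i] .
        moreover have "Psi i (\<psi> i)" using \<psi> i by blast
        ultimately show "\<omega> (comp v i) = \<omega> (w i) * \<Omega> i v" unfolding Psi_def \<Omega>_def by simp
      qed simp
      finally show ?thesis .
    qed
  qed
  moreover have "(\<rho> x ^^ (\<Sum>i\<in>I. d i)) v = 0" if x: "x \<in> um" and v: "v \<in> V" for x v
  proof -
    have xL: "x \<in> L" using x um_subset by blast
    have pow: "(\<rho> x ^^ k) y \<in> W i" if "i \<in> I" "y \<in> W i" for i y k
      by (induction k) (use that inv[OF _ xL] in auto)
    have "(\<rho> x ^^ k) v = (\<Sum>i\<in>I. (\<rho> x ^^ k) (comp v i))" for k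
    proof (induction k)
      case 0
      then show ?case using comp_sum[OF v] by simp
    next
      case (Suc k)
      have "\<rho> x (\<Sum>i\<in>I. (\<rho> x ^^ k) (comp v i)) = (\<Sum>i\<in>I. \<rho> x ((\<rho> x ^^ k) (comp v i)))"
        by (rule act_sum[OF xL]) (use pow comp_in[OF v] WV in blast)
      then show ?case using Suc by simp
    qed
    moreover have "(\<rho> x ^^ (\<Sum>i\<in>I. d i)) (comp v i) = 0" if i: "i \<in> I" for i
    proof -
      have "d i \<le> (\<Sum>i\<in>I. d i)" using fin i by (intro member_le_sum) auto
      then obtain k where k: "(\<Sum>i\<in>I. d i) = d i + k" using le_Suc_ex by blast
      have "(\<rho> x ^^ d i) ((\<rho> x ^^ k) (comp v i)) = 0" using d i x pow[OF i comp_in[OF v i]] by blast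
      then show ?thesis unfolding k by (simp add: funpow_add)
    qed
    ultimately show ?thesis by simp
  qed
  ultimately show ?thesis by blast
qed

section \<open>Signatures and multiplicities\<close>

locale signatures = highest_weight_module sg br L P um t u sv \<rho> V \<Lambda> v
  for sg :: "complex \<Rightarrow> 'g::ab_group_add \<Rightarrow> 'g" and br :: "'g \<Rightarrow> 'g \<Rightarrow> 'g" and L :: "'g set"
    and P :: "('g \<Rightarrow> complex) set" and um t u :: "'g set"
    and sv :: "complex \<Rightarrow> 'v::ab_group_add \<Rightarrow> 'v" and \<rho> :: "'g \<Rightarrow> 'v \<Rightarrow> 'v" and V :: "'v set"
    and \<Lambda> :: "'g \<Rightarrow> complex" and v :: 'v +
  fixes N :: nat and \<alpha> :: "nat \<Rightarrow> 'g \<Rightarrow> complex" and f :: "nat \<Rightarrow> 'g"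
  assumes simple: "simple_lie_algebra sg br L" and \<alpha>: "\<alpha> ` {1..N} = P"
    and f: "\<And>i. i \<in> {1..N} \<Longrightarrow> f i \<in> root_space sg br L t (neg_weight t (\<alpha> i)) \<and> f i \<noteq> 0"
begin

abbreviation sigvec :: "(nat \<Rightarrow> nat) \<Rightarrow> 'v" where
  "sigvec p \<equiv> signature_vector f \<rho> N v p"

lemma f_in: "i \<in> {1..N} \<Longrightarrow> f i \<in> L"
  using f unfolding root_space_def by blast

lemma f_um: "i \<in> {1..N} \<Longrightarrow> f i \<in> um"
  unfolding um_span neg_root_vectors_def using f \<alpha> by (intro adj.G.span_base) blast

lemma pow_in: "x \<in> L \<Longrightarrow> w \<in> V \<Longrightarrow> (\<rho> x ^^ k) w \<in> V"
  by (induction k) (auto simp: act_closed)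

lemma foldr_in: "set is \<subseteq> {1..N} \<Longrightarrow> foldr (\<lambda>i w. (\<rho> (f i) ^^ p i) w) is v \<in> V"
  by (induction "is") (auto simp: v_in pow_in f_in)

lemma sigvec_in: "sigvec p \<in> V"
  unfolding signature_vector_def by (rule foldr_in) auto

text \<open>
  Straightening applies because the chosen root vectors span \<open>um\<close>, which is closed under brackets of
  these vectors.
\<close>

lemma span_sigvec: "M.span {sigvec p |p. p \<in> exponent_tuples N} = V"
proof
  show "M.span {sigvec p |p. p \<in> exponent_tuples N} \<subseteq> V"
    by (rule M.span_minimal[OF _ V_subspace]) (use sigvec_in in blast)
  have neg_span: "um = adj.G.span (f ` {1..N})" by (rule negative_root_vectors(1)[OF simple \<alpha> f])
  have neg_br: "br (f i) (f j) \<in> um" if "i \<in> {1..N}" "j \<in> {1..N}" for i j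
    by (rule negative_root_vectors(2)[OF simple \<alpha> f that])
  have fL: "f ` {1..N} \<subseteq> L" using f_in by blast
  have str: "straightening sv V (\<lambda>i. \<rho> (f i)) {1..N} v"
  proof
    show "M.subspace V" by (rule V_subspace)
    show "v \<in> V" by (rule v_in)
    show "linear_map_on sv sv V (\<rho> (f i))" if "i \<in> {1..N}" for i using act_linear f_in[OF that] .
    show "\<rho> (f i) w \<in> V" if "i \<in> {1..N}" "w \<in> V" for i w using act_closed f_in that by blast
    fix i j w assume i: "i \<in> {1..N}" and j: "j \<in> {1..N}" and w: "w \<in> V"
    have "\<rho> (br (f i) (f j)) w \<in> M.span ((\<lambda>k. \<rho> (f k) w) ` {1..N})"
    proof (rule act_span_left[OF w fL M.subspace_span])
      show "br (f i) (f j) \<in> adj.G.span (f ` {1..N})" using neg_br[OF i j] neg_span by simp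
    qed (auto intro: M.span_base)
    then show "\<rho> (f i) (\<rho> (f j) w) - \<rho> (f j) (\<rho> (f i) w) \<in> M.span ((\<lambda>k. \<rho> (f k) w) ` {1..N})"
      using act_commute[OF f_in[OF i] f_in[OF j] w] by simp
  qed
  have "foldr \<rho> ys v \<in> M.span {sigvec p |p. p \<in> exponent_tuples N}" if "set ys \<subseteq> f ` {1..N}" for ys
  proof -
    have "\<exists>is. set is \<subseteq> {1..N} \<and> ys = map f is"
      using that
    proof (induction ys)
      case (Cons y ys)
      then obtain i "is" where "i \<in> {1..N}" "y = f i" "set is \<subseteq> {1..N}" "ys = map f is" by auto
      then show ?case by (intro exI[of _ "i # is"]) simp
    qed simp
    then obtain "is" where is': "set is \<subseteq> {1..N}" "ys = map f is" by blast
    have "foldr \<rho> ys v = foldr (\<lambda>i. \<rho> (f i)) is v" unfolding is'(2) by (simp add: foldr_map comp_def)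
    then show ?thesis
      using span_ordered_monomials[OF str is'(1)] unfolding signature_vector_def by simp
  qed
  then have "{foldr \<rho> ys v |ys. set ys \<subseteq> f ` {1..N}} \<subseteq> M.span {sigvec p |p. p \<in> exponent_tuples N}"
    by blast
  then have "M.span {foldr \<rho> ys v |ys. set ys \<subseteq> f ` {1..N}} \<subseteq> M.span {sigvec p |p. p \<in> exponent_tuples N}"
    by (rule M.span_minimal[OF _ M.subspace_span])
  then show "V \<subseteq> M.span {sigvec p |p. p \<in> exponent_tuples N}"
    using span_words[OF fL] neg_span by simp
qed

text \<open>
  Since \<open>um\<close> acts nilpotently, large exponents give zero. This replaces well-foundedness of the monomial
  order.
\<close>

lemma finite_sigvec: "finite {p \<in> exponent_tuples N. sigvec p \<noteq> 0}"
proof -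
  obtain d where d: "\<forall>x\<in>um. \<forall>w\<in>V. (\<rho> x ^^ d) w = 0" using um_nilpotent ..
  have pow0: "(\<rho> x ^^ k) 0 = 0" if "x \<in> L" for x k
    by (induction k) (auto simp: act_0[OF that])
  have zero: "foldr (\<lambda>i w. (\<rho> (f i) ^^ p i) w) is v = 0"
    if "set is \<subseteq> {1..N}" "i \<in> set is" "d \<le> p i" for p i "is"
    using that
  proof (induction "is")
    case (Cons j js)
    let ?w = "foldr (\<lambda>i w. (\<rho> (f i) ^^ p i) w) js v"
    have w: "?w \<in> V" using foldr_in Cons.prems(1) by simp
    have j: "j \<in> {1..N}" using Cons.prems(1) by simp
    show ?case
    proof (cases "i = j")
      case True
      then have "(\<rho> (f j) ^^ p j) ?w = (\<rho> (f j) ^^ d) ((\<rho> (f j) ^^ (p j - d)) ?w)"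
        using Cons.prems(3) funpow_add[of d "p j - d" "\<rho> (f j)"] by simp
      also have "\<dots> = 0" using d f_um[OF j] pow_in[OF f_in[OF j] w] by blast
      finally show ?thesis by simp
    next
      case False
      then have "?w = 0" using Cons by simp
      then show ?thesis using pow0[OF f_in[OF j]] by simp
    qed
  qed simp
  have "{p \<in> exponent_tuples N. sigvec p \<noteq> 0}
      \<subseteq> {p. \<forall>i. (i \<in> {1..N} \<longrightarrow> p i \<in> {..<d}) \<and> (i \<notin> {1..N} \<longrightarrow> p i = 0)}"
  proof (rule subsetI, rule CollectI, rule allI, rule conjI; rule impI)
    fix p i assume p: "p \<in> {p \<in> exponent_tuples N. sigvec p \<noteq> 0}"
    show "p i = 0" if "i \<notin> {1..N}" using p that unfolding exponent_tuples_def by simp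
    show "p i \<in> {..<d}" if i: "i \<in> {1..N}"
    proof (rule ccontr)
      assume "p i \<notin> {..<d}"
      then have "sigvec p = 0" unfolding signature_vector_def by (intro zero) (use i in auto)
      then show False using p by simp
    qed
  qed
  then show ?thesis by (rule finite_subset) (intro finite_set_of_finite_funs; simp)
qed

lemma sigvec_weight:
  assumes h: "h \<in> t"
  shows "\<rho> h (sigvec p) = sv (\<Lambda> h - (\<Sum>i=1..N. of_nat (p i) * \<alpha> i h)) (sigvec p)"
proof -
  have hL: "h \<in> L" using h t_subset by blast
  have pow: "\<rho> h ((\<rho> (f i) ^^ k) w) = sv (c - of_nat k * \<alpha> i h) ((\<rho> (f i) ^^ k) w)"
    if i: "i \<in> {1..N}" and w: "w \<in> V" "\<rho> h w = sv c w" for i k w c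
  proof (induction k)
    case 0
    then show ?case using w by simp
  next
    case (Suc k)
    have "br h (f i) = sg (- \<alpha> i h) (f i)" using f[OF i] h unfolding root_space_def neg_weight_def by simp
    from weight_shift[OF hL f_in[OF i] pow_in[OF f_in[OF i] w(1)] this Suc]
    have "\<rho> h (\<rho> (f i) ((\<rho> (f i) ^^ k) w)) =
        sv (c - of_nat k * \<alpha> i h + - \<alpha> i h) (\<rho> (f i) ((\<rho> (f i) ^^ k) w))" .
    also have "c - of_nat k * \<alpha> i h + - \<alpha> i h = c - of_nat (Suc k) * \<alpha> i h" by (simp add: algebra_simps)
    finally show ?case by simp
  qed
  have "\<rho> h (foldr (\<lambda>i w. (\<rho> (f i) ^^ p i) w) is v)
      = sv (\<Lambda> h - (\<Sum>i\<leftarrow>is. of_nat (p i) * \<alpha> i h)) (foldr (\<lambda>i w. (\<rho> (f i) ^^ p i) w) is v)"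
    if "set is \<subseteq> {1..N}" for "is"
    using that
  proof (induction "is")
    case Nil
    show ?case using v_weight[OF h] by simp
  next
    case (Cons j js)
    have "\<Lambda> h - (\<Sum>i\<leftarrow>js. of_nat (p i) * \<alpha> i h) - of_nat (p j) * \<alpha> j h
        = \<Lambda> h - (\<Sum>i\<leftarrow>j # js. of_nat (p i) * \<alpha> i h)" by simp
    with pow[OF _ foldr_in Cons.IH, of j "p j"] Cons.prems show ?case by simp
  qed
  from this[of "[1..<Suc N]"] show ?thesis
    unfolding signature_vector_def
    by (simp add: interv_sum_list_conv_sum_set_nat atLeastLessThanSuc_atLeastAtMost del: upt_Suc)
qed

lemma sign_of_eq:
  assumes r: "monomial_order N r"
    and lt: "least_term {(p, q). (int \<circ> p, int \<circ> q) \<in> r} (exponent_tuples N) (\<lambda>q. \<omega> (sigvec q)) p"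
  shows "sign_of r f \<rho> N \<Lambda> v \<omega> = (\<Lambda>, p)"
proof -
  let ?r = "{(p, q). (int \<circ> p, int \<circ> q) \<in> r}"
  have "trans r" "irrefl r" using r unfolding monomial_order_def strict_linear_order_on_def by blast+
  then have r': "trans ?r" "irrefl ?r" unfolding trans_def irrefl_def by blast+
  have "q = p" if "least_term ?r (exponent_tuples N) (\<lambda>q. \<omega> (sigvec q)) q" for q
    by (rule least_term_unique[OF r' that lt])
  with lt have "(THE p. least_term ?r (exponent_tuples N) (\<lambda>q. \<omega> (sigvec q)) p) = p"
    by (rule the_equality)
  then show ?thesis unfolding sign_of_def least_term_def by simp
qed

end

lemma monomial_order_on_exponents:
  assumes "monomial_order N r"
  shows "trans {(p, q). (int \<circ> p, int \<circ> q) \<in> r}" "irrefl {(p, q). (int \<circ> p, int \<circ> q) \<in> r}"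
    "total_on (exponent_tuples N) {(p, q). (int \<circ> p, int \<circ> q) \<in> r}"
proof -
  have r: "trans r" "irrefl r" "total_on (int_tuples N) r"
    using assms unfolding monomial_order_def strict_linear_order_on_def by blast+
  show "trans {(p, q). (int \<circ> p, int \<circ> q) \<in> r}" "irrefl {(p, q). (int \<circ> p, int \<circ> q) \<in> r}"
    using r(1,2) unfolding trans_def irrefl_def by blast+
  have mem: "int \<circ> p \<in> int_tuples N" if "p \<in> exponent_tuples N" for p
    using that unfolding exponent_tuples_def int_tuples_def by simp
  show "total_on (exponent_tuples N) {(p, q). (int \<circ> p, int \<circ> q) \<in> r}"
  proof (rule total_onI)
    fix p q :: "nat \<Rightarrow> nat" assume pq: "p \<in> exponent_tuples N" "q \<in> exponent_tuples N" "p \<noteq> q"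
    then have "int \<circ> p \<noteq> int \<circ> q" by (auto simp: fun_eq_iff)
    then show "(p, q) \<in> {(p, q). (int \<circ> p, int \<circ> q) \<in> r} \<or> (q, p) \<in> {(p, q). (int \<circ> p, int \<circ> q) \<in> r}"
      using r(3) mem[OF pq(1)] mem[OF pq(2)] unfolding total_on_def by blast
  qed
qed

theorem mainTheorem1:
  fixes sg :: "complex \<Rightarrow> 'g::ab_group_add \<Rightarrow> 'g" and br :: "'g \<Rightarrow> 'g \<Rightarrow> 'g"
    and \<gg> um t u :: "'g set" and P :: "('g \<Rightarrow> complex) set"
    and \<hh> um' th u' :: "'g set" and P' :: "('g \<Rightarrow> complex) set"
    and N :: nat and \<alpha> :: "nat \<Rightarrow> 'g \<Rightarrow> complex" and f :: "nat \<Rightarrow> 'g"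
    and r :: "((nat \<Rightarrow> int) \<times> (nat \<Rightarrow> int)) set"
    and sv :: "complex \<Rightarrow> 'v::ab_group_add \<Rightarrow> 'v"
    and \<rho> :: "('g \<Rightarrow> complex) \<Rightarrow> 'g \<Rightarrow> 'v \<Rightarrow> 'v"
    and V :: "('g \<Rightarrow> complex) \<Rightarrow> 'v set" and vh :: "('g \<Rightarrow> complex) \<Rightarrow> 'v"
    and \<Sigma>' :: "'g signature set"
    and \<Lambda> \<Lambda>' :: "'g \<Rightarrow> complex" and m :: "('g \<Rightarrow> complex) \<Rightarrow> nat"
  assumes g_simple: "simple_lie_algebra sg br \<gg>"
    and g_triangular: "triangular_decomposition sg br \<gg> P um t u"
    and positive_roots: "bij_betw \<alpha> {1..N} P"
    and root_vectors:
      "\<And>i. i \<in> {1..N} \<Longrightarrow> f i \<in> root_space sg br \<gg> t (neg_weight t (\<alpha> i)) \<and> f i \<noteq> 0"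
    and order: "monomial_order N r"
    and modules: "\<And>\<mu>. dominant_weight sg br \<gg> t P \<mu> \<Longrightarrow>
        irreducible_highest_weight_module sg br \<gg> t u sv (\<rho> \<mu>) (V \<mu>) \<mu> (vh \<mu>)"
    and subalgebra: "\<hh> \<subseteq> \<gg>"
    and h_simple: "simple_lie_algebra sg br \<hh>"
    and h_triangular: "triangular_decomposition sg br \<hh> P' um' th u'"
    and cartan: "th \<subseteq> t"
    and \<Sigma>': "\<Sigma>' = branching_semigroup sg br \<gg> t P sv \<rho> V vh r f N um'"
    and dominant: "dominant_weight sg br \<gg> t P \<Lambda>"
    and dominant': "dominant_weight sg br \<hh> th P' \<Lambda>'"
    and multiplicities: "decomposes_with_multiplicities sg br \<hh> P' th u' sv (\<rho> \<Lambda>) (V \<Lambda>) m"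
  shows "finite {\<sigma> \<in> \<Sigma>'. fst \<sigma> = \<Lambda> \<and> restrict (signature_weight t N \<alpha> \<sigma>) th = \<Lambda>'} \<and>
    m \<Lambda>' = card {\<sigma> \<in> \<Sigma>'. fst \<sigma> = \<Lambda> \<and> restrict (signature_weight t N \<alpha> \<sigma>) th = \<Lambda>'}"
proof -
  have g_lie: "lie_algebra_on sg br \<gg>" and h_lie: "lie_algebra_on sg br \<hh>"
    using g_simple h_simple unfolding simple_lie_algebra_def by blast+
  have irr: "irreducible_highest_weight_module sg br \<gg> t u sv (\<rho> \<Lambda>) (V \<Lambda>) \<Lambda> (vh \<Lambda>)"
    by (rule modules[OF dominant])
  interpret g: signatures sg br \<gg> P um t u sv "\<rho> \<Lambda>" "V \<Lambda>" \<Lambda> "vh \<Lambda>" N \<alpha> f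
    by unfold_locales (use g_lie g_triangular irr g_simple positive_roots root_vectors in
        \<open>auto simp: bij_betw_def\<close>)
  interpret h: triangular sg br \<hh> P' um' th u'
    by unfold_locales (rule h_lie h_triangular)+
  let ?V = "V \<Lambda>" and ?\<rho> = "\<rho> \<Lambda>" and ?Q = "exponent_tuples N"
  let ?r = "{(p, q). (int \<circ> p, int \<circ> q) \<in> r}"
  let ?v = "signature_vector f ?\<rho> N (vh \<Lambda>)"
  have h_mod: "lie_module_on sg br \<hh> sv ?\<rho> ?V"
    by (rule lie_module_on_subalgebra[OF g.module_on subalgebra])
  interpret hm: lie_module sg br \<hh> sv ?\<rho> ?V by unfold_locales (rule h_lie h_mod)+
  define I where "I = {(\<mu>, j). dominant_weight sg br \<hh> th P' \<mu> \<and> j < m \<mu>}"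
  obtain \<Omega> w d where "invariant_basis sv ?\<rho> ?V um' th I \<Omega> w"
    and nil: "\<And>x v. x \<in> um' \<Longrightarrow> v \<in> ?V \<Longrightarrow> (?\<rho> x ^^ d) v = 0"
    using h.invariant_basis_exists[OF h_mod multiplicities] unfolding I_def by blast
  then interpret b: invariant_basis sv ?\<rho> ?V um' th I \<Omega> w by blast
  have invariants: "dual_invariants sv ?\<rho> um' ?V
      = {\<omega> \<in> dual_space sv ?V. \<forall>x\<in>um'. \<forall>v\<in>?V. \<omega> (?\<rho> x v) = 0}"
    by (rule hm.dual_invariants_eq[OF h.um_subset nil])
  have um'_V: "?\<rho> x v \<in> ?V" if "x \<in> um'" "v \<in> ?V" for x v
    using hm.act_closed that h.um_subset by blast
  define I' where "I' = {i \<in> I. fst i = \<Lambda>'}"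
  have I': "finite I'" "I' \<subseteq> I" unfolding I'_def using b.finite_I by auto
  have "I' = Pair \<Lambda>' ` {..<m \<Lambda>'}" unfolding I'_def I_def using dominant' by auto
  then have card_I': "card I' = m \<Lambda>'" by (simp add: card_image inj_on_def)
  define rw where "rw p = restrict (signature_weight t N \<alpha> (\<Lambda>, p)) th" for p
  have weight: "rw p = fst i" if i: "i \<in> I" and nz: "\<Omega> i (?v p) \<noteq> 0" for i p
  proof
    fix h
    have "dominant_weight sg br \<hh> th P' (fst i)" using i unfolding I_def by auto
    then have ext: "fst i \<in> extensional th" unfolding dominant_weight_def dual_space_def by blast
    show "rw p h = fst i h"
    proof (cases "h \<in> th")
      case True
      then have t: "h \<in> t" using cartan by blast
      let ?c = "\<Lambda> h - (\<Sum>i=1..N. of_nat (p i) * \<alpha> i h)"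
      have "fst i h * \<Omega> i (?v p) = \<Omega> i (?\<rho> h (?v p))"
        using b.\<Omega>_weight[OF i True g.sigvec_in] by simp
      also have "\<dots> = \<Omega> i (sv ?c (?v p))" using g.sigvec_weight[OF t] by simp
      also have "\<dots> = ?c * \<Omega> i (?v p)"
        using b.\<Omega>_linear[OF i] g.sigvec_in unfolding linear_map_on_def by blast
      finally have "fst i h = ?c" using nz by simp
      then show ?thesis unfolding rw_def signature_weight_def using True t by simp
    next
      case False
      then show ?thesis unfolding rw_def using ext by (simp add: extensional_def)
    qed
  qed
  define S where "S = {p. \<exists>c. least_term ?r ?Q (\<lambda>q. \<Sum>i\<in>I'. c i * \<Omega> i (?v q)) p}"
  have order': "trans ?r" "irrefl ?r" "total_on ?Q ?r"
    by (rule monomial_order_on_exponents[OF order])+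
  have C: "vector_space ((*) :: complex \<Rightarrow> complex \<Rightarrow> complex)"
    by unfold_locales (auto simp: algebra_simps)
  interpret C: vector_space "(*) :: complex \<Rightarrow> complex \<Rightarrow> complex" by (rule C)
  have zero_on_V: "\<omega> v = 0"
    if \<omega>: "linear_map_on sv (*) ?V \<omega>" and zero: "\<And>q. q \<in> ?Q \<Longrightarrow> \<omega> (?v q) = 0" and v: "v \<in> ?V" for \<omega> v
  proof -
    have "\<omega> v \<in> {0}"
      by (rule linear_map_on_span[OF g.M.vector_space_axioms C g.V_subspace \<omega> _ C.subspace_single_0,
            of "{?v p |p. p \<in> ?Q}"])
        (use g.sigvec_in zero v g.span_sigvec in auto)
    then show ?thesis by simp
  qed
  have comb_linear: "linear_map_on sv (*) ?V (\<lambda>v. \<Sum>i\<in>I'. c i * \<Omega> i v)" for c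
  proof -
    have "linear_map_on sv (*) ?V (\<Omega> i)" if "i \<in> I'" for i using b.\<Omega>_linear I'(2) that by blast
    then show ?thesis unfolding linear_map_on_def
      by (auto simp: sum.distrib[symmetric] sum_distrib_left distrib_left mult.left_commute
          intro!: sum.cong)
  qed
  have \<Omega>_0: "\<Omega> i 0 = 0" if "i \<in> I" for i
    by (rule linear_map_on_0[OF g.M.vector_space_axioms C g.V_subspace b.\<Omega>_linear[OF that]])
  have S: "finite S \<and> card S = card I'"
    unfolding S_def
  proof (rule card_least_terms[OF order' I'(1)])
    fix i assume "i \<in> I'"
    then have "\<Omega> i 0 = 0" using \<Omega>_0 I'(2) by blast
    then have "{q \<in> ?Q. \<Omega> i (?v q) \<noteq> 0} \<subseteq> {p \<in> ?Q. ?v p \<noteq> 0}" by auto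
    then show "finite {q \<in> ?Q. \<Omega> i (?v q) \<noteq> 0}" using g.finite_sigvec by (rule finite_subset)
  next
    fix c assume zero: "\<And>q. q \<in> ?Q \<Longrightarrow> (\<Sum>i\<in>I'. c i * \<Omega> i (?v q)) = 0"
    show "\<forall>i\<in>I'. c i = 0"
    proof
      fix j assume j: "j \<in> I'"
      have "(\<Sum>i\<in>I'. c i * \<Omega> i (w j)) = 0"
        using zero_on_V[OF comb_linear zero] b.w_in j I'(2) by blast
      moreover have "(\<Sum>i\<in>I'. c i * \<Omega> i (w j)) = (\<Sum>i\<in>I'. if i = j then c i else 0)"
      proof (rule sum.cong)
        fix i assume "i \<in> I'"
        then have "\<Omega> i (w j) = (if i = j then 1 else 0)" using b.\<Omega>_w[of i j] j I'(2) by blast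
        then show "c i * \<Omega> i (w j) = (if i = j then c i else 0)" by simp
      qed simp
      ultimately show "c j = 0" using j I'(1) by simp
    qed
  qed
  have "{\<sigma> \<in> \<Sigma>'. fst \<sigma> = \<Lambda> \<and> restrict (signature_weight t N \<alpha> \<sigma>) th = \<Lambda>'} = Pair \<Lambda> ` S"
  proof (intro subset_antisym subsetI)
    fix \<sigma> assume "\<sigma> \<in> {\<sigma> \<in> \<Sigma>'. fst \<sigma> = \<Lambda> \<and> restrict (signature_weight t N \<alpha> \<sigma>) th = \<Lambda>'}"
    then have \<sigma>: "\<sigma> \<in> \<Sigma>'" "fst \<sigma> = \<Lambda>" "restrict (signature_weight t N \<alpha> \<sigma>) th = \<Lambda>'" by blast+
    obtain \<Lambda>1 \<omega> where s: "\<sigma> = sign_of r f (\<rho> \<Lambda>1) N \<Lambda>1 (vh \<Lambda>1) \<omega>"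
      and inv: "\<omega> \<in> dual_invariants sv (\<rho> \<Lambda>1) um' (V \<Lambda>1)" and nz: "\<exists>v\<in>V \<Lambda>1. \<omega> v \<noteq> 0"
      using \<sigma>(1) unfolding \<Sigma>' branching_semigroup_def by blast
    have \<Lambda>1: "\<Lambda>1 = \<Lambda>" using s \<sigma>(2) unfolding sign_of_def by simp
    note s = s[unfolded \<Lambda>1] and inv = inv[unfolded \<Lambda>1 invariants] and nz = nz[unfolded \<Lambda>1]
    have lin: "linear_map_on sv (*) ?V \<omega>" and kill: "\<And>x v. x \<in> um' \<Longrightarrow> v \<in> ?V \<Longrightarrow> \<omega> (?\<rho> x v) = 0"
      using inv unfolding dual_space_def by blast+
    have expansion: "\<omega> v = (\<Sum>i\<in>I. \<omega> (w i) * \<Omega> i v)" if "v \<in> ?V" for v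
      by (rule b.\<Omega>_basis[OF lin kill that])
    obtain q where q: "q \<in> ?Q" "\<omega> (?v q) \<noteq> 0" using zero_on_V[OF lin] nz by blast
    have "\<omega> 0 = 0" by (rule linear_map_on_0[OF g.M.vector_space_axioms C g.V_subspace lin])
    then have "{q \<in> ?Q. \<omega> (?v q) \<noteq> 0} \<subseteq> {p \<in> ?Q. ?v p \<noteq> 0}" by auto
    then have "finite {q \<in> ?Q. \<omega> (?v q) \<noteq> 0}" using g.finite_sigvec by (rule finite_subset)
    then obtain p where p: "least_term ?r ?Q (\<lambda>q. \<omega> (?v q)) p"
      using least_term_exists[where a = "\<lambda>q. \<omega> (?v q)", OF order' _ q] by blast
    have sp: "\<sigma> = (\<Lambda>, p)" unfolding s by (rule g.sign_of_eq[OF order p])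
    have rwp: "rw p = \<Lambda>'" using \<sigma>(3) unfolding sp rw_def .
    \<comment> \<open>The weight component of \<open>\<omega>\<close> for \<open>\<Lambda>'\<close> agrees with \<open>\<omega>\<close> on the vectors of that weight.\<close>
    have part: "(\<Sum>i\<in>I'. \<omega> (w i) * \<Omega> i (?v q)) = (if rw q = \<Lambda>' then \<omega> (?v q) else 0)" for q
    proof -
      have "(\<Sum>i\<in>I. \<omega> (w i) * \<Omega> i (?v q)) = (\<Sum>i\<in>I'. \<omega> (w i) * \<Omega> i (?v q))" if "rw q = \<Lambda>'"
        using weight that I'(2) b.finite_I unfolding I'_def by (intro sum.mono_neutral_right) auto
      moreover have "(\<Sum>i\<in>I'. \<omega> (w i) * \<Omega> i (?v q)) = 0" if "rw q \<noteq> \<Lambda>'"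
        using weight that unfolding I'_def by (intro sum.neutral) auto
      ultimately show ?thesis using expansion[OF g.sigvec_in] by simp
    qed
    have "least_term ?r ?Q (\<lambda>q. \<Sum>i\<in>I'. \<omega> (w i) * \<Omega> i (?v q)) p"
      using p rwp unfolding least_term_def part by simp
    then have "p \<in> S" unfolding S_def by (intro CollectI exI[of _ "\<lambda>i. \<omega> (w i)"])
    then show "\<sigma> \<in> Pair \<Lambda> ` S" using sp by blast
  next
    fix \<sigma> assume "\<sigma> \<in> Pair \<Lambda> ` S"
    then obtain p c where sp: "\<sigma> = (\<Lambda>, p)"
      and p: "least_term ?r ?Q (\<lambda>q. \<Sum>i\<in>I'. c i * \<Omega> i (?v q)) p"
      unfolding S_def by blast
    define \<omega> where "\<omega> = restrict (\<lambda>v. \<Sum>i\<in>I'. c i * \<Omega> i v) ?V"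
    have \<omega>: "\<omega> v = (\<Sum>i\<in>I'. c i * \<Omega> i v)" if "v \<in> ?V" for v using that unfolding \<omega>_def by simp
    have "linear_map_on sv (*) ?V \<omega>"
      using comb_linear[of c] \<omega> g.M.subspace_add[OF g.V_subspace] g.M.subspace_scale[OF g.V_subspace]
      unfolding linear_map_on_def by simp
    then have "\<omega> \<in> dual_space sv ?V" unfolding dual_space_def by (simp add: \<omega>_def)
    moreover have "\<omega> (?\<rho> x v) = 0" if "x \<in> um'" "v \<in> ?V" for x v
    proof -
      have "(\<Sum>i\<in>I'. c i * \<Omega> i (?\<rho> x v)) = 0"
      proof (rule sum.neutral, rule ballI)
        fix i assume "i \<in> I'"
        then have "\<Omega> i (?\<rho> x v) = 0" using b.\<Omega>_kills that I'(2) by blast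
        then show "c i * \<Omega> i (?\<rho> x v) = 0" by simp
      qed
      then show ?thesis using \<omega>[OF um'_V[OF that]] by simp
    qed
    ultimately have inv: "\<omega> \<in> dual_invariants sv ?\<rho> um' ?V" unfolding invariants by blast
    have p\<omega>: "least_term ?r ?Q (\<lambda>q. \<omega> (?v q)) p" using p \<omega>[OF g.sigvec_in] by simp
    then have nz: "\<omega> (?v p) \<noteq> 0" unfolding least_term_def by blast
    have "\<sigma> = sign_of r f ?\<rho> N \<Lambda> (vh \<Lambda>) \<omega>" unfolding sp by (rule g.sign_of_eq[OF order p\<omega>, symmetric])
    then have "\<sigma> \<in> \<Sigma>'"
      unfolding \<Sigma>' branching_semigroup_def using dominant inv nz g.sigvec_in by blast
    moreover have "\<exists>i\<in>I'. \<Omega> i (?v p) \<noteq> 0"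
    proof (rule ccontr)
      assume "\<not> ?thesis"
      then have "\<omega> (?v p) = 0" using \<omega>[OF g.sigvec_in] by simp
      then show False using nz by simp
    qed
    then have "rw p = \<Lambda>'" using weight unfolding I'_def by blast
    ultimately show "\<sigma> \<in> {\<sigma> \<in> \<Sigma>'. fst \<sigma> = \<Lambda> \<and> restrict (signature_weight t N \<alpha> \<sigma>) th = \<Lambda>'}"
      unfolding sp rw_def by simp
  qed
  moreover have "card (Pair \<Lambda> ` S) = card S" by (simp add: card_image inj_on_def)
  ultimately show ?thesis using S card_I' by simp
qed

end
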